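(* Let $(K,J,g)$ be a compact Kähler manifold of complex dimension $k$ and let $\psi$ be a Kähler isometry, i.e. $\psi$ is a holomorphic diffeomorphism of $K$ satisfying $\psi^*(g)=g$. Then the mapping torus $$M_f=(K\times\mathbb S^3)_f,\qquad f=(\psi,\mathrm{Id}_{\mathbb S^3}),$$ admits an SKT structure $(I,h)$.
   Context: For a smooth manifold $N$ and a diffeomorphism $f$ of $N$, the mapping torus $N_f$ is the quotient of $N\times\mathbb R$ by the $\mathbb Z$-action $n\cdot(p,t)=(f^n(p),t+n)$. Here $f=(\psi,\mathrm{Id}_{\mathbb S^3})$ is the diffeomorphism $(p,q)\mapsto(\psi(p),q)$ of $K\times\mathbb S^3$. An SKT structure $(I,h)$ on a smooth manifold consists of an integrable complex structure $I$ and an $I$-Hermitian (compatible Riemannian) metric $h$ whose fundamental form $\omega=h(I\cdot,\cdot)$ satisfies $dd^c\omega=0$, where $d^c\omega(X,Y,Z)=-d\omega(IX,IY,IZ)$ (equivalently $\partial\overline\partial\omega=0$). *)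

theory Defs
  imports "HOL-Analysis.Analysis"
begin

section \<open>Smooth maps between open subsets of finite-dimensional spaces\<close>

text \<open>On a finite-dimensional domain, continuity of all iterated directional derivatives
  is the usual notion of class \<open>C\<^sup>\<infinity>\<close>.\<close>

primrec Ck_on :: "nat \<Rightarrow> 'a::real_normed_vector set \<Rightarrow> ('a \<Rightarrow> 'b::real_normed_vector) \<Rightarrow> bool" where
  "Ck_on 0 S f \<longleftrightarrow> continuous_on S f"
| "Ck_on (Suc n) S f \<longleftrightarrow> (\<forall>x\<in>S. f differentiable (at x)) \<and>
     (\<forall>v. Ck_on n S (\<lambda>x. frechet_derivative f (at x) v))"

definition smooth_on :: "'a::real_normed_vector set \<Rightarrow> ('a \<Rightarrow> 'b::real_normed_vector) \<Rightarrow> bool" where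
  "smooth_on S f \<longleftrightarrow> (\<forall>n. Ck_on n S f)"


section \<open>Smooth manifolds\<close>

text \<open>A chart is a pair of a domain and a coordinate map; the values of the coordinate map
  outside the domain are irrelevant.  An atlas need not be maximal.\<close>

type_synonym ('a, 'e) chart = "'a set \<times> ('a \<Rightarrow> 'e)"

record ('a, 'e) manifold =
  topo :: "'a topology"
  atlas :: "('a, 'e) chart set"

definition is_chart :: "'a topology \<Rightarrow> ('a, 'e::real_inner) chart \<Rightarrow> bool" where
  "is_chart X c \<longleftrightarrow> openin X (fst c) \<and> open (snd c ` fst c) \<and>
     homeomorphic_map (subtopology X (fst c)) (top_of_set (snd c ` fst c)) (snd c)"

definition local_dom ::
  "('a \<Rightarrow> 'b) \<Rightarrow> ('a, 'e::real_inner) chart \<Rightarrow> ('b, 'f::real_inner) chart \<Rightarrow> 'e set" where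
  "local_dom f c d = snd c ` {p \<in> fst c. f p \<in> fst d}"

definition local_rep ::
  "('a \<Rightarrow> 'b) \<Rightarrow> ('a, 'e::real_inner) chart \<Rightarrow> ('b, 'f::real_inner) chart \<Rightarrow> 'e \<Rightarrow> 'f" where
  "local_rep f c d = snd d \<circ> f \<circ> inv_into (fst c) (snd c)"

text \<open>For \<open>f = id\<close> these are the domain of the transition map from \<open>c\<close> to \<open>d\<close> and the
  transition map itself.\<close>

definition smoothly_compatible :: "('a, 'e::real_inner) chart \<Rightarrow> ('a, 'e) chart \<Rightarrow> bool" where
  "smoothly_compatible c d \<longleftrightarrow>
     smooth_on (local_dom id c d) (local_rep id c d) \<and>
     smooth_on (local_dom id d c) (local_rep id d c)"

text \<open>The model space of an \<open>n\<close>-dimensional manifold is an \<open>n\<close>-dimensional real inner product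
  space, i.e. a copy of \<open>\<real>\<^sup>n\<close>.  Class \<open>euclidean_space\<close> would exclude \<open>n = 0\<close>.\<close>

definition smooth_manifold :: "nat \<Rightarrow> ('a, 'e::real_inner) manifold \<Rightarrow> bool" where
  "smooth_manifold n M \<longleftrightarrow>
     (\<exists>B :: 'e set. finite B \<and> independent B \<and> span B = UNIV \<and> card B = n) \<and>
     Hausdorff_space (topo M) \<and> second_countable (topo M) \<and>
     (\<forall>c\<in>atlas M. is_chart (topo M) c) \<and>
     (\<Union>c\<in>atlas M. fst c) = topspace (topo M) \<and>
     (\<forall>c\<in>atlas M. \<forall>d\<in>atlas M. smoothly_compatible c d)"

definition smooth_map ::
  "('a, 'e::real_inner) manifold \<Rightarrow> ('b, 'f::real_inner) manifold \<Rightarrow> ('a \<Rightarrow> 'b) \<Rightarrow> bool" where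
  "smooth_map M N f \<longleftrightarrow> continuous_map (topo M) (topo N) f \<and>
     (\<forall>c\<in>atlas M. \<forall>d\<in>atlas N. smooth_on (local_dom f c d) (local_rep f c d))"

definition diffeomorphism_of :: "('a, 'e::real_inner) manifold \<Rightarrow> ('a \<Rightarrow> 'a) \<Rightarrow> bool" where
  "diffeomorphism_of M f \<longleftrightarrow>
     bij_betw f (topspace (topo M)) (topspace (topo M)) \<and>
     smooth_map M M f \<and> smooth_map M M (inv_into (topspace (topo M)) f)"


section \<open>Tensor fields\<close>

text \<open>A tensor field on a manifold is given by its coordinate expressions: one smooth tensor
  field on the image of each chart, subject to the transformation law under the transition
  maps.  \<open>T c x\<close> is the expression in the chart \<open>c\<close> at the coordinate point \<open>x\<close>.\<close>

type_synonym ('a, 'e) endo_field = "('a, 'e) chart \<Rightarrow> 'e \<Rightarrow> 'e \<Rightarrow> 'e"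
type_synonym ('a, 'e) form2 = "('a, 'e) chart \<Rightarrow> 'e \<Rightarrow> 'e \<Rightarrow> 'e \<Rightarrow> real"
type_synonym ('a, 'e) form3 = "('a, 'e) chart \<Rightarrow> 'e \<Rightarrow> 'e \<Rightarrow> 'e \<Rightarrow> 'e \<Rightarrow> real"

text \<open>\<open>df \<circ> T = T \<circ> df\<close> in coordinates; for \<open>f = id\<close> this is the transformation law of a
  field of endomorphisms of the tangent bundle.\<close>

definition preserves_endo ::
  "('a, 'e::real_inner) manifold \<Rightarrow> ('a \<Rightarrow> 'a) \<Rightarrow> ('a, 'e) endo_field \<Rightarrow> bool" where
  "preserves_endo M f T \<longleftrightarrow>
     (\<forall>c\<in>atlas M. \<forall>d\<in>atlas M. \<forall>x\<in>local_dom f c d. \<forall>v.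
        frechet_derivative (local_rep f c d) (at x) (T c x v) =
        T d (local_rep f c d x) (frechet_derivative (local_rep f c d) (at x) v))"

text \<open>\<open>f\<^sup>* h = h\<close> in coordinates; for \<open>f = id\<close> this is the transformation law of a field of
  bilinear forms.\<close>

definition preserves_bilinear ::
  "('a, 'e::real_inner) manifold \<Rightarrow> ('a \<Rightarrow> 'a) \<Rightarrow> ('a, 'e) form2 \<Rightarrow> bool" where
  "preserves_bilinear M f h \<longleftrightarrow>
     (\<forall>c\<in>atlas M. \<forall>d\<in>atlas M. \<forall>x\<in>local_dom f c d. \<forall>u v.
        h d (local_rep f c d x)
          (frechet_derivative (local_rep f c d) (at x) u)
          (frechet_derivative (local_rep f c d) (at x) v) = h c x u v)"

definition smooth_endo_field ::
  "('a, 'e::real_inner) manifold \<Rightarrow> ('a, 'e) endo_field \<Rightarrow> bool" where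
  "smooth_endo_field M T \<longleftrightarrow>
     (\<forall>c\<in>atlas M. (\<forall>x\<in>snd c ` fst c. linear (T c x)) \<and>
        (\<forall>v. smooth_on (snd c ` fst c) (\<lambda>x. T c x v))) \<and>
     preserves_endo M id T"

definition riemannian_metric ::
  "('a, 'e::real_inner) manifold \<Rightarrow> ('a, 'e) form2 \<Rightarrow> bool" where
  "riemannian_metric M h \<longleftrightarrow>
     (\<forall>c\<in>atlas M.
        (\<forall>x\<in>snd c ` fst c. bilinear (h c x) \<and> (\<forall>u v. h c x u v = h c x v u) \<and>
           (\<forall>v. v \<noteq> 0 \<longrightarrow> h c x v v > 0)) \<and>
        (\<forall>u v. smooth_on (snd c ` fst c) (\<lambda>x. h c x u v))) \<and>
     preserves_bilinear M id h"


section \<open>Exterior derivative\<close>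

text \<open>The formula \<open>d\<alpha>(X\<^sub>0,\<dots>,X\<^sub>p) = \<Sum>\<^sub>i (-1)\<^sup>i X\<^sub>i(\<alpha>(X\<^sub>0,\<dots>,X\<^sub>i omitted,\<dots>,X\<^sub>p))\<close> for constant
  vector fields on an open subset of the model space, for \<open>p = 2\<close> and \<open>p = 3\<close>.\<close>

definition ext_deriv2 ::
  "('e::real_inner \<Rightarrow> 'e \<Rightarrow> 'e \<Rightarrow> real) \<Rightarrow> 'e \<Rightarrow> 'e \<Rightarrow> 'e \<Rightarrow> 'e \<Rightarrow> real" where
  "ext_deriv2 \<alpha> x u v w =
     frechet_derivative (\<lambda>y. \<alpha> y v w) (at x) u
   - frechet_derivative (\<lambda>y. \<alpha> y u w) (at x) v
   + frechet_derivative (\<lambda>y. \<alpha> y u v) (at x) w"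

definition ext_deriv3 ::
  "('e::real_inner \<Rightarrow> 'e \<Rightarrow> 'e \<Rightarrow> 'e \<Rightarrow> real) \<Rightarrow> 'e \<Rightarrow> 'e \<Rightarrow> 'e \<Rightarrow> 'e \<Rightarrow> 'e \<Rightarrow> real" where
  "ext_deriv3 \<beta> x u v w z =
     frechet_derivative (\<lambda>y. \<beta> y v w z) (at x) u
   - frechet_derivative (\<lambda>y. \<beta> y u w z) (at x) v
   + frechet_derivative (\<lambda>y. \<beta> y u v z) (at x) w
   - frechet_derivative (\<lambda>y. \<beta> y u v w) (at x) z"


section \<open>Complex, Kaehler and SKT structures\<close>

text \<open>An integrable complex structure: a smooth field \<open>J\<close> of endomorphisms with \<open>J\<^sup>2 = -1\<close> such
  that every point lies in the domain of a holomorphic coordinate chart, that is, a smooth chart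
  \<open>d\<close> with values in a complex vector space \<open>(E, J0)\<close> whose differential is complex linear.
  Here \<open>E\<close> is the model space and \<open>J0\<close> (a linear map with \<open>J0\<^sup>2 = -1\<close>) is its multiplication
  by \<open>i\<close>.\<close>

definition complex_structure ::
  "('a, 'e::real_inner) manifold \<Rightarrow> ('a, 'e) endo_field \<Rightarrow> bool" where
  "complex_structure M J \<longleftrightarrow> smooth_endo_field M J \<and>
     (\<forall>c\<in>atlas M. \<forall>x\<in>snd c ` fst c. \<forall>v. J c x (J c x v) = - v) \<and>
     (\<forall>p\<in>topspace (topo M). \<exists>d J0.
        is_chart (topo M) d \<and> p \<in> fst d \<and> (\<forall>c\<in>atlas M. smoothly_compatible c d) \<and>
        linear J0 \<and> (\<forall>v. J0 (J0 v) = - v) \<and>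
        (\<forall>c\<in>atlas M. \<forall>x\<in>local_dom id c d. \<forall>v.
           frechet_derivative (local_rep id c d) (at x) (J c x v) =
           J0 (frechet_derivative (local_rep id c d) (at x) v)))"

definition hermitian_metric ::
  "('a, 'e::real_inner) manifold \<Rightarrow> ('a, 'e) endo_field \<Rightarrow> ('a, 'e) form2 \<Rightarrow> bool" where
  "hermitian_metric M I h \<longleftrightarrow> riemannian_metric M h \<and>
     (\<forall>c\<in>atlas M. \<forall>x\<in>snd c ` fst c. \<forall>u v. h c x (I c x u) (I c x v) = h c x u v)"

definition fundamental_form ::
  "('a, 'e::real_inner) endo_field \<Rightarrow> ('a, 'e) form2 \<Rightarrow> ('a, 'e) form2" where
  "fundamental_form I h = (\<lambda>c x u v. h c x (I c x u) v)"

definition dc_form ::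
  "('a, 'e::real_inner) endo_field \<Rightarrow> ('a, 'e) form2 \<Rightarrow> ('a, 'e) form3" where
  "dc_form I \<omega> = (\<lambda>c x u v w. - ext_deriv2 (\<omega> c) x (I c x u) (I c x v) (I c x w))"

definition skt_structure ::
  "('a, 'e::real_inner) manifold \<Rightarrow> ('a, 'e) endo_field \<Rightarrow> ('a, 'e) form2 \<Rightarrow> bool" where
  "skt_structure M I h \<longleftrightarrow> complex_structure M I \<and> hermitian_metric M I h \<and>
     (\<forall>c\<in>atlas M. \<forall>x\<in>snd c ` fst c. \<forall>u v w z.
        ext_deriv3 (dc_form I (fundamental_form I h) c) x u v w z = 0)"

definition kaehler_manifold ::
  "nat \<Rightarrow> ('a, 'e::real_inner) manifold \<Rightarrow> ('a, 'e) endo_field \<Rightarrow> ('a, 'e) form2 \<Rightarrow> bool" where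
  "kaehler_manifold k K J g \<longleftrightarrow> smooth_manifold (2 * k) K \<and>
     complex_structure K J \<and> hermitian_metric K J g \<and>
     (\<forall>c\<in>atlas K. \<forall>x\<in>snd c ` fst c. \<forall>u v w.
        ext_deriv2 (fundamental_form J g c) x u v w = 0)"

definition kaehler_isometry ::
  "('a, 'e::real_inner) manifold \<Rightarrow> ('a, 'e) endo_field \<Rightarrow> ('a, 'e) form2 \<Rightarrow> ('a \<Rightarrow> 'a) \<Rightarrow> bool"
  where
  "kaehler_isometry K J g \<psi> \<longleftrightarrow>
     diffeomorphism_of K \<psi> \<and> preserves_endo K \<psi> J \<and> preserves_bilinear K \<psi> g"


section \<open>Products, the line, the three-sphere\<close>

definition prod_manifold ::
  "('a, 'e::real_inner) manifold \<Rightarrow> ('b, 'f::real_inner) manifold \<Rightarrow> ('a \<times> 'b, 'e \<times> 'f) manifold"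
  where
  "prod_manifold M N = \<lparr> topo = prod_topology (topo M) (topo N),
     atlas = {(fst c \<times> fst d, map_prod (snd c) (snd d)) | c d. c \<in> atlas M \<and> d \<in> atlas N} \<rparr>"

definition line_manifold :: "(real, real) manifold" where
  "line_manifold = \<lparr> topo = euclidean, atlas = {(UNIV, id)} \<rparr>"

text \<open>The unit sphere of \<open>\<real>\<^sup>3 \<times> \<real>\<close> with the stereographic projections from the poles
  \<open>(0, 1)\<close> and \<open>(0, -1)\<close>.\<close>

definition sphere3 :: "((real^3) \<times> real, real^3) manifold" where
  "sphere3 = \<lparr> topo = top_of_set (sphere 0 1),
     atlas = {(sphere 0 1 - {(0, 1)}, \<lambda>(y, s). y /\<^sub>R (1 - s)),
              (sphere 0 1 - {(0, -1)}, \<lambda>(y, s). y /\<^sub>R (1 + s))} \<rparr>"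


section \<open>Mapping tori\<close>

definition quotient_topology :: "'a topology \<Rightarrow> ('a \<Rightarrow> 'b) \<Rightarrow> 'b topology" where
  "quotient_topology X q =
     topology (\<lambda>S. S \<subseteq> q ` topspace X \<and> openin X {x \<in> topspace X. q x \<in> S})"

lemma openin_quotient_topology:
  "openin (quotient_topology X q) S \<longleftrightarrow>
     S \<subseteq> q ` topspace X \<and> openin X {x \<in> topspace X. q x \<in> S}"
proof -
  have Int: "{x \<in> topspace X. q x \<in> S \<inter> T} =
      {x \<in> topspace X. q x \<in> S} \<inter> {x \<in> topspace X. q x \<in> T}" for S T
    by auto
  have Union: "{x \<in> topspace X. q x \<in> \<Union>\<K>} = (\<Union>S\<in>\<K>. {x \<in> topspace X. q x \<in> S})" for \<K>
    by auto
  have "istopology (\<lambda>S. S \<subseteq> q ` topspace X \<and> openin X {x \<in> topspace X. q x \<in> S})"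
    unfolding istopology_def Int Union by (blast intro: openin_Int openin_Union)
  then show ?thesis
    unfolding quotient_topology_def by (simp add: topology_inverse')
qed

text \<open>The manifold structure on the base of a covering map \<open>q\<close> that makes \<open>q\<close> a local
  diffeomorphism: its charts are the charts of the total space, restricted to open sets on
  which \<open>q\<close> is injective and transported along \<open>q\<close>.\<close>

definition quotient_manifold ::
  "('a, 'e::real_inner) manifold \<Rightarrow> ('a \<Rightarrow> 'b) \<Rightarrow> ('b, 'e) manifold" where
  "quotient_manifold M q = \<lparr> topo = quotient_topology (topo M) q,
     atlas = {(q ` W, snd c \<circ> inv_into W q) | c W.
       c \<in> atlas M \<and> openin (topo M) W \<and> W \<subseteq> fst c \<and> inj_on q W} \<rparr>"

definition int_funpow :: "'a set \<Rightarrow> ('a \<Rightarrow> 'a) \<Rightarrow> int \<Rightarrow> 'a \<Rightarrow> 'a" where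
  "int_funpow S f n = (if n \<ge> 0 then f ^^ nat n else inv_into S f ^^ nat (- n))"

definition mapping_torus_orbit :: "'a set \<Rightarrow> ('a \<Rightarrow> 'a) \<Rightarrow> 'a \<times> real \<Rightarrow> ('a \<times> real) set" where
  "mapping_torus_orbit S f = (\<lambda>(p, t). {(int_funpow S f n p, t + of_int n) | n. n \<in> UNIV})"

definition mapping_torus ::
  "('a, 'e::real_inner) manifold \<Rightarrow> ('a \<Rightarrow> 'a) \<Rightarrow> (('a \<times> real) set, 'e \<times> real) manifold" where
  "mapping_torus N f =
     quotient_manifold (prod_manifold N line_manifold)
       (mapping_torus_orbit (topspace (topo N)) f)"

end

theory Submission
  imports Defs
begin

text \<open>
  The map \<open>(q, t) \<mapsto> e\<^sup>t q\<close> identifies \<open>S\<^sup>3 \<times> \<real>\<close> with \<open>\<complex>\<^sup>2 - {0}\<close>.  The complex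
  structure of \<open>\<complex>\<^sup>2\<close> and the flat metric divided by the squared distance from the origin turn
  \<open>S\<^sup>3 \<times> \<real>\<close> into a Hermitian manifold, whose metric is the product of the round metric and
  \<open>dt\<^sup>2\<close> (\<open>hopf_embed_holomorphic\<close>, \<open>hopf_embed_conformal\<close>).  With \<open>\<eta>\<close> the one-form dual to
  the Hopf field, the fundamental form is \<open>dt \<and> \<eta> + d\<eta>/2\<close>, hence its differential is
  \<open>- dt \<and> d\<eta>\<close>, and \<open>d\<^sup>c\<close> of it is \<open>- \<eta> \<and> d\<eta>\<close>, a constant multiple of the volume form of
  \<open>S\<^sup>3\<close> (\<open>ext_deriv2_hopf_omega_I\<close>).  That form is closed for reasons of dimension
  (\<open>conf_volume_closed\<close>): this is the SKT condition on \<open>S\<^sup>3 \<times> \<real>\<close>.  On the product with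
  \<open>K\<close> the Kaehler form is closed and contributes nothing to the torsion, so
  \<open>K \<times> S\<^sup>3 \<times> \<real>\<close> is SKT (\<open>cover_skt_structure\<close>).

  The mapping torus is the quotient of \<open>K \<times> S\<^sup>3 \<times> \<real>\<close> by the powers of
  \<open>(p, q, t) \<mapsto> (\<psi> p, q, t + 1)\<close>.  The first factor of this map preserves the Kaehler structure
  by assumption; the second, multiplication by \<open>e\<close> on \<open>\<complex>\<^sup>2 - {0}\<close>, is a holomorphic isometry
  (\<open>cover_map_hermitian\<close>).  The action is free and properly discontinuous
  (\<open>mapping_torus_is_deck_quotient\<close>), so the quotient is a manifold
  (\<open>quotient_smooth_manifold\<close>) to which the invariant structure descends
  (\<open>descend_skt_structure\<close>).

  All tensor fields are given by coordinate expressions.  On \<open>S\<^sup>3\<close> the two stereographic charts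
  are treated together, a sign \<open>\<epsilon>\<close> telling from which pole the projection is made; in these
  coordinates the Hopf structure is rational, and the identities above become polynomial ones.
\<close>

section \<open>Calculus of smooth maps\<close>

lemma frechet_derivative_cong_open:
  assumes "open S" "x \<in> S" "\<And>y. y \<in> S \<Longrightarrow> f y = g y"
  shows "frechet_derivative f (at x) = frechet_derivative g (at x)"
proof -
  have "(f has_derivative f') (at x) \<longleftrightarrow> (g has_derivative f') (at x)" for f'
    using has_derivative_transform_within_open[of f f' x UNIV S g]
      has_derivative_transform_within_open[of g f' x UNIV S f] assms by auto
  then show ?thesis unfolding frechet_derivative_def by simp
qed

lemma Ck_on_cong:
  assumes "open S" "\<And>x. x \<in> S \<Longrightarrow> f x = g x" "Ck_on n S f"
  shows "Ck_on n S g"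
  using assms(2,3)
proof (induction n arbitrary: f g)
  case 0
  then show ?case by (simp cong: continuous_on_cong)
next
  case (Suc n)
  have "g differentiable at x" if "x \<in> S" for x
  proof -
    have "f differentiable at x" using Suc.prems(2) that by simp
    then obtain D where "(f has_derivative D) (at x)" by (auto simp: differentiable_def)
    then have "(g has_derivative D) (at x)"
      by (rule has_derivative_transform_within_open[OF _ assms(1) that Suc.prems(1)])
    then show ?thesis by (auto simp: differentiable_def)
  qed
  moreover have "Ck_on n S (\<lambda>x. frechet_derivative g (at x) v)" for v
  proof (rule Suc.IH)
    show "frechet_derivative f (at x) v = frechet_derivative g (at x) v" if "x \<in> S" for x
      using frechet_derivative_cong_open[OF assms(1) that] Suc.prems(1) by metis
  qed (use Suc.prems in simp)
  ultimately show ?case by simp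
qed

lemma Ck_on_SucI:
  assumes "open S" "\<And>x. x \<in> S \<Longrightarrow> (f has_derivative f' x) (at x)"
    "\<And>v. Ck_on n S (\<lambda>x. f' x v)"
  shows "Ck_on (Suc n) S f"
proof -
  have "Ck_on n S (\<lambda>x. frechet_derivative f (at x) v)" for v
    by (rule Ck_on_cong[OF assms(1) _ assms(3)[of v]])
      (simp add: frechet_derivative_at[OF assms(2), symmetric])
  then show ?thesis using assms(2) by (auto simp: differentiable_def)
qed

lemma Ck_on_subset: "Ck_on n S f \<Longrightarrow> T \<subseteq> S \<Longrightarrow> Ck_on n T f"
  by (induction n arbitrary: f) (auto intro: continuous_on_subset)

lemma Ck_on_Suc_imp: "Ck_on (Suc n) S f \<Longrightarrow> Ck_on n S f"
proof (induction n arbitrary: f)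
  case 0
  then show ?case
    by (auto intro!: continuous_at_imp_continuous_on differentiable_imp_continuous_within)
next
  case (Suc n)
  then show ?case by (metis Ck_on.simps(2))
qed

lemma Ck_on_has_derivative:
  "Ck_on (Suc n) S f \<Longrightarrow> x \<in> S \<Longrightarrow> (f has_derivative frechet_derivative f (at x)) (at x)"
  by (simp add: frechet_derivative_works)

lemma Ck_on_local:
  assumes "\<And>x. x \<in> S \<Longrightarrow> \<exists>U. open U \<and> x \<in> U \<and> Ck_on n U f"
  shows "Ck_on n S f"
  using assms
proof (induction n arbitrary: f)
  case 0
  then have "isCont f x" if "x \<in> S" for x
    using that by (fastforce simp: continuous_on_eq_continuous_at)
  then show ?case by (simp add: continuous_at_imp_continuous_on)
next
  case (Suc n)
  have "f differentiable at x" if "x \<in> S" for x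
    using Suc.prems[OF that] by auto
  moreover have "Ck_on n S (\<lambda>x. frechet_derivative f (at x) v)" for v
    by (rule Suc.IH) (use Suc.prems in force)
  ultimately show ?case by simp
qed

lemma Ck_on_const: "Ck_on n S (\<lambda>x. c)"
  by (induction n arbitrary: c) auto

lemma Ck_on_bounded_linear_compose:
  assumes "bounded_linear L" "open S" "Ck_on n S f"
  shows "Ck_on n S (\<lambda>x. L (f x))"
  using assms(3)
proof (induction n arbitrary: f)
  case 0
  then show ?case using bounded_linear.continuous_on[OF assms(1)] by auto
next
  case (Suc n)
  have "Ck_on n S (\<lambda>x. frechet_derivative f (at x) v)" for v using Suc.prems by simp
  then show ?case
    by (intro Ck_on_SucI[OF assms(2) bounded_linear.has_derivative[OF assms(1)
            Ck_on_has_derivative[OF Suc.prems]]] Suc.IH)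
qed

lemma Ck_on_id: "Ck_on n S (\<lambda>x. x)"
  by (cases n) (auto simp: Ck_on_const)

lemma Ck_on_add:
  assumes "open S" "Ck_on n S f" "Ck_on n S g"
  shows "Ck_on n S (\<lambda>x. f x + g x)"
  using assms(2,3)
proof (induction n arbitrary: f g)
  case 0
  then show ?case by (auto intro: continuous_on_add)
next
  case (Suc n)
  have "Ck_on n S (\<lambda>x. frechet_derivative f (at x) v)"
    "Ck_on n S (\<lambda>x. frechet_derivative g (at x) v)" for v using Suc.prems by auto
  then show ?case
    by (intro Ck_on_SucI[OF assms(1) has_derivative_add[OF Ck_on_has_derivative[OF Suc.prems(1)]
            Ck_on_has_derivative[OF Suc.prems(2)]]] Suc.IH)
qed

lemma Ck_on_bounded_bilinear:
  assumes b: "bounded_bilinear p" and "open S" "Ck_on n S f" "Ck_on n S g"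
  shows "Ck_on n S (\<lambda>x. p (f x) (g x))"
  using assms(3,4)
proof (induction n arbitrary: f g)
  case 0
  then show ?case by (auto intro: bounded_bilinear.continuous_on[OF b])
next
  case (Suc n)
  have "Ck_on n S (\<lambda>x. frechet_derivative f (at x) v)"
    "Ck_on n S (\<lambda>x. frechet_derivative g (at x) v)" for v using Suc.prems by auto
  then show ?case
    by (intro Ck_on_SucI[OF assms(2) bounded_bilinear.FDERIV[OF b
            Ck_on_has_derivative[OF Suc.prems(1)] Ck_on_has_derivative[OF Suc.prems(2)]]]
          Suc.IH Ck_on_add assms(2) Suc.prems[THEN Ck_on_Suc_imp])
qed

lemma Ck_on_sum:
  assumes "open S" "\<And>i. i \<in> I \<Longrightarrow> Ck_on n S (f i)"
  shows "Ck_on n S (\<lambda>x. \<Sum>i\<in>I. f i x)"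
  using assms(2)
  by (induction I rule: infinite_finite_induct) (auto simp: Ck_on_const intro!: Ck_on_add assms(1))

text \<open>A model space is a real inner product space without a distinguished basis.  A finite orthonormal
  spanning set takes that role: a linear map is determined, with explicit coefficients, by its
  finitely many values there.\<close>

definition onb :: "'e::real_inner set \<Rightarrow> bool" where
  "onb B \<longleftrightarrow> finite B \<and> pairwise orthogonal B \<and> (\<forall>b\<in>B. norm b = 1) \<and> span B = UNIV"

lemma onb_expansion:
  assumes "onb B" shows "x = (\<Sum>b\<in>B. (x \<bullet> b) *\<^sub>R b)"
proof -
  let ?y = "x - (\<Sum>b\<in>B. (x \<bullet> b) *\<^sub>R b)"
  have o: "b \<bullet> c = (if b = c then 1 else 0)" if "b \<in> B" "c \<in> B" for b c
  proof (cases "b = c")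
    case True
    then show ?thesis using assms that by (simp add: onb_def norm_eq_1)
  next
    case False
    then show ?thesis using assms that unfolding onb_def pairwise_def orthogonal_def by simp
  qed
  have "?y \<bullet> c = 0" if "c \<in> B" for c
  proof -
    have fin: "finite B" using assms by (simp add: onb_def)
    have "(\<Sum>b\<in>B. (x \<bullet> b) *\<^sub>R b) \<bullet> c = (\<Sum>b\<in>B. if b = c then x \<bullet> b else 0)"
      unfolding inner_sum_left by (rule sum.cong) (simp_all add: o that)
    also have "\<dots> = x \<bullet> c" using that fin by simp
    finally show ?thesis by (simp add: inner_diff_left)
  qed
  then have "orthogonal ?y c" if "c \<in> B" for c using that by (simp add: orthogonal_def)
  then have "orthogonal ?y ?y"
  proof (rule orthogonal_to_span[rotated])
    have "span B = UNIV" using assms unfolding onb_def by blast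
    then show "?y \<in> span B" by (simp only: UNIV_I)
  qed
  then have "?y = 0" by (simp only: orthogonal_self)
  then show ?thesis by (rule eq_iff_diff_eq_0[THEN iffD2])
qed

lemma onb_linear_expansion:
  assumes "onb B" "linear L" shows "L x = (\<Sum>b\<in>B. (x \<bullet> b) *\<^sub>R L b)"
proof -
  have "L x = L (\<Sum>b\<in>B. (x \<bullet> b) *\<^sub>R b)" by (rule arg_cong[OF onb_expansion[OF assms(1)]])
  also have "\<dots> = (\<Sum>b\<in>B. (x \<bullet> b) *\<^sub>R L b)"
    unfolding linear_sum[OF assms(2)] linear_scale[OF assms(2)] ..
  finally show ?thesis .
qed

lemma onb_independent:
  assumes "onb B" shows "independent B"
  by (rule pairwise_orthogonal_independent) (use assms in \<open>auto simp: onb_def\<close>)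

lemma onb_exists:
  fixes B :: "'e::real_inner set"
  assumes "finite B" "span B = UNIV"
  shows "\<exists>C::'e set. onb C"
proof -
  obtain C where C: "finite C" "span C = span B" "pairwise orthogonal C"
    using basis_orthogonal[OF assms(1)] by blast
  let ?D = "C - {0}"
  let ?E = "(\<lambda>x. x /\<^sub>R norm x) ` ?D"
  have "span ?D = UNIV" using C(2) assms(2) by (simp add: span_delete_0)
  moreover have "?D \<subseteq> span ?E"
  proof
    fix x assume x: "x \<in> ?D"
    then have "norm x *\<^sub>R (x /\<^sub>R norm x) \<in> span ?E" by (intro span_scale span_base) blast
    then show "x \<in> span ?E" using x by simp
  qed
  moreover from this have "span ?D \<subseteq> span ?E" by (rule span_minimal[OF _ subspace_span])
  ultimately have "span ?E = UNIV" by auto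
  moreover have "pairwise orthogonal ?E"
    using C(3) by (auto simp: pairwise_def orthogonal_def)
  moreover have "norm y = 1" if "y \<in> ?E" for y using that by (auto simp: field_simps split: if_splits)
  ultimately have "onb ?E" using C(1) unfolding onb_def by blast
  then show ?thesis by blast
qed

lemma onb_card:
  fixes B C :: "'e::real_inner set"
  assumes "onb B" "finite C" "independent C" "span C = UNIV"
  shows "card B = card C"
proof (rule antisym)
  have fin: "finite B" "span B = UNIV" using assms(1) by (auto simp: onb_def)
  show "card B \<le> card C"
    using real_vector.independent_span_bound[OF assms(2) onb_independent[OF assms(1)]] assms(4) by simp
  show "card C \<le> card B"
    using real_vector.independent_span_bound[OF fin(1) assms(3)] fin(2) by simp
qed

lemma onb_Basis: "onb (Basis :: 'e::euclidean_space set)"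
  unfolding onb_def pairwise_def orthogonal_def by (simp add: inner_not_same_Basis)

lemma onb_Times:
  assumes B: "onb B" and C: "onb C"
  shows "onb ((\<lambda>b. (b, 0)) ` B \<union> Pair 0 ` C)" (is "onb (?B \<union> ?C)")
    and "card ((\<lambda>b. (b, 0)) ` B \<union> Pair 0 ` C) = card B + card C"
proof -
  have "z \<in> span (?B \<union> ?C)" for z
  proof -
    have 1: "(\<Sum>b\<in>B. (fst z \<bullet> b) *\<^sub>R b) = fst z" "(\<Sum>c\<in>C. (snd z \<bullet> c) *\<^sub>R c) = snd z"
      using onb_expansion[OF B] onb_expansion[OF C] by metis+
    have "(\<Sum>b\<in>B. (fst z \<bullet> b) *\<^sub>R (b, 0)) + (\<Sum>c\<in>C. (snd z \<bullet> c) *\<^sub>R (0, c)) = z"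
      by (rule prod_eqI) (simp_all add: fst_sum snd_sum 1)
    moreover have "(\<Sum>b\<in>B. (fst z \<bullet> b) *\<^sub>R (b, 0)) + (\<Sum>c\<in>C. (snd z \<bullet> c) *\<^sub>R (0, c)) \<in> span (?B \<union> ?C)"
      by (intro span_add span_sum span_scale span_base) auto
    ultimately show ?thesis by simp
  qed
  then have "span (?B \<union> ?C) = UNIV" by blast
  moreover have "pairwise orthogonal (?B \<union> ?C)"
    using B C unfolding onb_def pairwise_def orthogonal_def by force
  moreover have "norm z = 1" if "z \<in> ?B \<union> ?C" for z
    using that B C by (auto simp: onb_def norm_Pair)
  moreover have fin: "finite B" "finite C" using B C by (auto simp: onb_def)
  ultimately show "onb (?B \<union> ?C)" by (simp add: onb_def)
  have "0 \<notin> B" using B by (auto simp: onb_def)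
  then have "?B \<inter> ?C = {}" by auto
  then show "card (?B \<union> ?C) = card B + card C"
    using fin by (simp add: card_Un_disjoint card_image inj_on_def)
qed

text \<open>Differentiating \<open>g \<circ> f\<close> produces \<open>Dg\<close> at a direction that varies with the point;
  expanding that direction in an orthonormal basis returns to derivatives in fixed directions,
  to which the induction hypothesis applies.\<close>

lemma Ck_on_compose:
  fixes f :: "'a::real_normed_vector \<Rightarrow> 'e::real_inner" and g :: "'e \<Rightarrow> 'b::real_normed_vector"
  assumes B: "onb (B :: 'e set)" and S: "open S" and T: "f ` S \<subseteq> T"
    and "Ck_on n S f" "Ck_on n T g"
  shows "Ck_on n S (\<lambda>x. g (f x))"
  using assms(4,5)
proof (induction n arbitrary: g)
  case 0
  then show ?case using T continuous_on_compose2[of T g S f] by simp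
next
  case (Suc n)
  have df: "(f has_derivative frechet_derivative f (at x)) (at x)" if "x \<in> S" for x
    using Ck_on_has_derivative[OF Suc.prems(1) that] .
  have dg: "(g has_derivative frechet_derivative g (at (f x))) (at (f x))" if "x \<in> S" for x
    by (rule Ck_on_has_derivative[OF Suc.prems(2)]) (use that T in blast)
  show ?case
  proof (rule Ck_on_SucI[OF S])
    fix x assume x: "x \<in> S"
    have "((\<lambda>x. g (f x)) has_derivative
        (\<lambda>v. frechet_derivative g (at (f x)) (frechet_derivative f (at x) v))) (at x)"
      using diff_chain_at[OF df[OF x] dg[OF x]] by (simp add: o_def)
    then show "((\<lambda>x. g (f x)) has_derivative (\<lambda>v. \<Sum>b\<in>B. (frechet_derivative f (at x) v \<bullet> b) *\<^sub>R
        frechet_derivative g (at (f x)) b)) (at x)"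
      by (rule has_derivative_eq_rhs)
        (rule ext, rule onb_linear_expansion[OF B has_derivative_linear[OF dg[OF x]]])
  next
    fix v
    have "Ck_on n S (\<lambda>x. frechet_derivative g (at (f x)) b)" for b
      by (rule Suc.IH) (use Suc.prems(2) Ck_on_Suc_imp[OF Suc.prems(1)] in simp_all)
    moreover have "Ck_on n S (\<lambda>x. frechet_derivative f (at x) v \<bullet> b)" for b
      by (rule Ck_on_bounded_linear_compose[OF bounded_linear_inner_left S])
        (use Suc.prems in auto)
    ultimately show "Ck_on n S (\<lambda>x. \<Sum>b\<in>B. (frechet_derivative f (at x) v \<bullet> b) *\<^sub>R
        frechet_derivative g (at (f x)) b)"
      by (intro Ck_on_sum[OF S] Ck_on_bounded_bilinear[OF bounded_bilinear_scaleR S])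
  qed
qed

lemma Ck_on_inverse: "Ck_on n (- {0::real}) inverse"
proof (induction n)
  case 0
  then show ?case by (auto intro!: continuous_intros)
next
  case (Suc n)
  have o: "open (- {0::real})" by auto
  note m = Ck_on_bounded_bilinear[OF bounded_bilinear_mult o]
  have "Ck_on n (- {0}) (\<lambda>x::real. (-1) * (inverse x * v * inverse x))" for v
    by (intro m Suc Ck_on_const)
  then show ?case
    by (intro Ck_on_SucI[OF o, where f' = "\<lambda>x v. - (inverse x * v * inverse x)"])
       (auto intro: has_derivative_inverse')
qed

lemma Ck_on_exp: "Ck_on n UNIV (exp :: real \<Rightarrow> real)"
proof (induction n)
  case 0
  then show ?case by (auto intro!: continuous_intros)
next
  case (Suc n)
  show ?case
    by (intro Ck_on_SucI[where f' = "\<lambda>x v. v * exp x"])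
       (auto intro!: derivative_eq_intros Ck_on_bounded_bilinear[OF bounded_bilinear_mult]
         Suc Ck_on_const)
qed

lemma Ck_on_ln: "Ck_on n {0<..} (ln :: real \<Rightarrow> real)"
proof (cases n)
  case 0
  then show ?thesis by (auto intro!: continuous_intros)
next
  case (Suc m)
  have "Ck_on m {0<..} (inverse :: real \<Rightarrow> real)"
    by (rule Ck_on_subset[OF Ck_on_inverse]) auto
  then have "Ck_on m {0<..} (\<lambda>x::real. v * inverse x)" for v
    by (intro Ck_on_bounded_bilinear[OF bounded_bilinear_mult] Ck_on_const) auto
  then show ?thesis unfolding Suc
    by (intro Ck_on_SucI[where f' = "\<lambda>x v. v * inverse x"])
       (auto intro!: derivative_eq_intros simp: divide_inverse)
qed

subsection \<open>Smooth maps on open sets\<close>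

lemma smooth_on_cong:
  assumes "open S" "\<And>x. x \<in> S \<Longrightarrow> f x = g x" "smooth_on S f"
  shows "smooth_on S g"
  using Ck_on_cong[OF assms(1,2)] assms(3) by (simp add: smooth_on_def)

lemma smooth_on_subset: "smooth_on S f \<Longrightarrow> T \<subseteq> S \<Longrightarrow> smooth_on T f"
  unfolding smooth_on_def using Ck_on_subset by blast

lemma smooth_on_local:
  assumes "\<And>x. x \<in> S \<Longrightarrow> \<exists>U. open U \<and> x \<in> U \<and> smooth_on U f"
  shows "smooth_on S f"
  unfolding smooth_on_def
proof
  show "Ck_on n S f" for n
    by (rule Ck_on_local) (use assms in \<open>auto simp: smooth_on_def\<close>)
qed

lemma smooth_on_has_derivative:
  "smooth_on S f \<Longrightarrow> x \<in> S \<Longrightarrow> (f has_derivative frechet_derivative f (at x)) (at x)"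
  unfolding smooth_on_def using Ck_on_has_derivative by blast

lemma smooth_on_imp_continuous_on: "smooth_on S f \<Longrightarrow> continuous_on S f"
  unfolding smooth_on_def by (metis Ck_on.simps(1))

lemma smooth_on_compose:
  fixes f :: "'a::real_normed_vector \<Rightarrow> 'e::real_inner" and g :: "'e \<Rightarrow> 'b::real_normed_vector"
  assumes "onb (B :: 'e set)" "open S" "f ` S \<subseteq> T" "smooth_on S f" "smooth_on T g"
  shows "smooth_on S (\<lambda>x. g (f x))"
  unfolding smooth_on_def
proof
  show "Ck_on n S (\<lambda>x. g (f x))" for n
    by (rule Ck_on_compose[OF assms(1-3)]) (use assms(4,5) in \<open>auto simp: smooth_on_def\<close>)
qed

named_theorems smooth_intros

lemma smooth_on_const [smooth_intros]: "smooth_on S (\<lambda>x. c)"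
  unfolding smooth_on_def using Ck_on_const by blast

lemma smooth_on_id [smooth_intros]: "smooth_on S (\<lambda>x. x)"
  unfolding smooth_on_def using Ck_on_id by blast

lemma smooth_on_bounded_linear:
  "bounded_linear L \<Longrightarrow> open S \<Longrightarrow> smooth_on S f \<Longrightarrow> smooth_on S (\<lambda>x. L (f x))"
  unfolding smooth_on_def by (auto intro: Ck_on_bounded_linear_compose)

lemma smooth_on_bounded_bilinear:
  "bounded_bilinear p \<Longrightarrow> open S \<Longrightarrow> smooth_on S f \<Longrightarrow> smooth_on S g \<Longrightarrow>
    smooth_on S (\<lambda>x. p (f x) (g x))"
  unfolding smooth_on_def by (auto intro: Ck_on_bounded_bilinear)

lemma smooth_on_add [smooth_intros]:
  "open S \<Longrightarrow> smooth_on S f \<Longrightarrow> smooth_on S g \<Longrightarrow> smooth_on S (\<lambda>x. f x + g x)"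
  unfolding smooth_on_def by (auto intro: Ck_on_add)

lemma smooth_on_sum [smooth_intros]:
  "open S \<Longrightarrow> (\<And>i. i \<in> I \<Longrightarrow> smooth_on S (f i)) \<Longrightarrow> smooth_on S (\<lambda>x. \<Sum>i\<in>I. f i x)"
  unfolding smooth_on_def by (auto intro: Ck_on_sum)

lemmas smooth_on_scaleR [smooth_intros] = smooth_on_bounded_bilinear[OF bounded_bilinear_scaleR]
lemmas smooth_on_mult [smooth_intros] =
  smooth_on_bounded_bilinear[OF bounded_bilinear_mult[where 'a = real]]
lemmas smooth_on_inner [smooth_intros] = smooth_on_bounded_bilinear[OF bounded_bilinear_inner]
lemmas smooth_on_fst [smooth_intros] = smooth_on_bounded_linear[OF bounded_linear_fst]
lemmas smooth_on_snd [smooth_intros] = smooth_on_bounded_linear[OF bounded_linear_snd]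
lemmas smooth_on_minus [smooth_intros] =
  smooth_on_bounded_linear[OF bounded_linear_minus[OF bounded_linear_ident]]

lemma smooth_on_diff [smooth_intros]:
  "open S \<Longrightarrow> smooth_on S f \<Longrightarrow> smooth_on S g \<Longrightarrow> smooth_on S (\<lambda>x. f x - g x)"
  using smooth_on_add[OF _ _ smooth_on_minus, of S f g] by simp

lemma smooth_on_Pair [smooth_intros]:
  assumes "open S" "smooth_on S f" "smooth_on S g"
  shows "smooth_on S (\<lambda>x. (f x, g x))"
proof -
  have "bounded_linear (\<lambda>y. (y, 0))" "bounded_linear (Pair 0)"
    by (auto intro!: bounded_linear_Pair bounded_linear_ident bounded_linear_zero)
  then have "smooth_on S (\<lambda>x. (f x, 0) + (0, g x))"
    using assms by (intro smooth_on_add) (auto intro: smooth_on_bounded_linear)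
  then show ?thesis by simp
qed

lemma smooth_on_real_compose:
  fixes f :: "'a::real_normed_vector \<Rightarrow> real"
  shows "smooth_on T g \<Longrightarrow> open S \<Longrightarrow> smooth_on S f \<Longrightarrow> f ` S \<subseteq> T \<Longrightarrow> smooth_on S (\<lambda>x. g (f x))"
  by (rule smooth_on_compose[OF onb_Basis])

lemma smooth_on_inverse [smooth_intros]:
  fixes f :: "'a::real_normed_vector \<Rightarrow> real"
  assumes "open S" "smooth_on S f" "\<And>x. x \<in> S \<Longrightarrow> f x \<noteq> 0"
  shows "smooth_on S (\<lambda>x. inverse (f x))"
  by (rule smooth_on_real_compose[of "- {0}"])
    (use assms Ck_on_inverse in \<open>auto simp: smooth_on_def\<close>)

lemma smooth_on_divide [smooth_intros]:
  fixes f :: "'a::real_normed_vector \<Rightarrow> real"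
  assumes "open S" "smooth_on S f" "smooth_on S g" "\<And>x. x \<in> S \<Longrightarrow> g x \<noteq> 0"
  shows "smooth_on S (\<lambda>x. f x / g x)"
  unfolding divide_inverse using assms by (intro smooth_intros)

lemma smooth_on_exp [smooth_intros]:
  fixes f :: "'a::real_normed_vector \<Rightarrow> real"
  assumes "open S" "smooth_on S f"
  shows "smooth_on S (\<lambda>x. exp (f x))"
  by (rule smooth_on_real_compose[of UNIV])
    (use assms Ck_on_exp in \<open>auto simp: smooth_on_def\<close>)

lemma smooth_on_ln [smooth_intros]:
  fixes f :: "'a::real_normed_vector \<Rightarrow> real"
  assumes "open S" "smooth_on S f" "\<And>x. x \<in> S \<Longrightarrow> f x > 0"
  shows "smooth_on S (\<lambda>x. ln (f x))"
  by (rule smooth_on_real_compose[of "{0<..}"])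
    (use assms Ck_on_ln in \<open>auto simp: smooth_on_def\<close>)

lemma smooth_on_power [smooth_intros]:
  fixes f :: "'a::real_normed_vector \<Rightarrow> real"
  assumes "open S" "smooth_on S f"
  shows "smooth_on S (\<lambda>x. f x ^ n)"
  by (induction n) (auto intro!: smooth_intros assms)

section \<open>Charts and coordinate representations\<close>

abbreviation chart_inv :: "('a, 'e) chart \<Rightarrow> 'e \<Rightarrow> 'a" where
  "chart_inv c \<equiv> inv_into (fst c) (snd c)"

abbreviation smooth_rep ::
  "('a \<Rightarrow> 'b) \<Rightarrow> ('a, 'e::real_inner) chart \<Rightarrow> ('b, 'f::real_inner) chart \<Rightarrow> bool" where
  "smooth_rep f c d \<equiv> smooth_on (local_dom f c d) (local_rep f c d)"

abbreviation local_deriv ::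
  "('a \<Rightarrow> 'b) \<Rightarrow> ('a, 'e::real_inner) chart \<Rightarrow> ('b, 'f::real_inner) chart \<Rightarrow> 'e \<Rightarrow> 'e \<Rightarrow> 'f" where
  "local_deriv f c d x \<equiv> frechet_derivative (local_rep f c d) (at x)"

lemma is_chart_openin: "is_chart X c \<Longrightarrow> openin X (fst c)"
  by (simp add: is_chart_def)

lemma is_chart_subset: "is_chart X c \<Longrightarrow> fst c \<subseteq> topspace X"
  by (simp add: is_chart_openin openin_subset)

lemma is_chart_inj: "is_chart X c \<Longrightarrow> inj_on (snd c) (fst c)"
  using is_chart_subset[of X c] homeomorphic_imp_injective_map
  by (fastforce simp: is_chart_def topspace_subtopology Int_absorb1)

lemma is_chart_open_image:
  assumes "is_chart X c" "openin X U" "U \<subseteq> fst c"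
  shows "open (snd c ` U)"
proof -
  have "open_map (subtopology X (fst c)) (top_of_set (snd c ` fst c)) (snd c)"
    using assms(1) by (auto simp: is_chart_def homeomorphic_eq_everything_map)
  moreover have "openin (subtopology X (fst c)) U"
    using assms by (simp add: openin_open_subtopology is_chart_openin)
  ultimately have "openin (top_of_set (snd c ` fst c)) (snd c ` U)"
    by (simp add: open_map_def)
  then show ?thesis using assms(1) openin_open_trans by (auto simp: is_chart_def)
qed

lemma is_chart_openin_preimage:
  assumes "is_chart X c" "open T"
  shows "openin X {p \<in> fst c. snd c p \<in> T}"
proof -
  have ts: "topspace (subtopology X (fst c)) = fst c"
    using is_chart_subset[OF assms(1)] by auto
  have "continuous_map (subtopology X (fst c)) euclidean (snd c)"
    using assms(1) unfolding is_chart_def homeomorphic_eq_everything_map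
    by (simp add: continuous_map_in_subtopology)
  then have "openin (subtopology X (fst c)) {p \<in> topspace (subtopology X (fst c)). snd c p \<in> T}"
    by (rule openin_continuous_map_preimage) (use assms in simp)
  then show ?thesis
    unfolding ts openin_open_subtopology[OF is_chart_openin[OF assms(1)]] by (rule conjunct1)
qed

text \<open>Openness of the coordinate map replaces continuity of its inverse, so that no formula for the
  inverse is required.\<close>

lemma is_chartI:
  assumes U: "openin X U" and inj: "inj_on \<phi> U"
    and cont: "\<And>T. open T \<Longrightarrow> openin X {p \<in> U. \<phi> p \<in> T}"
    and op: "\<And>V. openin X V \<Longrightarrow> V \<subseteq> U \<Longrightarrow> open (\<phi> ` V)"
  shows "is_chart X (U, \<phi>)"
proof -
  have ts: "topspace (subtopology X U) = U" using openin_subset[OF U] by auto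
  have "continuous_map (subtopology X U) (top_of_set (\<phi> ` U)) \<phi>"
    unfolding continuous_map_in_subtopology
    using cont ts U by (auto simp: continuous_map_def openin_open_subtopology)
  moreover have "open_map (subtopology X U) (top_of_set (\<phi> ` U)) \<phi>"
    using U op by (auto simp: open_map_def openin_open_subtopology open_subset image_mono)
  ultimately have "homeomorphic_map (subtopology X U) (top_of_set (\<phi> ` U)) \<phi>"
    using ts inj by (intro bijective_open_imp_homeomorphic_map) auto
  then show ?thesis using U op by (simp add: is_chart_def)
qed

lemma chart_inv_chart: "is_chart X c \<Longrightarrow> p \<in> fst c \<Longrightarrow> chart_inv c (snd c p) = p"
  by (simp add: is_chart_inj)

lemma local_rep_apply: "local_rep f c d x = snd d (f (chart_inv c x))"
  by (simp add: local_rep_def)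

lemma mem_local_dom_iff:
  "is_chart X c \<Longrightarrow> x \<in> local_dom f c d \<longleftrightarrow> x \<in> snd c ` fst c \<and> f (chart_inv c x) \<in> fst d"
  by (force simp: local_dom_def chart_inv_chart)

lemma open_local_dom:
  assumes "is_chart X c" "is_chart Y d" "continuous_map X Y f"
  shows "open (local_dom f c d)"
  unfolding local_dom_def
proof (rule is_chart_open_image[OF assms(1)])
  have "openin X (fst c \<inter> {p \<in> topspace X. f p \<in> fst d})"
    by (intro openin_Int openin_continuous_map_preimage[OF assms(3)] is_chart_openin[OF assms(1)]
        is_chart_openin[OF assms(2)])
  moreover have "fst c \<inter> {p \<in> topspace X. f p \<in> fst d} = {p \<in> fst c. f p \<in> fst d}"
    using is_chart_subset[OF assms(1)] by auto
  ultimately show "openin X {p \<in> fst c. f p \<in> fst d}" by simp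
qed auto

lemma local_rep_cong:
  assumes "is_chart X c" "\<And>p. p \<in> topspace X \<Longrightarrow> f p = g p"
  shows "local_dom f c d = local_dom g c d"
    and "x \<in> local_dom f c d \<Longrightarrow> local_rep f c d x = local_rep g c d x"
proof -
  have *: "f p = g p" if "p \<in> fst c" for p
    by (rule assms(2)) (use is_chart_subset[OF assms(1)] that in blast)
  then show "local_dom f c d = local_dom g c d"
    unfolding local_dom_def by (intro arg_cong[where f = "image (snd c)"] Collect_cong) (metis *)
  assume "x \<in> local_dom f c d"
  then obtain p where "p \<in> fst c" "x = snd c p" unfolding local_dom_def by blast
  then show "local_rep f c d x = local_rep g c d x"
    unfolding local_rep_apply by (simp add: chart_inv_chart[OF assms(1)] *)
qed

lemma frechet_derivative_local_rep_cong:
  assumes "is_chart X c" "is_chart Y d" "continuous_map X Y f"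
    "\<And>p. p \<in> topspace X \<Longrightarrow> f p = g p" "x \<in> local_dom f c d"
  shows "local_deriv f c d x = local_deriv g c d x"
  by (rule frechet_derivative_cong_open[OF open_local_dom[OF assms(1-3)] assms(5)])
    (rule local_rep_cong(2)[OF assms(1,4)])

lemma local_rep_compose:
  assumes "is_chart X c" "is_chart Y d" "x \<in> local_dom f c d"
  shows "local_rep g d e (local_rep f c d x) = local_rep (g \<circ> f) c e x"
    and "local_rep f c d x \<in> local_dom g d e \<longleftrightarrow> x \<in> local_dom (g \<circ> f) c e"
  using assms by (auto simp: local_rep_apply mem_local_dom_iff chart_inv_chart)

text \<open>The coordinate expression through an intermediate chart \<open>d\<close> is defined only where \<open>f\<close> maps
  into the domain of \<open>d\<close>, hence the statement is one about a neighbourhood of \<open>x\<close>.\<close>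

lemma local_rep_compose_smooth:
  fixes d :: "('b, 'f::real_inner) chart"
  assumes B: "onb (B :: 'f set)"
    and c: "is_chart X c" and d: "is_chart Y d" and e: "is_chart Z e"
    and f: "continuous_map X Y f" and g: "continuous_map Y Z g"
    and sf: "smooth_rep f c d"
    and sg: "smooth_rep g d e"
    and x: "x \<in> local_dom (g \<circ> f) c e" "x \<in> local_dom f c d"
  shows "\<exists>U. open U \<and> x \<in> U \<and> smooth_on U (local_rep (g \<circ> f) c e)"
    and "local_deriv (g \<circ> f) c e x v =
      local_deriv g d e (local_rep f c d x)
        (local_deriv f c d x v)"
proof -
  let ?U = "local_dom (g \<circ> f) c e \<inter> local_dom f c d"
  have o: "open ?U"
    using open_local_dom[OF c d f] open_local_dom[OF c e continuous_map_compose[OF f g]] by auto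
  have eq: "local_rep g d e (local_rep f c d y) = local_rep (g \<circ> f) c e y" if "y \<in> ?U" for y
    using local_rep_compose(1)[OF c d] that by blast
  have sub: "local_rep f c d ` ?U \<subseteq> local_dom g d e"
    using local_rep_compose(2)[OF c d] by blast
  have "smooth_on ?U (\<lambda>y. local_rep g d e (local_rep f c d y))"
    by (rule smooth_on_compose[OF B o sub smooth_on_subset[OF sf] sg]) auto
  from smooth_on_cong[OF o _ this] have "smooth_on ?U (local_rep (g \<circ> f) c e)"
    using eq by blast
  then show "\<exists>U. open U \<and> x \<in> U \<and> smooth_on U (local_rep (g \<circ> f) c e)"
    using o x by blast
  have "(local_rep f c d has_derivative local_deriv f c d x) (at x)"
    by (rule smooth_on_has_derivative[OF sf x(2)])
  moreover have "(local_rep g d e has_derivative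
      local_deriv g d e (local_rep f c d x)) (at (local_rep f c d x))"
    by (rule smooth_on_has_derivative[OF sg]) (use sub x in auto)
  ultimately have "((local_rep g d e \<circ> local_rep f c d) has_derivative
      (local_deriv g d e (local_rep f c d x) \<circ>
        local_deriv f c d x)) (at x)"
    by (rule diff_chain_at)
  then have "frechet_derivative (local_rep g d e \<circ> local_rep f c d) (at x) v =
      local_deriv g d e (local_rep f c d x)
        (local_deriv f c d x v)"
    by (simp add: frechet_derivative_at[symmetric])
  moreover have "frechet_derivative (local_rep g d e \<circ> local_rep f c d) (at x) =
      local_deriv (g \<circ> f) c e x"
    by (rule frechet_derivative_cong_open[OF o]) (use x eq in auto)
  ultimately show "local_deriv (g \<circ> f) c e x v =
      local_deriv g d e (local_rep f c d x)
        (local_deriv f c d x v)" by simp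
qed

section \<open>Smooth manifolds and their structure-preserving maps\<close>

lemma smooth_manifold_iff_onb:
  fixes M :: "('a, 'e::real_inner) manifold"
  shows "smooth_manifold n M \<longleftrightarrow> (\<exists>B :: 'e set. onb B \<and> card B = n) \<and>
     Hausdorff_space (topo M) \<and> second_countable (topo M) \<and>
     (\<forall>c\<in>atlas M. is_chart (topo M) c) \<and>
     (\<Union>c\<in>atlas M. fst c) = topspace (topo M) \<and>
     (\<forall>c\<in>atlas M. \<forall>d\<in>atlas M. smoothly_compatible c d)"
proof -
  have "(\<exists>B :: 'e set. finite B \<and> independent B \<and> span B = UNIV \<and> card B = n) \<longleftrightarrow>
      (\<exists>B :: 'e set. onb B \<and> card B = n)"
  proof
    assume "\<exists>B :: 'e set. finite B \<and> independent B \<and> span B = UNIV \<and> card B = n"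
    then obtain B :: "'e set" where B: "finite B" "independent B" "span B = UNIV" "card B = n"
      by blast
    obtain C :: "'e set" where C: "onb C" using onb_exists[OF B(1,3)] by blast
    show "\<exists>B :: 'e set. onb B \<and> card B = n" using C onb_card[OF C B(1-3)] B(4) by blast
  next
    assume "\<exists>B :: 'e set. onb B \<and> card B = n"
    then show "\<exists>B :: 'e set. finite B \<and> independent B \<and> span B = UNIV \<and> card B = n"
      using onb_independent unfolding onb_def by blast
  qed
  then show ?thesis unfolding smooth_manifold_def by simp
qed

context
  fixes M :: "('a, 'e::real_inner) manifold" and n
  assumes M: "smooth_manifold n M"
begin

lemma manifold_onb: "\<exists>B :: 'e set. onb B"
  using M by (auto simp: smooth_manifold_iff_onb)

lemma manifold_chart: "c \<in> atlas M \<Longrightarrow> is_chart (topo M) c"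
  using M by (auto simp: smooth_manifold_def)

lemma manifold_cover: "p \<in> topspace (topo M) \<Longrightarrow> \<exists>c\<in>atlas M. p \<in> fst c"
  using M by (auto simp: smooth_manifold_def)

lemma manifold_transition_smooth:
  "c \<in> atlas M \<Longrightarrow> d \<in> atlas M \<Longrightarrow> smooth_rep id c d"
  using M by (auto simp: smooth_manifold_def smoothly_compatible_def)

lemma smooth_map_id: "smooth_map M M id"
  by (simp add: smooth_map_def manifold_transition_smooth)

lemma smooth_map_cong:
  assumes f: "smooth_map M N f" and N: "smooth_manifold m N"
    and eq: "\<And>p. p \<in> topspace (topo M) \<Longrightarrow> f p = g p"
  shows "smooth_map M N g"
  unfolding smooth_map_def
proof safe
  have cf: "continuous_map (topo M) (topo N) f" using f by (simp add: smooth_map_def)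
  then show "continuous_map (topo M) (topo N) g" by (rule continuous_map_eq) (use eq in auto)
  fix c d assume c: "c \<in> atlas M" and d: "d \<in> atlas N"
  have "is_chart (topo N) d" using N d by (auto simp: smooth_manifold_def)
  then have "open (local_dom f c d)"
    by (rule open_local_dom[OF manifold_chart[OF c] _ cf])
  moreover have "smooth_rep f c d"
    using f c d by (auto simp: smooth_map_def)
  moreover have "local_rep f c d x = local_rep g c d x" if "x \<in> local_dom f c d" for x
    by (rule local_rep_cong(2)[OF manifold_chart[OF c] eq that])
  ultimately have "smooth_on (local_dom f c d) (local_rep g c d)"
    using smooth_on_cong[of "local_dom f c d" "local_rep f c d" "local_rep g c d"] by blast
  then show "smooth_rep g c d"
    by (simp only: local_rep_cong(1)[where f = f and g = g, OF manifold_chart[OF c] eq])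
qed

end

text \<open>The charts at the two ends may lie outside the atlases; this is how holomorphic coordinate charts
  are compared with the charts of the atlas.\<close>

lemma smooth_map_compose_chart:
  fixes N :: "('b, 'f::real_inner) manifold"
  assumes N: "smooth_manifold n N"
    and c: "is_chart X c" and e: "is_chart Z e"
    and f: "continuous_map X (topo N) f" and g: "continuous_map (topo N) Z g"
    and sf: "\<And>d. d \<in> atlas N \<Longrightarrow> smooth_rep f c d"
    and sg: "\<And>d. d \<in> atlas N \<Longrightarrow> smooth_rep g d e"
  shows "smooth_rep (g \<circ> f) c e"
proof (rule smooth_on_local)
  fix x assume x: "x \<in> local_dom (g \<circ> f) c e"
  obtain B :: "'f set" where B: "onb B" using manifold_onb[OF N] by auto
  have "chart_inv c x \<in> topspace X"
    using x is_chart_subset[OF c] by (auto simp: local_dom_def chart_inv_chart[OF c])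
  then have "f (chart_inv c x) \<in> topspace (topo N)"
    using f by (auto simp: continuous_map_def)
  then obtain d where d: "d \<in> atlas N" "f (chart_inv c x) \<in> fst d"
    using manifold_cover[OF N] by blast
  then have "x \<in> local_dom f c d" using x by (simp add: mem_local_dom_iff[OF c])
  then show "\<exists>U. open U \<and> x \<in> U \<and> smooth_on U (local_rep (g \<circ> f) c e)"
    using local_rep_compose_smooth(1)[OF B c manifold_chart[OF N d(1)] e f g sf[OF d(1)]
        sg[OF d(1)] x] by blast
qed

lemma smooth_map_compose:
  assumes "smooth_manifold m M" "smooth_manifold n N" "smooth_manifold l L"
    "smooth_map M N f" "smooth_map N L g"
  shows "smooth_map M L (g \<circ> f)"
  using assms(4,5) unfolding smooth_map_def
  by (auto intro: continuous_map_compose smooth_map_compose_chart[OF assms(2)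
        manifold_chart[OF assms(1)] manifold_chart[OF assms(3)]])

text \<open>Invertibility is left out, so that the class is visibly closed under composition; the inverse of
  a diffeomorphism is added by a separate lemma, and with it all integer powers.\<close>

definition hermitian_map ::
  "('a, 'e::real_inner) manifold \<Rightarrow> ('a, 'e) endo_field \<Rightarrow> ('a, 'e) form2 \<Rightarrow> ('a \<Rightarrow> 'a) \<Rightarrow> bool"
  where "hermitian_map M T h f \<longleftrightarrow>
    smooth_map M M f \<and> preserves_endo M f T \<and> preserves_bilinear M f h"

lemma hermitian_mapD:
  assumes "hermitian_map M T h f" "c \<in> atlas M" "d \<in> atlas M" "x \<in> local_dom f c d"
  shows "local_deriv f c d x (T c x v) =
      T d (local_rep f c d x) (local_deriv f c d x v)"
    and "h d (local_rep f c d x) (local_deriv f c d x u)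
      (local_deriv f c d x v) = h c x u v"
  using assms by (auto simp: hermitian_map_def preserves_endo_def preserves_bilinear_def)

context
  fixes M :: "('a, 'e::real_inner) manifold" and n
    and T :: "('a, 'e) endo_field" and h :: "('a, 'e) form2"
  assumes M: "smooth_manifold n M"
begin

lemma hermitian_map_cong:
  assumes f: "hermitian_map M T h f"
    and eq: "\<And>p. p \<in> topspace (topo M) \<Longrightarrow> f p = g p"
  shows "hermitian_map M T h g"
proof -
  have cf: "continuous_map (topo M) (topo M) f"
    using f by (simp add: hermitian_map_def smooth_map_def)
  have dom: "local_dom g c d = local_dom f c d" if "c \<in> atlas M" for c d
    by (rule local_rep_cong(1)[OF manifold_chart[OF M that] eq[symmetric]])
  have rep: "local_rep g c d x = local_rep f c d x"
    if "c \<in> atlas M" "x \<in> local_dom f c d" for c d x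
    by (rule local_rep_cong(2)[OF manifold_chart[OF M that(1)] eq that(2), symmetric])
  have der: "local_deriv g c d x =
      local_deriv f c d x"
    if "c \<in> atlas M" "d \<in> atlas M" "x \<in> local_dom f c d" for c d x
    by (rule frechet_derivative_local_rep_cong[OF manifold_chart[OF M that(1)]
          manifold_chart[OF M that(2)] cf eq that(3), symmetric])
  have "smooth_map M M g"
    using smooth_map_cong[OF M _ M eq] f by (simp add: hermitian_map_def)
  then show ?thesis
    using f unfolding hermitian_map_def preserves_endo_def preserves_bilinear_def
    by (simp add: dom rep der)
qed

lemma hermitian_map_compose:
  assumes f: "hermitian_map M T h f" and g: "hermitian_map M T h g"
  shows "hermitian_map M T h (g \<circ> f)"
proof -
  obtain B :: "'e set" where B: "onb B" using manifold_onb[OF M] by auto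
  have sf: "smooth_map M M f" and sg: "smooth_map M M g"
    using f g by (auto simp: hermitian_map_def)
  then have cf: "continuous_map (topo M) (topo M) f" and cg: "continuous_map (topo M) (topo M) g"
    by (auto simp: smooth_map_def)
  have *: "local_deriv (g \<circ> f) c e x (T c x v) =
      T e (local_rep (g \<circ> f) c e x) (local_deriv (g \<circ> f) c e x v) \<and>
     h e (local_rep (g \<circ> f) c e x) (local_deriv (g \<circ> f) c e x u)
      (local_deriv (g \<circ> f) c e x v) = h c x u v"
    if c: "c \<in> atlas M" and e: "e \<in> atlas M" and x: "x \<in> local_dom (g \<circ> f) c e" for c e x u v
  proof -
    note cc = manifold_chart[OF M c] and ce = manifold_chart[OF M e]
    have "chart_inv c x \<in> topspace (topo M)"
      using x is_chart_subset[OF cc] by (auto simp: local_dom_def chart_inv_chart[OF cc])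
    then have "f (chart_inv c x) \<in> topspace (topo M)"
      using cf by (auto simp: continuous_map_def)
    then obtain d where d: "d \<in> atlas M" "f (chart_inv c x) \<in> fst d"
      using manifold_cover[OF M] by blast
    note cd = manifold_chart[OF M d(1)]
    have xf: "x \<in> local_dom f c d" using x d by (simp add: mem_local_dom_iff[OF cc])
    have xg: "local_rep f c d x \<in> local_dom g d e"
      using local_rep_compose(2)[OF cc cd xf] x by blast
    have D: "local_deriv (g \<circ> f) c e x w =
      local_deriv g d e (local_rep f c d x)
        (local_deriv f c d x w)" for w
      by (rule local_rep_compose_smooth(2)[OF B cc cd ce cf cg _ _ x xf])
        (use sf sg c d e in \<open>auto simp: smooth_map_def\<close>)
    show ?thesis
      unfolding D local_rep_compose(1)[OF cc cd xf, symmetric]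
      using hermitian_mapD[OF f c d(1) xf] hermitian_mapD[OF g d(1) e xg] by simp
  qed
  show ?thesis
    unfolding hermitian_map_def preserves_endo_def preserves_bilinear_def
    using * smooth_map_compose[OF M M M sf sg] by blast
qed

text \<open>By the chain rule the differentials of \<open>f\<close> and \<open>g\<close> at corresponding points are inverse to
  each other, so what one of them intertwines or preserves, the other does too.\<close>

lemma hermitian_map_inverse:
  assumes f: "hermitian_map M T h f" and g: "smooth_map M M g"
    and gf: "\<And>p. p \<in> topspace (topo M) \<Longrightarrow> g (f p) = p"
    and fg: "\<And>p. p \<in> topspace (topo M) \<Longrightarrow> f (g p) = p"
  shows "hermitian_map M T h g"
proof -
  obtain B :: "'e set" where B: "onb B" using manifold_onb[OF M] by auto
  have sf: "smooth_map M M f" using f by (auto simp: hermitian_map_def)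
  then have cf: "continuous_map (topo M) (topo M) f" and cg: "continuous_map (topo M) (topo M) g"
    using g by (auto simp: smooth_map_def)
  have inv: "local_deriv b d c (local_rep a c d x)
      (local_deriv a c d x w) = w"
    if c: "c \<in> atlas M" and d: "d \<in> atlas M" and x: "x \<in> local_dom a c d"
      and a: "smooth_map M M a" and b: "smooth_map M M b"
      and ba: "\<And>p. p \<in> topspace (topo M) \<Longrightarrow> b (a p) = p" for c d x a b w
  proof -
    note cc = manifold_chart[OF M c] and cd = manifold_chart[OF M d]
    have ca: "continuous_map (topo M) (topo M) a" and cb: "continuous_map (topo M) (topo M) b"
      using a b by (auto simp: smooth_map_def)
    have eq: "(b \<circ> a) p = id p" if "p \<in> topspace (topo M)" for p using ba that by simp
    have xc: "x \<in> snd c ` fst c" using x by (auto simp: local_dom_def)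
    then have "x \<in> local_dom id c c"
      by (auto simp: mem_local_dom_iff[OF cc] chart_inv_chart[OF cc])
    then have x': "x \<in> local_dom (b \<circ> a) c c"
      using local_rep_cong(1)[where f = "b \<circ> a" and g = id, OF cc eq] by blast
    have "local_deriv b d c (local_rep a c d x)
        (local_deriv a c d x w) =
        local_deriv (b \<circ> a) c c x w"
      by (rule local_rep_compose_smooth(2)[OF B cc cd cc ca cb _ _ x' x, symmetric])
        (use a b c d in \<open>auto simp: smooth_map_def\<close>)
    also have "local_deriv (b \<circ> a) c c x =
        frechet_derivative (\<lambda>y. y) (at x)"
    proof (rule frechet_derivative_cong_open)
      show "open (local_dom (b \<circ> a) c c)"
        by (rule open_local_dom[OF cc cc continuous_map_compose[OF ca cb]])
      show "local_rep (b \<circ> a) c c y = y" if "y \<in> local_dom (b \<circ> a) c c" for y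
        using that eq is_chart_subset[OF cc]
        by (auto simp: local_dom_def local_rep_apply chart_inv_chart[OF cc] subset_iff)
    qed (rule x')
    finally show ?thesis by (simp add: frechet_derivative_ident)
  qed
  have *: "local_deriv g c d x (T c x v) =
      T d (local_rep g c d x) (local_deriv g c d x v) \<and>
     h d (local_rep g c d x) (local_deriv g c d x u)
      (local_deriv g c d x v) = h c x u v"
    if c: "c \<in> atlas M" and d: "d \<in> atlas M" and x: "x \<in> local_dom g c d" for c d x u v
  proof -
    note cc = manifold_chart[OF M c] and cd = manifold_chart[OF M d]
    let ?y = "local_rep g c d x"
    have xc: "x \<in> snd c ` fst c" "chart_inv c x \<in> fst c"
      using x by (auto simp: local_dom_def chart_inv_chart[OF cc])
    then have "f (g (chart_inv c x)) = chart_inv c x"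
      using fg is_chart_subset[OF cc] by auto
    moreover have "chart_inv d ?y = g (chart_inv c x)" "?y \<in> snd d ` fst d"
      using x by (auto simp: mem_local_dom_iff[OF cc] local_rep_apply chart_inv_chart[OF cd])
    ultimately have y: "?y \<in> local_dom f d c" "local_rep f d c ?y = x"
      using xc by (auto simp: mem_local_dom_iff[OF cd] local_rep_apply f_inv_into_f)
    have i1: "local_deriv f d c ?y
        (local_deriv g c d x w) = w" for w
      by (rule inv[OF c d x g sf fg])
    have i2: "local_deriv g c d x
        (local_deriv f d c ?y w) = w" for w
      using inv[OF d c y(1) sf g gf] y(2) by simp
    note F = hermitian_mapD[OF f d c y(1), unfolded y(2)]
    have "T c x v = local_deriv f d c ?y
        (T d ?y (local_deriv g c d x v))"
      by (simp add: F(1) i1)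
    then show ?thesis using F(2) i1 i2 by metis
  qed
  show ?thesis
    unfolding hermitian_map_def preserves_endo_def preserves_bilinear_def
    using * g by blast
qed

end

lemma complex_structureD:
  assumes "complex_structure M I" "c \<in> atlas M"
  shows "x \<in> snd c ` fst c \<Longrightarrow> linear (I c x)"
    and "x \<in> snd c ` fst c \<Longrightarrow> I c x (I c x v) = - v"
    and "smooth_on (snd c ` fst c) (\<lambda>x. I c x v)"
proof -
  from assms(1) have
    1: "\<forall>c\<in>atlas M. (\<forall>x\<in>snd c ` fst c. linear (I c x)) \<and>
        (\<forall>v. smooth_on (snd c ` fst c) (\<lambda>x. I c x v))" and
    2: "\<forall>c\<in>atlas M. \<forall>x\<in>snd c ` fst c. \<forall>v. I c x (I c x v) = - v"
    unfolding complex_structure_def smooth_endo_field_def by fast+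
  show "x \<in> snd c ` fst c \<Longrightarrow> linear (I c x)"
    by (rule bspec[OF conjunct1[OF bspec[OF 1 assms(2)]]])
  show "smooth_on (snd c ` fst c) (\<lambda>x. I c x v)"
    by (rule spec[OF conjunct2[OF bspec[OF 1 assms(2)]]])
  show "x \<in> snd c ` fst c \<Longrightarrow> I c x (I c x v) = - v"
    by (rule spec[OF bspec[OF bspec[OF 2 assms(2)]]])
qed

lemma hermitian_metric_smooth:
  "hermitian_metric M I h \<Longrightarrow> c \<in> atlas M \<Longrightarrow> smooth_on (snd c ` fst c) (\<lambda>x. h c x u v)"
  unfolding hermitian_metric_def riemannian_metric_def by fast

lemma hermitian_metricD:
  assumes "hermitian_metric M I h" "c \<in> atlas M" "x \<in> snd c ` fst c"
  shows "bilinear (h c x)" "h c x u v = h c x v u" "v \<noteq> 0 \<Longrightarrow> 0 < h c x v v"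
    "h c x (I c x u) (I c x v) = h c x u v"
proof -
  have 1: "\<forall>c\<in>atlas M. \<forall>x\<in>snd c ` fst c. bilinear (h c x) \<and>
        (\<forall>u v. h c x u v = h c x v u) \<and> (\<forall>v. v \<noteq> 0 \<longrightarrow> h c x v v > 0)" and
    2: "\<forall>c\<in>atlas M. \<forall>x\<in>snd c ` fst c. \<forall>u v. h c x (I c x u) (I c x v) = h c x u v"
    using assms(1) unfolding hermitian_metric_def riemannian_metric_def by fast+
  note 3 = bspec[OF bspec[OF 1 assms(2)] assms(3)]
  show "bilinear (h c x)" "h c x u v = h c x v u" "v \<noteq> 0 \<Longrightarrow> 0 < h c x v v" using 3 by simp_all
  show "h c x (I c x u) (I c x v) = h c x u v"
    using bspec[OF bspec[OF 2 assms(2)] assms(3)] by simp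
qed

section \<open>Quotients by deck transformations\<close>

text \<open>Transitivity on ordered pairs of points of a fibre takes the place of a group structure on
  \<open>\<Gamma>\<close>: it supplies inverses where they are needed.\<close>

locale deck_quotient =
  fixes P :: "('a, 'e::real_inner) manifold" and n :: nat and q :: "'a \<Rightarrow> 'b"
    and \<Gamma> :: "('a \<Rightarrow> 'a) set"
  assumes manifold: "smooth_manifold n P"
    and deck_smooth: "F \<in> \<Gamma> \<Longrightarrow> smooth_map P P F"
    and deck_orbit: "F \<in> \<Gamma> \<Longrightarrow> p \<in> topspace (topo P) \<Longrightarrow> q (F p) = q p"
    and deck_transitive: "p \<in> topspace (topo P) \<Longrightarrow> p' \<in> topspace (topo P) \<Longrightarrow> q p = q p' \<Longrightarrow>
      \<exists>F\<in>\<Gamma>. F p = p'"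
    and locally_injective: "p \<in> topspace (topo P) \<Longrightarrow>
      \<exists>W. openin (topo P) W \<and> p \<in> W \<and> inj_on q W"
    and separated: "p \<in> topspace (topo P) \<Longrightarrow> p' \<in> topspace (topo P) \<Longrightarrow> q p \<noteq> q p' \<Longrightarrow>
      \<exists>U V. openin (topo P) U \<and> openin (topo P) V \<and> p \<in> U \<and> p' \<in> V \<and> q ` U \<inter> q ` V = {}"
begin

abbreviation Q :: "('b, 'e) manifold" where "Q \<equiv> quotient_manifold P q"

definition push :: "('a, 'e) chart \<Rightarrow> 'a set \<Rightarrow> ('b, 'e) chart" where
  "push c W = (q ` W, snd c \<circ> inv_into W q)"

lemma fst_push [simp]: "fst (push c W) = q ` W"
  by (simp add: push_def)

lemma atlas_quotient: "atlas Q = {push c W | c W.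
    c \<in> atlas P \<and> openin (topo P) W \<and> W \<subseteq> fst c \<and> inj_on q W}"
  by (simp add: quotient_manifold_def push_def)

lemma deck_continuous: "F \<in> \<Gamma> \<Longrightarrow> continuous_map (topo P) (topo P) F"
  using deck_smooth by (simp add: smooth_map_def)

lemma openin_quotient:
  "openin (topo Q) S \<longleftrightarrow> S \<subseteq> q ` topspace (topo P) \<and>
    openin (topo P) {x \<in> topspace (topo P). q x \<in> S}"
  by (simp add: quotient_manifold_def openin_quotient_topology)

text \<open>The saturation of an open set is a union of preimages under deck transformations, so the
  projection is open.\<close>

lemma quotient_open:
  assumes U: "openin (topo P) U" shows "openin (topo Q) (q ` U)"
proof -
  have sub: "U \<subseteq> topspace (topo P)" by (rule openin_subset[OF U])
  have "{x \<in> topspace (topo P). q x \<in> q ` U} = (\<Union>F\<in>\<Gamma>. {x \<in> topspace (topo P). F x \<in> U})"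
  proof (intro set_eqI iffI)
    fix x assume x: "x \<in> {x \<in> topspace (topo P). q x \<in> q ` U}"
    then obtain u where "u \<in> U" "q x = q u" by blast
    then obtain F where "F \<in> \<Gamma>" "F x = u" using deck_transitive[of x u] x sub by blast
    then show "x \<in> (\<Union>F\<in>\<Gamma>. {x \<in> topspace (topo P). F x \<in> U})" using x \<open>u \<in> U\<close> by blast
  next
    fix x assume "x \<in> (\<Union>F\<in>\<Gamma>. {x \<in> topspace (topo P). F x \<in> U})"
    then obtain F where F: "F \<in> \<Gamma>" "x \<in> topspace (topo P)" "F x \<in> U" by blast
    then have "q x = q (F x)" using deck_orbit by simp
    then show "x \<in> {x \<in> topspace (topo P). q x \<in> q ` U}" using F by blast
  qed
  also have "openin (topo P) \<dots>"
    by (intro openin_Union) (use openin_continuous_map_preimage[OF deck_continuous U] in blast)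
  finally show ?thesis using sub by (auto simp: openin_quotient)
qed

lemma topspace_quotient: "topspace (topo Q) = q ` topspace (topo P)"
proof
  show "topspace (topo Q) \<subseteq> q ` topspace (topo P)"
    using openin_topspace[of "topo Q"] unfolding openin_quotient by blast
  show "q ` topspace (topo P) \<subseteq> topspace (topo Q)"
    by (rule openin_subset[OF quotient_open[OF openin_topspace]])
qed

context
  fixes c :: "('a, 'e) chart" and W
  assumes c: "is_chart (topo P) c" and W: "openin (topo P) W" "W \<subseteq> fst c" "inj_on q W"
begin

lemma snd_push: "p \<in> W \<Longrightarrow> snd (push c W) (q p) = snd c p"
  using W(3) by (simp add: push_def)

lemma push_image: "snd (push c W) ` fst (push c W) = snd c ` W"
  unfolding fst_push image_image by (rule image_cong[OF refl snd_push])

lemma push_is_chart: "is_chart (topo Q) (push c W)"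
  unfolding push_def
proof (rule is_chartI)
  have injc: "inj_on (snd c) W" using is_chart_inj[OF c] W(2) inj_on_subset by blast
  have inv: "inv_into W q (q p) = p" if "p \<in> W" for p using W(3) that by simp
  show "openin (topo Q) (q ` W)" by (rule quotient_open[OF W(1)])
  show "inj_on (snd c \<circ> inv_into W q) (q ` W)"
    using injc by (auto simp: inj_on_def inv)
  fix T :: "'e set" assume T: "open T"
  have "{p \<in> q ` W. (snd c \<circ> inv_into W q) p \<in> T} = q ` (W \<inter> {p \<in> fst c. snd c p \<in> T})"
    using W(2) by (auto simp: inv)
  then show "openin (topo Q) {p \<in> q ` W. (snd c \<circ> inv_into W q) p \<in> T}"
    using quotient_open[OF openin_Int[OF W(1) is_chart_openin_preimage[OF c T]]] by simp
next
  have inv: "inv_into W q (q p) = p" if "p \<in> W" for p using W(3) that by simp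
  fix V assume V: "openin (topo Q) V" "V \<subseteq> q ` W"
  have "(snd c \<circ> inv_into W q) ` V = snd c ` (W \<inter> {x \<in> topspace (topo P). q x \<in> V})"
  proof (intro set_eqI iffI)
    fix y assume "y \<in> (snd c \<circ> inv_into W q) ` V"
    then obtain p where p: "p \<in> W" "q p \<in> V" "y = snd c p" using V(2) inv by fastforce
    then show "y \<in> snd c ` (W \<inter> {x \<in> topspace (topo P). q x \<in> V})"
      using openin_subset[OF W(1)] by blast
  next
    fix y assume "y \<in> snd c ` (W \<inter> {x \<in> topspace (topo P). q x \<in> V})"
    then obtain p where p: "p \<in> W" "q p \<in> V" "y = snd c p" by blast
    then show "y \<in> (snd c \<circ> inv_into W q) ` V"
      using inv[OF p(1)] by (intro image_eqI[where x = "q p"]) auto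
  qed
  moreover have "openin (topo P) (W \<inter> {x \<in> topspace (topo P). q x \<in> V})"
    using V(1) W(1) by (auto simp: openin_quotient)
  ultimately show "open ((snd c \<circ> inv_into W q) ` V)"
    using is_chart_open_image[OF c] W(2) by (simp add: le_infI1)
qed

lemma push_chart_inv: "p \<in> W \<Longrightarrow> chart_inv (push c W) (snd c p) = q p"
  using chart_inv_chart[OF push_is_chart, of "q p"] snd_push by simp

end

text \<open>Both representatives of a point of the quotient lie in one orbit, so some deck transformation
  \<open>F\<close> carries the first to the second.  Near that point it carries \<open>W\<close> into \<open>V\<close>, and
  injectivity of the projection on \<open>V\<close> identifies it with the transition map.\<close>

lemma push_transition:
  assumes c: "is_chart (topo P) c" and W: "openin (topo P) W" "W \<subseteq> fst c" "inj_on q W"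
    and d: "is_chart (topo P) d" and V: "openin (topo P) V" "V \<subseteq> fst d" "inj_on q V"
    and x: "x \<in> local_dom id (push c W) (push d V)"
  shows "\<exists>F\<in>\<Gamma>. \<exists>U. open U \<and> x \<in> U \<and> U \<subseteq> local_dom F c d \<and>
    (\<forall>y\<in>U. local_rep id (push c W) (push d V) y = local_rep F c d y)"
proof -
  from x obtain p where p: "p \<in> W" "q p \<in> q ` V" "x = snd c p"
    using snd_push[OF c W] by (auto simp: local_dom_def)
  then obtain v where v: "v \<in> V" "q p = q v" by blast
  then obtain F where F: "F \<in> \<Gamma>" "F p = v"
    using deck_transitive p(1) openin_subset[OF W(1)] openin_subset[OF V(1)] by blast
  let ?O = "W \<inter> {p' \<in> topspace (topo P). F p' \<in> V}"
  have o: "openin (topo P) ?O"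
    by (rule openin_Int[OF W(1) openin_continuous_map_preimage[OF deck_continuous[OF F(1)] V(1)]])
  have "open (snd c ` ?O)" by (rule is_chart_open_image[OF c o]) (use W(2) in blast)
  moreover have "x \<in> snd c ` ?O" using p v F openin_subset[OF W(1)] by blast
  moreover have "snd c ` ?O \<subseteq> local_dom F c d" using W(2) V(2) by (auto simp: local_dom_def)
  moreover have "local_rep id (push c W) (push d V) y = local_rep F c d y" if "y \<in> snd c ` ?O" for y
  proof -
    from that obtain p' where p': "p' \<in> W" "F p' \<in> V" "y = snd c p'" "p' \<in> topspace (topo P)"
      by blast
    have "q p' = q (F p')" using deck_orbit[OF F(1) p'(4)] by simp
    then have "snd (push d V) (q p') = snd d (F p')" using snd_push[OF d V p'(2)] by simp
    moreover have "p' \<in> fst c" using p'(1) W(2) by blast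
    ultimately show ?thesis
      unfolding local_rep_apply p'(3) push_chart_inv[OF c W p'(1)]
      by (simp add: chart_inv_chart[OF c])
  qed
  ultimately show ?thesis using F(1) by blast
qed

lemma push_smooth:
  assumes c: "is_chart (topo P) c" and W: "openin (topo P) W" "W \<subseteq> fst c" "inj_on q W"
    and d: "is_chart (topo P) d" and V: "openin (topo P) V" "V \<subseteq> fst d" "inj_on q V"
    and s: "\<And>F. F \<in> \<Gamma> \<Longrightarrow> smooth_rep F c d"
  shows "smooth_rep id (push c W) (push d V)"
proof (rule smooth_on_local)
  fix x assume "x \<in> local_dom id (push c W) (push d V)"
  from push_transition[OF c W d V this] obtain F U where
    U: "F \<in> \<Gamma>" "open U" "x \<in> U" "U \<subseteq> local_dom F c d"
      "\<And>y. y \<in> U \<Longrightarrow> local_rep id (push c W) (push d V) y = local_rep F c d y" by blast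
  have "smooth_on U (local_rep id (push c W) (push d V))"
    by (rule smooth_on_cong[OF U(2) _ smooth_on_subset[OF s[OF U(1)] U(4)]]) (simp add: U(5))
  then show "\<exists>U. open U \<and> x \<in> U \<and> smooth_on U (local_rep id (push c W) (push d V))"
    using U(2,3) by blast
qed

lemma push_derivative:
  assumes c: "is_chart (topo P) c" and W: "openin (topo P) W" "W \<subseteq> fst c" "inj_on q W"
    and d: "is_chart (topo P) d" and V: "openin (topo P) V" "V \<subseteq> fst d" "inj_on q V"
    and x: "x \<in> local_dom id (push c W) (push d V)"
  obtains F where "F \<in> \<Gamma>" "x \<in> local_dom F c d"
    "local_rep id (push c W) (push d V) x = local_rep F c d x"
    "local_deriv id (push c W) (push d V) x =
      local_deriv F c d x"
proof -
  from push_transition[OF assms] obtain F U where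
    U: "F \<in> \<Gamma>" "open U" "x \<in> U" "U \<subseteq> local_dom F c d"
      "\<And>y. y \<in> U \<Longrightarrow> local_rep id (push c W) (push d V) y = local_rep F c d y" by blast
  show ?thesis
  proof (rule that[OF U(1) _ U(5)[OF U(3)]])
    show "x \<in> local_dom F c d" using U(3,4) by blast
    show "local_deriv id (push c W) (push d V) x =
        local_deriv F c d x"
      by (rule frechet_derivative_cong_open[OF U(2,3)]) (rule U(5))
  qed
qed

text \<open>Since the projection is open, second countability and the separation of orbits pass to the
  quotient; smoothness of the transition maps is smoothness of the deck transformations.\<close>

theorem quotient_smooth_manifold: "smooth_manifold n Q"
  unfolding smooth_manifold_iff_onb
proof (intro conjI ballI)
  show "\<exists>B :: 'e set. onb B \<and> card B = n"
    using manifold unfolding smooth_manifold_iff_onb by blast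
  show "Hausdorff_space (topo Q)"
    unfolding Hausdorff_space_def
  proof (intro allI impI, elim conjE)
    fix x y assume "x \<in> topspace (topo Q)" "y \<in> topspace (topo Q)" "x \<noteq> y"
    then obtain p p' where p: "p \<in> topspace (topo P)" "p' \<in> topspace (topo P)" "q p \<noteq> q p'"
        "x = q p" "y = q p'"
      unfolding topspace_quotient by blast
    from separated[OF p(1-3)] obtain U V where UV: "openin (topo P) U" "openin (topo P) V"
        "p \<in> U" "p' \<in> V" "q ` U \<inter> q ` V = {}"
      by blast
    show "\<exists>U V. openin (topo Q) U \<and> openin (topo Q) V \<and> x \<in> U \<and> y \<in> V \<and> disjnt U V"
      by (intro exI[of _ "q ` U"] exI[of _ "q ` V"])
        (simp add: quotient_open UV p disjnt_def)
  qed
  show "second_countable (topo Q)"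
  proof (rule second_countable_open_map_image)
    show "continuous_map (topo P) (topo Q) q"
      unfolding continuous_map_def topspace_quotient by (auto simp: openin_quotient)
    show "open_map (topo P) (topo Q) q" using quotient_open by (simp add: open_map_def)
    show "q ` topspace (topo P) = topspace (topo Q)" by (simp add: topspace_quotient)
    show "second_countable (topo P)" using manifold by (simp add: smooth_manifold_def)
  qed
  show "is_chart (topo Q) C" if "C \<in> atlas Q" for C
    using that push_is_chart manifold_chart[OF manifold] unfolding atlas_quotient by blast
  show "(\<Union>C\<in>atlas Q. fst C) = topspace (topo Q)"
  proof
    show "(\<Union>C\<in>atlas Q. fst C) \<subseteq> topspace (topo Q)"
    proof (rule UN_least)
      fix C assume "C \<in> atlas Q"
      then obtain c W where "C = push c W" "openin (topo P) W" unfolding atlas_quotient by blast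
      then show "fst C \<subseteq> topspace (topo Q)"
        using openin_subset[of "topo P" W] unfolding topspace_quotient by auto
    qed
    show "topspace (topo Q) \<subseteq> (\<Union>C\<in>atlas Q. fst C)"
      unfolding topspace_quotient
    proof
      fix x assume "x \<in> q ` topspace (topo P)"
      then obtain p where p: "p \<in> topspace (topo P)" "x = q p" by blast
      obtain c where c: "c \<in> atlas P" "p \<in> fst c" using manifold_cover[OF manifold p(1)] by blast
      obtain W where W: "openin (topo P) W" "p \<in> W" "inj_on q W"
        using locally_injective[OF p(1)] by blast
      have "openin (topo P) (W \<inter> fst c)"
        using W(1) is_chart_openin[OF manifold_chart[OF manifold c(1)]] by blast
      moreover have "inj_on q (W \<inter> fst c)" by (rule inj_on_subset[OF W(3)]) blast
      ultimately have "push c (W \<inter> fst c) \<in> atlas Q" using c(1) unfolding atlas_quotient by blast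
      moreover have "x \<in> fst (push c (W \<inter> fst c))" using p(2) W(2) c(2) by simp
      ultimately show "x \<in> (\<Union>C\<in>atlas Q. fst C)" by blast
    qed
  qed
  fix C D assume "C \<in> atlas Q" "D \<in> atlas Q"
  then obtain c W d V where c: "c \<in> atlas P" "C = push c W"
    and W: "openin (topo P) W" "W \<subseteq> fst c" "inj_on q W" and d: "d \<in> atlas P" "D = push d V"
    and V: "openin (topo P) V" "V \<subseteq> fst d" "inj_on q V"
    unfolding atlas_quotient by blast
  note cc = manifold_chart[OF manifold c(1)] and cd = manifold_chart[OF manifold d(1)]
  show "smoothly_compatible C D"
    unfolding smoothly_compatible_def c(2) d(2)
    by (intro conjI push_smooth[OF cc W cd V] push_smooth[OF cd V cc W])
      (use deck_smooth c(1) d(1) in \<open>auto simp: smooth_map_def\<close>)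
qed

definition lift_chart :: "('b, 'e) chart \<Rightarrow> ('a, 'e) chart" where
  "lift_chart C = (SOME c. c \<in> atlas P \<and>
     (\<exists>W. openin (topo P) W \<and> W \<subseteq> fst c \<and> inj_on q W \<and> C = push c W))"

lemma lift_chart:
  assumes "C \<in> atlas Q"
  obtains W where "lift_chart C \<in> atlas P" "openin (topo P) W" "W \<subseteq> fst (lift_chart C)"
    "inj_on q W" "C = push (lift_chart C) W"
proof -
  have "\<exists>c. c \<in> atlas P \<and> (\<exists>W. openin (topo P) W \<and> W \<subseteq> fst c \<and> inj_on q W \<and> C = push c W)"
    using assms unfolding atlas_quotient by blast
  from someI_ex[OF this] show ?thesis using that unfolding lift_chart_def[symmetric] by blast
qed

text \<open>In a pushed chart the descended field has the coordinate expression of the original one.  For an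
  invariant field the choice of the chart upstairs is immaterial, since two choices differ by a deck
  transformation.\<close>

definition descend :: "(('a, 'e) chart \<Rightarrow> 'c) \<Rightarrow> ('b, 'e) chart \<Rightarrow> 'c" where
  "descend T C = T (lift_chart C)"

context
  fixes I :: "('a, 'e) endo_field" and h :: "('a, 'e) form2"
  assumes invariant: "F \<in> \<Gamma> \<Longrightarrow> hermitian_map P I h F"
begin

lemma descend_invariant:
  "preserves_endo Q id (descend I)" "preserves_bilinear Q id (descend h)"
proof -
  have "local_deriv id C D x (descend I C x v) =
        descend I D (local_rep id C D x) (local_deriv id C D x v) \<and>
      descend h D (local_rep id C D x)
        (local_deriv id C D x u)
        (local_deriv id C D x v) = descend h C x u v"
    if C: "C \<in> atlas Q" and D: "D \<in> atlas Q" and x: "x \<in> local_dom id C D" for C D x u v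
  proof -
    obtain W where W: "lift_chart C \<in> atlas P" "openin (topo P) W" "W \<subseteq> fst (lift_chart C)"
      "inj_on q W" and Ceq: "C = push (lift_chart C) W" using lift_chart[OF C] .
    obtain V where V: "lift_chart D \<in> atlas P" "openin (topo P) V" "V \<subseteq> fst (lift_chart D)"
      "inj_on q V" and Deq: "D = push (lift_chart D) V" using lift_chart[OF D] .
    obtain F where F: "F \<in> \<Gamma>" "x \<in> local_dom F (lift_chart C) (lift_chart D)"
      "local_rep id C D x = local_rep F (lift_chart C) (lift_chart D) x"
      "local_deriv id C D x =
        local_deriv F (lift_chart C) (lift_chart D) x"
      using push_derivative[OF manifold_chart[OF manifold W(1)] W(2-4)
          manifold_chart[OF manifold V(1)] V(2-4), folded Ceq Deq, OF x] .
    show ?thesis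
      unfolding descend_def F(3,4) using hermitian_mapD[OF invariant[OF F(1)] W(1) V(1) F(2)]
      by blast
  qed
  then show "preserves_endo Q id (descend I)" "preserves_bilinear Q id (descend h)"
    unfolding preserves_endo_def preserves_bilinear_def by blast+
qed

lemma lift_chart_image:
  assumes "C \<in> atlas Q"
  shows "lift_chart C \<in> atlas P" "open (snd C ` fst C)"
    "snd C ` fst C \<subseteq> snd (lift_chart C) ` fst (lift_chart C)"
proof -
  obtain W where W: "lift_chart C \<in> atlas P" "openin (topo P) W" "W \<subseteq> fst (lift_chart C)"
    "inj_on q W" and Ceq: "C = push (lift_chart C) W" using lift_chart[OF assms] .
  note cc = manifold_chart[OF manifold W(1)]
  have im: "snd C ` fst C = snd (lift_chart C) ` W"
    using push_image[OF cc W(2-4)] Ceq by simp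
  show "lift_chart C \<in> atlas P" by (rule W(1))
  show "open (snd C ` fst C)" unfolding im by (rule is_chart_open_image[OF cc W(2,3)])
  show "snd C ` fst C \<subseteq> snd (lift_chart C) ` fst (lift_chart C)"
    unfolding im using W(3) by blast
qed

text \<open>A holomorphic coordinate chart upstairs, shrunk until the projection is injective on it, is pushed
  down.  Seen from a pushed chart of the atlas it is a deck transformation followed by a holomorphic
  coordinate map, and the differentials of both are complex linear.\<close>

lemma descend_complex_structure:
  assumes I: "complex_structure P I"
  shows "complex_structure Q (descend I)"
  unfolding complex_structure_def smooth_endo_field_def
proof (intro conjI ballI allI)
  fix C assume C: "C \<in> atlas Q"
  note L = lift_chart_image[OF C]
  note LI = complex_structureD[OF I L(1)]
  show "linear (descend I C x)" if "x \<in> snd C ` fst C" for x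
    unfolding descend_def by (rule LI(1)) (use L(3) that in blast)
  show "smooth_on (snd C ` fst C) (\<lambda>x. descend I C x v)" for v
    unfolding descend_def
    by (rule smooth_on_subset[OF LI(3) L(3)])
  show "descend I C x (descend I C x v) = - v" if "x \<in> snd C ` fst C" for x v
    unfolding descend_def by (rule LI(2)) (use L(3) that in blast)
next
  show "preserves_endo Q id (descend I)" by (rule descend_invariant)
next
  fix p' assume "p' \<in> topspace (topo Q)"
  then obtain p where p: "p \<in> topspace (topo P)" "p' = q p" unfolding topspace_quotient by blast
  obtain d J0 where d: "is_chart (topo P) d" "p \<in> fst d"
    and comp: "\<And>c. c \<in> atlas P \<Longrightarrow> smoothly_compatible c d"
    and J0: "linear J0" "\<And>v. J0 (J0 v) = - v"
    and hol: "\<And>c x v. c \<in> atlas P \<Longrightarrow> x \<in> local_dom id c d \<Longrightarrow>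
        local_deriv id c d x (I c x v) =
        J0 (local_deriv id c d x v)"
    using I p(1) unfolding complex_structure_def by meson
  obtain W0 where W0: "openin (topo P) W0" "p \<in> W0" "inj_on q W0"
    using locally_injective[OF p(1)] by blast
  define W where "W = W0 \<inter> fst d"
  have W: "openin (topo P) W" "W \<subseteq> fst d" "inj_on q W"
    unfolding W_def using W0 is_chart_openin[OF d(1)] by (auto intro: inj_on_subset)
  obtain B :: "'e set" where B: "onb B" using manifold_onb[OF manifold] by blast
  have cid: "continuous_map (topo P) (topo P) id" by simp
  have s1: "smooth_rep id c d"
    and s2: "smooth_rep id d c" if "c \<in> atlas P" for c
    using comp[OF that] by (auto simp: smoothly_compatible_def)
  have s3: "smooth_rep F c c'"
    if "F \<in> \<Gamma>" "c \<in> atlas P" "c' \<in> atlas P" for F c c'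
    using deck_smooth[OF that(1)] that(2,3) by (simp add: smooth_map_def)
  have sF: "smooth_rep F c d"
    and sF': "smooth_rep F d c"
    if F: "F \<in> \<Gamma>" and c: "c \<in> atlas P" for F c
  proof -
    note cc = manifold_chart[OF manifold c]
    show "smooth_rep F c d"
      using smooth_map_compose_chart[OF manifold cc d(1) deck_continuous[OF F] cid
          s3[OF F c] s1] by simp
    show "smooth_rep F d c"
      using smooth_map_compose_chart[OF manifold d(1) cc cid deck_continuous[OF F]
          s2 s3[OF F _ c]] by simp
  qed
  show "\<exists>D J0. is_chart (topo Q) D \<and> p' \<in> fst D \<and> (\<forall>C\<in>atlas Q. smoothly_compatible C D) \<and>
      linear J0 \<and> (\<forall>v. J0 (J0 v) = - v) \<and>
      (\<forall>C\<in>atlas Q. \<forall>x\<in>local_dom id C D. \<forall>v.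
        local_deriv id C D x (descend I C x v) =
        J0 (local_deriv id C D x v))"
  proof (intro exI[of _ "push d W"] exI[of _ J0] conjI ballI allI)
    show "is_chart (topo Q) (push d W)" by (rule push_is_chart[OF d(1) W])
    show "p' \<in> fst (push d W)" using p(2) d(2) W0(2) by (simp add: W_def)
    show "linear J0" "J0 (J0 v) = - v" for v using J0 by auto
    fix C assume C: "C \<in> atlas Q"
    obtain V where V: "lift_chart C \<in> atlas P" "openin (topo P) V" "V \<subseteq> fst (lift_chart C)"
      "inj_on q V" and Ceq: "C = push (lift_chart C) V" using lift_chart[OF C] .
    let ?c = "lift_chart C"
    note cc = manifold_chart[OF manifold V(1)]
    have "smoothly_compatible (push ?c V) (push d W)"
      unfolding smoothly_compatible_def
      by (intro conjI push_smooth[OF cc V(2-4) d(1) W] push_smooth[OF d(1) W cc V(2-4)]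
          sF sF' V(1))
    then show "smoothly_compatible C (push d W)" using Ceq by simp
    fix x v assume x: "x \<in> local_dom id C (push d W)"
    obtain F where F: "F \<in> \<Gamma>" "x \<in> local_dom F ?c d"
      "local_deriv id C (push d W) x =
        local_deriv F ?c d x"
      using push_derivative[OF cc V(2-4) d(1) W, folded Ceq, OF x] .
    have "chart_inv ?c x \<in> topspace (topo P)" "F (chart_inv ?c x) \<in> fst d"
      using F(2) is_chart_subset[OF cc] unfolding mem_local_dom_iff[OF cc]
      by (auto simp: chart_inv_chart[OF cc])
    then obtain c' where c': "c' \<in> atlas P" "F (chart_inv ?c x) \<in> fst c'"
      using manifold_cover[OF manifold, of "F (chart_inv ?c x)"] is_chart_subset[OF d(1)] by blast
    note cc' = manifold_chart[OF manifold c'(1)]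
    have xF: "x \<in> local_dom F ?c c'"
      using F(2) c'(2) unfolding mem_local_dom_iff[OF cc] by blast
    have xd: "local_rep F ?c c' x \<in> local_dom id c' d"
      using local_rep_compose(2)[OF cc cc' xF, of id d] F(2) by simp
    have D: "local_deriv F ?c d x w =
        local_deriv id c' d (local_rep F ?c c' x)
          (local_deriv F ?c c' x w)" for w
      using local_rep_compose_smooth(2)[OF B cc cc' d(1) deck_continuous[OF F(1)] cid
          s3[OF F(1) V(1) c'(1)] s1[OF c'(1)] _ xF] F(2) by simp
    show "local_deriv id C (push d W) x (descend I C x v) =
        J0 (local_deriv id C (push d W) x v)"
      unfolding F(3) D descend_def
      by (simp add: hermitian_mapD(1)[OF invariant[OF F(1)] V(1) c'(1) xF] hol[OF c'(1) xd])
  qed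
qed

lemma descend_hermitian_metric:
  assumes h: "hermitian_metric P I h"
  shows "hermitian_metric Q (descend I) (descend h)"
  unfolding hermitian_metric_def riemannian_metric_def
proof (intro conjI ballI allI impI)
  fix C assume C: "C \<in> atlas Q"
  note L = lift_chart_image[OF C]
  show "smooth_on (snd C ` fst C) (\<lambda>x. descend h C x u v)" for u v
    unfolding descend_def
    by (rule smooth_on_subset[OF hermitian_metric_smooth[OF h L(1)] L(3)])
  fix x assume "x \<in> snd C ` fst C"
  then have x: "x \<in> snd (lift_chart C) ` fst (lift_chart C)" using L(3) by blast
  note H = hermitian_metricD[OF h L(1) x]
  show "bilinear (descend h C x)" "descend h C x u v = descend h C x v u"
    "v \<noteq> 0 \<Longrightarrow> 0 < descend h C x v v"
    "descend h C x (descend I C x u) (descend I C x v) = descend h C x u v" for u v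
    unfolding descend_def by (rule H(1), rule H(2), erule H(3), rule H(4))
next
  show "preserves_bilinear Q id (descend h)" by (rule descend_invariant)
qed

text \<open>The SKT equation is an equation between coordinate expressions, and these are the same as
  upstairs.\<close>

theorem descend_skt_structure:
  assumes "skt_structure P I h"
  shows "skt_structure Q (descend I) (descend h)"
proof -
  have "ext_deriv3 (dc_form (descend I) (fundamental_form (descend I) (descend h)) C) x u v w z = 0"
    if C: "C \<in> atlas Q" "x \<in> snd C ` fst C" for C x u v w z
  proof -
    have "dc_form (descend I) (fundamental_form (descend I) (descend h)) C =
        dc_form I (fundamental_form I h) (lift_chart C)"
      by (simp add: dc_form_def fundamental_form_def descend_def)
    then show ?thesis
      using assms lift_chart_image[OF C(1)] C(2) unfolding skt_structure_def by auto
  qed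
  then show ?thesis
    using assms descend_complex_structure descend_hermitian_metric
    by (simp add: skt_structure_def)
qed

end

end

section \<open>Products\<close>

text \<open>The derivative of \<open>g \<circ> L\<close> in the direction \<open>v\<close> is the derivative of \<open>g\<close> in the fixed
  direction \<open>L v\<close>, which makes the induction immediate in every normed space.\<close>

lemma Ck_on_compose_linear:
  assumes L: "bounded_linear L" and "open S" "L ` S \<subseteq> T" "Ck_on n T g"
  shows "Ck_on n S (\<lambda>x. g (L x))"
  using assms(4)
proof (induction n arbitrary: g)
  case 0
  have "continuous_on S L" by (rule bounded_linear.continuous_on[OF L continuous_on_id])
  with 0 show ?case using continuous_on_compose2[of T g S L] assms(3) by simp
next
  case (Suc n)
  show ?case
  proof (rule Ck_on_SucI[OF assms(2), where f' = "\<lambda>x v. frechet_derivative g (at (L x)) (L v)"])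
    fix x assume "x \<in> S"
    then have "(g has_derivative frechet_derivative g (at (L x))) (at (L x))"
      using Ck_on_has_derivative[OF Suc.prems] assms(3) by blast
    from diff_chain_at[OF bounded_linear_imp_has_derivative[OF L] this]
    show "((\<lambda>x. g (L x)) has_derivative (\<lambda>v. frechet_derivative g (at (L x)) (L v))) (at x)"
      by (simp add: o_def)
  next
    show "Ck_on n S (\<lambda>x. frechet_derivative g (at (L x)) (L v))" for v
      by (rule Suc.IH) (use Suc.prems in simp)
  qed
qed

lemma smooth_on_compose_linear:
  assumes "bounded_linear L" "open S" "L ` S \<subseteq> T" "smooth_on T g"
  shows "smooth_on S (\<lambda>x. g (L x))"
  unfolding smooth_on_def
  by (intro allI Ck_on_compose_linear[OF assms(1-3)]) (use assms(4) in \<open>simp add: smooth_on_def\<close>)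

definition prod_chart ::
  "('a, 'e) chart \<Rightarrow> ('b, 'f) chart \<Rightarrow> ('a \<times> 'b, 'e \<times> 'f) chart" where
  "prod_chart c d = (fst c \<times> fst d, map_prod (snd c) (snd d))"

lemma fst_prod_chart [simp]: "fst (prod_chart c d) = fst c \<times> fst d"
  and snd_prod_chart [simp]: "snd (prod_chart c d) = map_prod (snd c) (snd d)"
  by (simp_all add: prod_chart_def)

lemma prod_chart_image [simp]:
  "map_prod (snd c) (snd d) ` (fst c \<times> fst d) = (snd c ` fst c) \<times> (snd d ` fst d)"
  by (rule map_prod_surj_on) simp_all

lemma topo_prod_manifold [simp]:
  "topo (prod_manifold M N) = prod_topology (topo M) (topo N)"
  by (simp add: prod_manifold_def)

lemma atlas_prod_manifold:
  "atlas (prod_manifold M N) = {prod_chart c d | c d. c \<in> atlas M \<and> d \<in> atlas N}"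
  by (simp add: prod_manifold_def prod_chart_def)

lemma openin_prod_elim:
  assumes "openin (prod_topology X Y) S" "(x, y) \<in> S"
  obtains U V where "openin X U" "openin Y V" "x \<in> U" "y \<in> V" "U \<times> V \<subseteq> S"
  using assms(1)[unfolded openin_prod_topology_alt, rule_format, OF assms(2)] that by (elim exE conjE)

lemma prod_is_chart:
  assumes c: "is_chart X c" and d: "is_chart Y d"
  shows "is_chart (prod_topology X Y) (prod_chart c d)"
  unfolding prod_chart_def
proof (rule is_chartI)
  show "openin (prod_topology X Y) (fst c \<times> fst d)"
    using c d by (simp add: openin_prod_Times_iff is_chart_openin)
  show "inj_on (map_prod (snd c) (snd d)) (fst c \<times> fst d)"
    by (rule map_prod_inj_on) (use c d in \<open>simp_all add: is_chart_inj\<close>)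
next
  fix T :: "('b \<times> 'd) set" assume T: "open T"
  show "openin (prod_topology X Y) {p \<in> fst c \<times> fst d. map_prod (snd c) (snd d) p \<in> T}"
    unfolding openin_prod_topology_alt
  proof (intro allI impI)
    fix x y assume xy: "(x, y) \<in> {p \<in> fst c \<times> fst d. map_prod (snd c) (snd d) p \<in> T}"
    then have "(snd c x, snd d y) \<in> T" by simp
    from open_prod_elim[OF T this] obtain A B where "open A" "open B"
      "(snd c x, snd d y) \<in> A \<times> B" "A \<times> B \<subseteq> T" .
    then have AB: "open A" "open B" "snd c x \<in> A" "snd d y \<in> B" "A \<times> B \<subseteq> T" by simp_all
    have "{p \<in> fst c. snd c p \<in> A} \<times> {p \<in> fst d. snd d p \<in> B} \<subseteq>
        {p \<in> fst c \<times> fst d. map_prod (snd c) (snd d) p \<in> T}"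
      using AB(5) by force
    moreover have "x \<in> {p \<in> fst c. snd c p \<in> A}" "y \<in> {p \<in> fst d. snd d p \<in> B}"
      using xy AB(3,4) by simp_all
    ultimately show "\<exists>U V. openin X U \<and> openin Y V \<and> x \<in> U \<and> y \<in> V \<and>
        U \<times> V \<subseteq> {p \<in> fst c \<times> fst d. map_prod (snd c) (snd d) p \<in> T}"
      using is_chart_openin_preimage[OF c AB(1)] is_chart_openin_preimage[OF d AB(2)] by blast
  qed
next
  fix V assume V: "openin (prod_topology X Y) V" "V \<subseteq> fst c \<times> fst d"
  show "open (map_prod (snd c) (snd d) ` V)"
  proof (subst open_subopen, intro ballI)
    fix z assume "z \<in> map_prod (snd c) (snd d) ` V"
    then obtain x y where xy: "(x, y) \<in> V" "z = (snd c x, snd d y)" by auto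
    from openin_prod_elim[OF V(1) xy(1)]
    obtain A B where AB: "openin X A" "openin Y B" "x \<in> A" "y \<in> B" "A \<times> B \<subseteq> V" .
    then have sub: "A \<subseteq> fst c" "B \<subseteq> fst d" using V(2) by auto
    have "open (snd c ` A \<times> snd d ` B)"
      by (intro open_Times is_chart_open_image[OF c AB(1) sub(1)]
          is_chart_open_image[OF d AB(2) sub(2)])
    moreover have "snd c ` A \<times> snd d ` B \<subseteq> map_prod (snd c) (snd d) ` V"
      using AB(5) by force
    moreover have "z \<in> snd c ` A \<times> snd d ` B" using xy(2) AB by blast
    ultimately show "\<exists>T. open T \<and> z \<in> T \<and> T \<subseteq> map_prod (snd c) (snd d) ` V" by blast
  qed
qed

lemma local_dom_prod:
  "local_dom (map_prod f g) (prod_chart c d) (prod_chart c' d') =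
    local_dom f c c' \<times> local_dom g d d'"
  unfolding local_dom_def by force

context
  fixes X :: "'a topology" and Y :: "'b topology"
    and c :: "('a, 'e::real_inner) chart" and d :: "('b, 'f::real_inner) chart"
  assumes c: "is_chart X c" and d: "is_chart Y d"
begin

lemma prod_chart_inv:
  "x \<in> snd c ` fst c \<Longrightarrow> y \<in> snd d ` fst d \<Longrightarrow>
    chart_inv (prod_chart c d) (x, y) = (chart_inv c x, chart_inv d y)"
  using chart_inv_chart[OF prod_is_chart[OF c d]] chart_inv_chart[OF c] chart_inv_chart[OF d]
  by fastforce

lemma local_rep_prod:
  assumes "z \<in> local_dom f c c' \<times> local_dom g d d'"
  shows "local_rep (map_prod f g) (prod_chart c d) (prod_chart c' d') z =
    (local_rep f c c' (fst z), local_rep g d d' (snd z))"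
proof -
  obtain x y where z: "z = (x, y)" by (cases z)
  then have "x \<in> snd c ` fst c" "y \<in> snd d ` fst d" using assms by (auto simp: local_dom_def)
  then have "chart_inv (prod_chart c d) (x, y) = (chart_inv c x, chart_inv d y)"
    by (rule prod_chart_inv)
  then show ?thesis unfolding z local_rep_apply by simp
qed

context
  fixes X' :: "'c topology" and Y' :: "'d topology"
    and c' :: "('c, 'g::real_inner) chart" and d' :: "('d, 'h::real_inner) chart" and f g
  assumes c': "is_chart X' c'" and d': "is_chart Y' d'"
    and f: "continuous_map X X' f" and g: "continuous_map Y Y' g"
    and sf: "smooth_rep f c c'"
    and sg: "smooth_rep g d d'"
begin

lemma local_rep_prod_smooth:
  "smooth_rep (map_prod f g) (prod_chart c d) (prod_chart c' d')"
proof -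
  have o: "open (local_dom f c c' \<times> local_dom g d d')"
    by (intro open_Times open_local_dom[OF c c' f] open_local_dom[OF d d' g])
  have "smooth_on (local_dom f c c' \<times> local_dom g d d')
      (\<lambda>z. (local_rep f c c' (fst z), local_rep g d d' (snd z)))"
    by (intro smooth_on_Pair o smooth_on_compose_linear[OF bounded_linear_fst o _ sf]
        smooth_on_compose_linear[OF bounded_linear_snd o _ sg]) auto
  from smooth_on_cong[OF o local_rep_prod[symmetric] this] show ?thesis
    unfolding local_dom_prod by blast
qed

lemma local_rep_prod_derivative:
  assumes "z \<in> local_dom f c c' \<times> local_dom g d d'"
  shows "local_deriv (map_prod f g) (prod_chart c d) (prod_chart c' d') z v =
    (local_deriv f c c' (fst z) (fst v),
     local_deriv g d d' (snd z) (snd v))"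
proof -
  have o: "open (local_dom f c c' \<times> local_dom g d d')"
    by (intro open_Times open_local_dom[OF c c' f] open_local_dom[OF d d' g])
  have 1: "(local_rep f c c' has_derivative local_deriv f c c' (fst z))
      (at (fst z))"
    and 2: "(local_rep g d d' has_derivative local_deriv g d d' (snd z))
      (at (snd z))"
    using smooth_on_has_derivative[OF sf] smooth_on_has_derivative[OF sg] assms by auto
  have "((\<lambda>z. (local_rep f c c' (fst z), local_rep g d d' (snd z))) has_derivative
      (\<lambda>v. (local_deriv f c c' (fst z) (fst v),
        local_deriv g d d' (snd z) (snd v)))) (at z)"
    using has_derivative_Pair[OF
        diff_chain_at[OF bounded_linear_imp_has_derivative[OF bounded_linear_fst] 1]
        diff_chain_at[OF bounded_linear_imp_has_derivative[OF bounded_linear_snd] 2]]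
    by (simp add: o_def)
  then have "frechet_derivative (\<lambda>z. (local_rep f c c' (fst z), local_rep g d d' (snd z))) (at z) v =
      (local_deriv f c c' (fst z) (fst v),
        local_deriv g d d' (snd z) (snd v))"
    by (simp add: frechet_derivative_at[symmetric])
  moreover have "local_deriv (map_prod f g) (prod_chart c d) (prod_chart c' d') z = frechet_derivative (\<lambda>z. (local_rep f c c' (fst z), local_rep g d d' (snd z))) (at z)"
    by (rule frechet_derivative_cong_open[OF o assms]) (rule local_rep_prod)
  ultimately show ?thesis by simp
qed

end

end

lemma second_countable_prod:
  assumes "second_countable X" "second_countable Y"
  shows "second_countable (prod_topology X Y)"
proof -
  obtain B where B: "countable B" "\<And>V. V \<in> B \<Longrightarrow> openin X V"
      "\<And>U x. openin X U \<Longrightarrow> x \<in> U \<Longrightarrow> \<exists>V\<in>B. x \<in> V \<and> V \<subseteq> U"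
    using assms(1) unfolding second_countable_def by metis
  obtain C where C: "countable C" "\<And>V. V \<in> C \<Longrightarrow> openin Y V"
      "\<And>U x. openin Y U \<Longrightarrow> x \<in> U \<Longrightarrow> \<exists>V\<in>C. x \<in> V \<and> V \<subseteq> U"
    using assms(2) unfolding second_countable_def by metis
  let ?D = "(\<lambda>(U, V). U \<times> V) ` (B \<times> C)"
  have "\<exists>W\<in>?D. z \<in> W \<and> W \<subseteq> U" if U: "openin (prod_topology X Y) U" "z \<in> U" for U z
  proof -
    obtain x y where z: "z = (x, y)" by (cases z)
    from openin_prod_elim[OF U(1) U(2)[unfolded z]]
    obtain A A' where A: "openin X A" "openin Y A'" "x \<in> A" "y \<in> A'" "A \<times> A' \<subseteq> U" .
    obtain V where V: "V \<in> B" "x \<in> V" "V \<subseteq> A" using B(3)[OF A(1,3)] by blast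
    obtain V' where V': "V' \<in> C" "y \<in> V'" "V' \<subseteq> A'" using C(3)[OF A(2,4)] by blast
    show ?thesis
      by (rule bexI[of _ "V \<times> V'"]) (use V V' A z in auto)
  qed
  moreover have "countable ?D" using B(1) C(1) by simp
  moreover have "openin (prod_topology X Y) W" if "W \<in> ?D" for W
    using that B(2) C(2) by (auto simp: openin_prod_Times_iff)
  ultimately show ?thesis unfolding second_countable_def
    by (intro exI[of _ ?D] conjI ballI allI impI) (erule conjE, assumption | assumption)+
qed

lemma second_countable_euclidean:
  "second_countable (euclidean :: 'a::second_countable_topology topology)"
proof -
  obtain B :: "'a set set" where B: "countable B" "topological_basis B"
    using ex_countable_basis by blast
  have "\<exists>V\<in>B. x \<in> V \<and> V \<subseteq> U" if "open U" "x \<in> U" for U x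
    using topological_basisE[OF B(2) that] by metis
  then show ?thesis
    unfolding second_countable_def using B(1) topological_basis_open[OF B(2)]
    by (intro exI[of _ B] conjI ballI allI impI) (simp_all flip: open_openin)
qed

lemma map_prod_id: "map_prod id id = id"
  by (rule ext) auto

theorem smooth_manifold_prod:
  fixes M :: "('a, 'e::real_inner) manifold" and N :: "('b, 'f::real_inner) manifold"
  assumes M: "smooth_manifold m M" and N: "smooth_manifold n N"
  shows "smooth_manifold (m + n) (prod_manifold M N)"
  unfolding smooth_manifold_iff_onb
proof (intro conjI ballI)
  show "\<exists>B :: ('e \<times> 'f) set. onb B \<and> card B = m + n"
    using M N onb_Times unfolding smooth_manifold_iff_onb by metis
  show "Hausdorff_space (topo (prod_manifold M N))"
    using M N by (simp add: Hausdorff_space_prod_topology smooth_manifold_def)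
  show "second_countable (topo (prod_manifold M N))"
    using M N by (simp add: second_countable_prod smooth_manifold_def)
  show "is_chart (topo (prod_manifold M N)) C" if "C \<in> atlas (prod_manifold M N)" for C
    using that manifold_chart[OF M] manifold_chart[OF N] prod_is_chart
    unfolding atlas_prod_manifold topo_prod_manifold by blast
  have "(\<Union>C\<in>atlas (prod_manifold M N). fst C) =
      (\<Union>c\<in>atlas M. fst c) \<times> (\<Union>d\<in>atlas N. fst d)"
    unfolding atlas_prod_manifold by fastforce
  then show "(\<Union>C\<in>atlas (prod_manifold M N). fst C) = topspace (topo (prod_manifold M N))"
    using M N by (simp add: smooth_manifold_def)
  fix C D assume "C \<in> atlas (prod_manifold M N)" "D \<in> atlas (prod_manifold M N)"
  then obtain c d c' d' where C: "c \<in> atlas M" "d \<in> atlas N" "C = prod_chart c d"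
    and D: "c' \<in> atlas M" "d' \<in> atlas N" "D = prod_chart c' d'"
    unfolding atlas_prod_manifold by blast
  note ch = manifold_chart[OF M C(1)] manifold_chart[OF N C(2)]
    manifold_chart[OF M D(1)] manifold_chart[OF N D(2)]
  show "smoothly_compatible C D"
    unfolding smoothly_compatible_def C(3) D(3)
    using local_rep_prod_smooth[OF ch continuous_map_id continuous_map_id
        manifold_transition_smooth[OF M C(1) D(1)] manifold_transition_smooth[OF N C(2) D(2)]]
      local_rep_prod_smooth[OF ch(3,4,1,2) continuous_map_id continuous_map_id
        manifold_transition_smooth[OF M D(1) C(1)] manifold_transition_smooth[OF N D(2) C(2)]]
    by (simp add: map_prod_id)
qed

lemma continuous_map_map_prod:
  assumes "continuous_map X X' f" "continuous_map Y Y' g"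
  shows "continuous_map (prod_topology X Y) (prod_topology X' Y') (map_prod f g)"
proof -
  have "map_prod f g = (\<lambda>z. ((f \<circ> fst) z, (g \<circ> snd) z))" by (rule ext) (auto simp: map_prod_def)
  then show ?thesis
    using continuous_map_pairedI[OF continuous_map_compose[OF continuous_map_fst assms(1)]
        continuous_map_compose[OF continuous_map_snd assms(2)]] by simp
qed

lemma smooth_map_prod:
  assumes M: "smooth_manifold m M" and M': "smooth_manifold m' M'"
    and N: "smooth_manifold n N" and N': "smooth_manifold n' N'"
    and f: "smooth_map M M' f" and g: "smooth_map N N' g"
  shows "smooth_map (prod_manifold M N) (prod_manifold M' N') (map_prod f g)"
  unfolding smooth_map_def
proof (intro conjI ballI)
  have cf: "continuous_map (topo M) (topo M') f" and cg: "continuous_map (topo N) (topo N') g"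
    using f g by (auto simp: smooth_map_def)
  then show "continuous_map (topo (prod_manifold M N)) (topo (prod_manifold M' N')) (map_prod f g)"
    by (simp add: continuous_map_map_prod)
  fix C D assume "C \<in> atlas (prod_manifold M N)" "D \<in> atlas (prod_manifold M' N')"
  then obtain c d c' d' where C: "c \<in> atlas M" "d \<in> atlas N" "C = prod_chart c d"
    and D: "c' \<in> atlas M'" "d' \<in> atlas N'" "D = prod_chart c' d'"
    unfolding atlas_prod_manifold by blast
  have "smooth_rep f c c'"
    "smooth_rep g d d'"
    using f g C D by (auto simp: smooth_map_def)
  then show "smooth_rep (map_prod f g) C D"
    unfolding C(3) D(3)
    by (intro local_rep_prod_smooth[OF manifold_chart[OF M C(1)] manifold_chart[OF N C(2)]
        manifold_chart[OF M' D(1)] manifold_chart[OF N' D(2)] cf cg])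
qed

section \<open>The line and mapping tori\<close>

lemma UNIV_id_is_chart: "is_chart euclidean (UNIV, id)"
  by (rule is_chartI) auto

lemma line_rep: "local_dom f (UNIV, id) (UNIV, id) = UNIV" "local_rep f (UNIV, id) (UNIV, id) = f"
  by (auto simp: local_dom_def local_rep_def)

lemma topo_line [simp]: "topo line_manifold = euclidean"
  and atlas_line [simp]: "atlas line_manifold = {(UNIV, id)}"
  by (simp_all add: line_manifold_def)

lemma smooth_manifold_line: "smooth_manifold 1 line_manifold"
  unfolding smooth_manifold_iff_onb
proof (intro conjI ballI)
  show "\<exists>B :: real set. onb B \<and> card B = 1"
    by (intro exI[of _ Basis] conjI onb_Basis) simp
  show "smoothly_compatible c d" if "c \<in> atlas line_manifold" "d \<in> atlas line_manifold" for c d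
  proof -
    have "smooth_on UNIV (id :: real \<Rightarrow> real)" unfolding id_def by (rule smooth_on_id)
    then show ?thesis using that by (simp add: smoothly_compatible_def line_rep)
  qed
qed (auto simp: second_countable_euclidean UNIV_id_is_chart)

lemma smooth_map_translation: "smooth_map line_manifold line_manifold (\<lambda>t. t + a)"
proof -
  have "smooth_on UNIV (\<lambda>t::real. t + a)" by (intro smooth_intros open_UNIV)
  moreover have "continuous_on UNIV (\<lambda>t::real. t + a)" by (intro continuous_intros)
  ultimately show ?thesis by (simp add: smooth_map_def line_rep)
qed

definition torus_deck :: "'a set \<Rightarrow> ('a \<Rightarrow> 'a) \<Rightarrow> int \<Rightarrow> 'a \<times> real \<Rightarrow> 'a \<times> real" where
  "torus_deck S f k = map_prod (int_funpow S f k) (\<lambda>t. t + of_int k)"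

lemma int_funpow_induct:
  assumes "Q id" "\<And>g. Q g \<Longrightarrow> Q (f \<circ> g)" "\<And>g. Q g \<Longrightarrow> Q (inv_into S f \<circ> g)"
  shows "Q (int_funpow S f k)"
proof -
  have "Q (f ^^ m)" "Q (inv_into S f ^^ m)" for m
    by (induction m) (use assms in auto)
  then show ?thesis by (simp add: int_funpow_def)
qed

lemma int_funpow_0: "int_funpow S f 0 p = p"
  by (simp add: int_funpow_def)

context
  fixes N :: "('a, 'e::real_inner) manifold" and n and f :: "'a \<Rightarrow> 'a"
  assumes N: "smooth_manifold n N" and f: "diffeomorphism_of N f"
begin

private abbreviation "S \<equiv> topspace (topo N)"

lemma int_funpow_smooth: "smooth_map N N (int_funpow S f k)"
proof (rule int_funpow_induct)
  have "smooth_map N N f" "smooth_map N N (inv_into S f)"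
    using f by (simp_all add: diffeomorphism_of_def)
  then show "smooth_map N N (f \<circ> g)" "smooth_map N N (inv_into S f \<circ> g)"
    if "smooth_map N N g" for g
    using smooth_map_compose[OF N N N that] by blast+
qed (rule smooth_map_id[OF N])

lemma int_funpow_in: "p \<in> S \<Longrightarrow> int_funpow S f k p \<in> S"
  using int_funpow_smooth[of k] by (auto simp: smooth_map_def continuous_map_def)

lemma diffeomorphism_inverse:
  "p \<in> S \<Longrightarrow> f (inv_into S f p) = p" "p \<in> S \<Longrightarrow> inv_into S f (f p) = p"
  using f by (auto simp: diffeomorphism_of_def bij_betw_inv_into_right bij_betw_inv_into_left)

lemma int_funpow_Suc:
  assumes p: "p \<in> S" shows "int_funpow S f (k + 1) p = f (int_funpow S f k p)"
proof (cases "k \<ge> 0")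
  case True
  then show ?thesis by (simp add: int_funpow_def nat_add_distrib)
next
  case False
  define m where "m = nat (- (k + 1))"
  have "nat (- k) = Suc m" using False by (simp add: m_def)
  then have k: "int_funpow S f k p = inv_into S f ((inv_into S f ^^ m) p)"
    using False by (simp add: int_funpow_def)
  have k1: "int_funpow S f (k + 1) p = (inv_into S f ^^ m) p"
    using False by (cases "k = - 1") (auto simp: int_funpow_def m_def)
  show ?thesis unfolding k
    using diffeomorphism_inverse(1) int_funpow_in[OF p, of "k + 1"] k1 by simp
qed

lemma int_funpow_add:
  assumes p: "p \<in> S" shows "int_funpow S f (j + k) p = int_funpow S f j (int_funpow S f k p)"
proof (induction j rule: int_induct[where k = 0])
  case base
  then show ?case by (simp add: int_funpow_def)
next
  case (step1 i)
  then show ?case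
    using int_funpow_Suc[OF p, of "i + k"] int_funpow_Suc[OF int_funpow_in[OF p], of i k]
    by (simp add: algebra_simps)
next
  case (step2 i)
  have "f (int_funpow S f (i - 1 + k) p) = f (int_funpow S f (i - 1) (int_funpow S f k p))"
    using int_funpow_Suc[OF p, of "i - 1 + k"] step2
      int_funpow_Suc[OF int_funpow_in[OF p], of "i - 1" k]
    by (simp add: algebra_simps)
  then show ?case
    using diffeomorphism_inverse(2) int_funpow_in int_funpow_in[OF int_funpow_in] p by metis
qed

lemma orbit_eq_iff:
  assumes p: "p \<in> S"
  shows "mapping_torus_orbit S f (p, t) = mapping_torus_orbit S f (p', t') \<longleftrightarrow>
    (\<exists>k. p' = int_funpow S f k p \<and> t' = t + of_int k)"
proof
  assume eq: "mapping_torus_orbit S f (p, t) = mapping_torus_orbit S f (p', t')"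
  have "(int_funpow S f 0 p', t' + of_int 0) \<in> mapping_torus_orbit S f (p', t')"
    unfolding mapping_torus_orbit_def by blast
  then have "(p', t') \<in> mapping_torus_orbit S f (p, t)"
    unfolding eq by (simp add: int_funpow_0)
  then show "\<exists>k. p' = int_funpow S f k p \<and> t' = t + of_int k"
    by (auto simp: mapping_torus_orbit_def)
next
  assume "\<exists>k. p' = int_funpow S f k p \<and> t' = t + of_int k"
  then obtain k where k: "p' = int_funpow S f k p" "t' = t + of_int k" by blast
  have sub: "mapping_torus_orbit S f (int_funpow S f j a, s + of_int j) \<subseteq> mapping_torus_orbit S f (a, s)"
    if "a \<in> S" for a s j
  proof
    fix z assume "z \<in> mapping_torus_orbit S f (int_funpow S f j a, s + of_int j)"
    then obtain i where "z = (int_funpow S f i (int_funpow S f j a), s + of_int j + of_int i)"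
      by (auto simp: mapping_torus_orbit_def)
    then have "z = (int_funpow S f (i + j) a, s + of_int (i + j))"
      using int_funpow_add[OF that] by simp
    then show "z \<in> mapping_torus_orbit S f (a, s)" unfolding mapping_torus_orbit_def by blast
  qed
  have "int_funpow S f (- k) p' = p"
    using int_funpow_add[OF p, of "- k" k] by (simp add: k(1) int_funpow_0)
  then have "mapping_torus_orbit S f (p, t) \<subseteq> mapping_torus_orbit S f (p', t')"
    using sub[of p' "- k" t'] int_funpow_in[OF p] k by simp
  moreover have "mapping_torus_orbit S f (p', t') \<subseteq> mapping_torus_orbit S f (p, t)"
    using sub[OF p, of k t] k by simp
  ultimately show "mapping_torus_orbit S f (p, t) = mapping_torus_orbit S f (p', t')" by blast
qed

text \<open>Two orbits are separated either in the time direction, if their times differ modulo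
  \<open>1\<close>, or in the fibre, after moving one of them by the single power of \<open>f\<close> that
  aligns the times.\<close>

theorem mapping_torus_is_deck_quotient:
  "deck_quotient (prod_manifold N line_manifold) (n + 1) (mapping_torus_orbit S f)
    (range (torus_deck S f))"
proof
  show "smooth_manifold (n + 1) (prod_manifold N line_manifold)"
    by (rule smooth_manifold_prod[OF N smooth_manifold_line])
  show "smooth_map (prod_manifold N line_manifold) (prod_manifold N line_manifold) F"
    if "F \<in> range (torus_deck S f)" for F
    using that smooth_map_prod[OF N N smooth_manifold_line smooth_manifold_line int_funpow_smooth
        smooth_map_translation] by (auto simp: torus_deck_def)
  have ts: "topspace (topo (prod_manifold N line_manifold)) = S \<times> UNIV" by simp
  show "mapping_torus_orbit S f (F z) = mapping_torus_orbit S f z"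
    if F: "F \<in> range (torus_deck S f)" and z: "z \<in> topspace (topo (prod_manifold N line_manifold))" for F z
  proof -
    obtain p t k where pt: "z = (p, t)" "F = torus_deck S f k" using F by (cases z) auto
    then have "p \<in> S" using z by simp
    then have "mapping_torus_orbit S f (p, t) =
        mapping_torus_orbit S f (int_funpow S f k p, t + of_int k)"
      using orbit_eq_iff by blast
    then show ?thesis by (simp add: pt torus_deck_def)
  qed
  show "\<exists>F\<in>range (torus_deck S f). F z = z'"
    if z: "z \<in> topspace (topo (prod_manifold N line_manifold))"
      and eq: "mapping_torus_orbit S f z = mapping_torus_orbit S f z'" for z z'
  proof -
    obtain p t p' t' where pt: "z = (p, t)" "z' = (p', t')" by (cases z, cases z') auto
    then have "p \<in> S" using z by simp
    then obtain k where "p' = int_funpow S f k p" "t' = t + of_int k"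
      using eq orbit_eq_iff unfolding pt by blast
    then have "torus_deck S f k z = z'" by (simp add: pt torus_deck_def)
    then show ?thesis by blast
  qed
  have rect: "openin (topo (prod_manifold N line_manifold)) (U \<times> V)"
    if "openin (topo N) U" "open V" for U V
    using that by (simp add: openin_prod_Times_iff)
  show "\<exists>W. openin (topo (prod_manifold N line_manifold)) W \<and> z \<in> W \<and>
      inj_on (mapping_torus_orbit S f) W"
    if z: "z \<in> topspace (topo (prod_manifold N line_manifold))" for z
  proof -
    obtain p t where pt: "z = (p, t)" "p \<in> S" using z by (cases z) auto
    have "inj_on (mapping_torus_orbit S f) (S \<times> ball t (1/2))"
    proof (rule inj_onI)
      fix a b assume ab: "a \<in> S \<times> ball t (1/2)" "b \<in> S \<times> ball t (1/2)"
        and eq: "mapping_torus_orbit S f a = mapping_torus_orbit S f b"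
      obtain a1 a2 b1 b2 where [simp]: "a = (a1, a2)" "b = (b1, b2)" by (cases a, cases b) auto
      have "a1 \<in> S" using ab(1) by simp
      then obtain k where k: "b1 = int_funpow S f k a1" "b2 = a2 + of_int k"
        using eq orbit_eq_iff by auto
      have "\<bar>t - a2\<bar> < 1/2" "\<bar>t - b2\<bar> < 1/2" using ab by (auto simp: dist_real_def)
      then have "\<bar>real_of_int k\<bar> < 1" unfolding k(2) by linarith
      then have "k = 0" by linarith
      then show "a = b" using k by (simp add: int_funpow_0)
    qed
    then show ?thesis
      using rect[OF openin_topspace open_ball[of t "1/2"]] pt
      by (intro exI[of _ "S \<times> ball t (1/2)"]) auto
  qed
  show "\<exists>U V. openin (topo (prod_manifold N line_manifold)) U \<and>
      openin (topo (prod_manifold N line_manifold)) V \<and> z \<in> U \<and> z' \<in> V \<and>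
      mapping_torus_orbit S f ` U \<inter> mapping_torus_orbit S f ` V = {}"
    if z: "z \<in> topspace (topo (prod_manifold N line_manifold))"
      and z': "z' \<in> topspace (topo (prod_manifold N line_manifold))"
      and ne: "mapping_torus_orbit S f z \<noteq> mapping_torus_orbit S f z'" for z z'
  proof -
    obtain p t p' t' where pt: "z = (p, t)" "z' = (p', t')" "p \<in> S" "p' \<in> S"
      using z z' by (cases z, cases z') auto
    have disjoint: "mapping_torus_orbit S f ` (A \<times> ball t e) \<inter>
        mapping_torus_orbit S f ` (B \<times> ball t' e) = {}"
      if A: "A \<subseteq> S" and no: "\<And>k a. a \<in> A \<Longrightarrow> int_funpow S f k a \<in> B \<Longrightarrow>
        \<bar>t' - t - of_int k\<bar> < 2 * e \<Longrightarrow> False" for A B e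
    proof (rule ccontr)
      assume "mapping_torus_orbit S f ` (A \<times> ball t e) \<inter>
        mapping_torus_orbit S f ` (B \<times> ball t' e) \<noteq> {}"
      then obtain a s b s' where as: "a \<in> A" "s \<in> ball t e" "b \<in> B" "s' \<in> ball t' e"
        and eq: "mapping_torus_orbit S f (a, s) = mapping_torus_orbit S f (b, s')" by fastforce
      have "a \<in> S" using as A by blast
      then obtain k where k: "b = int_funpow S f k a" "s' = s + of_int k"
        using eq orbit_eq_iff by blast
      have "\<bar>t - s\<bar> < e" "\<bar>t' - s'\<bar> < e" using as(2,4) by (auto simp: dist_real_def)
      then have "\<bar>t' - t - of_int k\<bar> < 2 * e" unfolding k(2) by linarith
      then show False using no[OF as(1), of k] as(3) k(1) by blast
    qed
    show ?thesis
    proof (cases "\<exists>k. t' = t + of_int k")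
      case True
      then obtain k where k: "t' = t + of_int k" by blast
      then have "int_funpow S f k p \<noteq> p'" using ne orbit_eq_iff[OF pt(3)] unfolding pt by blast
      then obtain U V where UV: "openin (topo N) U" "openin (topo N) V" "int_funpow S f k p \<in> U"
          "p' \<in> V" "disjnt U V"
        using N pt(4) int_funpow_in[OF pt(3), of k]
        unfolding smooth_manifold_def Hausdorff_space_def by blast
      let ?A = "{a \<in> S. int_funpow S f k a \<in> U}"
      have "continuous_map (topo N) (topo N) (int_funpow S f k)"
        using int_funpow_smooth by (simp add: smooth_map_def)
      then have oA: "openin (topo N) ?A" using UV(1) by (rule openin_continuous_map_preimage)
      have "mapping_torus_orbit S f ` (?A \<times> ball t (1/4)) \<inter>
          mapping_torus_orbit S f ` (V \<times> ball t' (1/4)) = {}"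
      proof (rule disjoint)
        fix j a assume a: "a \<in> ?A" "int_funpow S f j a \<in> V"
          and "\<bar>t' - t - real_of_int j\<bar> < 2 * (1/4)"
        then have "j = k" using k by linarith
        then show False using a UV(5) by (auto simp: disjnt_def)
      qed blast
      then show ?thesis
        using rect[OF oA open_ball[of t "1/4"]] rect[OF UV(2) open_ball[of t' "1/4"]] pt UV
        by (intro exI[of _ "?A \<times> ball t (1/4)"] exI[of _ "V \<times> ball t' (1/4)"]) auto
    next
      case False
      \<comment> \<open>Half the distance of \<open>t' - t\<close> from the nearest integer.\<close>
      define e where "e = \<bar>t' - t - of_int (round (t' - t))\<bar> / 2"
      have "t' - t \<noteq> of_int (round (t' - t))" using False by (metis add.commute diff_add_cancel)
      then have e: "e > 0" by (simp add: e_def)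
      have "mapping_torus_orbit S f ` (S \<times> ball t e) \<inter>
          mapping_torus_orbit S f ` (S \<times> ball t' e) = {}"
      proof (rule disjoint)
        fix j a assume "\<bar>t' - t - real_of_int j\<bar> < 2 * e"
        then show False using round_diff_minimal[of "t' - t" j] by (simp add: e_def)
      qed blast
      then show ?thesis
        using rect[OF openin_topspace open_ball[of t e]] rect[OF openin_topspace open_ball[of t' e]]
          pt e
        by (intro exI[of _ "S \<times> ball t e"] exI[of _ "S \<times> ball t' e"]) auto
    qed
  qed
qed

end

section \<open>The Hopf structure in stereographic coordinates\<close>

definition e3 :: "real^3" where "e3 = axis 3 1"

lemma e3_nth [simp]: "e3 $ 1 = 0" "e3 $ 2 = 0" "e3 $ 3 = 1"
  by (simp_all add: e3_def axis_def)

lemmas vec3_simps = inner_vec_def sum_3 vec_eq_iff forall_3 cross_components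

lemma bounded_bilinear_cross3: "bounded_bilinear cross3"
  unfolding bilinear_conv_bounded_bilinear[symmetric] bilinear_def
  by (auto intro!: linearI simp: cross_add_left cross_add_right cross_mult_left cross_mult_right)

text \<open>Right multiplication by \<open>- e3\<close> on the quaternions, a quaternion being the pair of its imaginary
  and its real part.  With it \<open>\<real>\<^sup>3 \<times> \<real>\<close> is a copy of \<open>\<complex>\<^sup>2\<close>.\<close>

definition hopf_j :: "(real^3) \<times> real \<Rightarrow> (real^3) \<times> real" where
  "hopf_j z = (cross3 e3 (fst z) - snd z *\<^sub>R e3, e3 \<bullet> fst z)"

lemma linear_hopf_j: "linear hopf_j"
  by (rule linearI) (auto simp: hopf_j_def cross_add_right cross_mult_right algebra_simps)

lemma hopf_j_squared: "hopf_j (hopf_j z) = - z"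
  by (auto simp: hopf_j_def prod_eq_iff vec3_simps)

lemma hopf_j_isometry: "hopf_j z \<bullet> hopf_j w = z \<bullet> w"
  by (simp add: hopf_j_def inner_prod_def vec3_simps algebra_simps)

text \<open>The factor by which inverse stereographic projection scales lengths.\<close>

definition conf :: "real^3 \<Rightarrow> real" where "conf x = 2 / (1 + x \<bullet> x)"

lemma conf_denom: "1 + x \<bullet> x > (0::real)"
  by (simp add: add_pos_nonneg)

lemma conf_pos: "conf x > 0"
  using conf_denom by (simp add: conf_def)

lemma conf_mult: "conf x * ((1 + x \<bullet> x) / 2) = 1"
  using conf_denom[of x] by (simp add: conf_def)

text \<open>The vector field \<open>z \<mapsto> hopf_j z\<close> on \<open>S\<^sup>3\<close> in the stereographic coordinates taken from the
  pole \<open>(0, \<epsilon>)\<close>.\<close>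

definition hopf_field :: "real \<Rightarrow> real^3 \<Rightarrow> real^3" where
  "hopf_field \<epsilon> x = cross3 e3 x + \<epsilon> *\<^sub>R ((e3 \<bullet> x) *\<^sub>R x - ((x \<bullet> x - 1) / 2) *\<^sub>R e3)"

text \<open>The structure \<open>hopf_j\<close> pulled back along \<open>hopf_embed\<close> below: the unit vector of the line goes to
  the Hopf field, and the plane orthogonal to the Hopf field is turned by a right angle.  The sign of
  the rotation depends on \<open>\<epsilon>\<close> because the two stereographic charts induce opposite orientations.\<close>

definition hopf_I :: "real \<Rightarrow> (real^3) \<times> real \<Rightarrow> (real^3) \<times> real \<Rightarrow> (real^3) \<times> real" where
  "hopf_I \<epsilon> y U =
    (snd U *\<^sub>R hopf_field \<epsilon> (fst y) +
      (\<epsilon> * conf (fst y)) *\<^sub>R cross3 (hopf_field \<epsilon> (fst y)) (fst U),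
     - ((conf (fst y))\<^sup>2 * (hopf_field \<epsilon> (fst y) \<bullet> fst U)))"

text \<open>The round metric plus \<open>dt\<^sup>2\<close>; under \<open>hopf_embed\<close> it is the flat metric divided by the squared
  distance from the origin.\<close>

definition hopf_h :: "(real^3) \<times> real \<Rightarrow> (real^3) \<times> real \<Rightarrow> (real^3) \<times> real \<Rightarrow> real" where
  "hopf_h y U V = (conf (fst y))\<^sup>2 * (fst U \<bullet> fst V) + snd U * snd V"

text \<open>Inverse stereographic projection followed by \<open>(q, t) \<mapsto> e\<^sup>t q\<close>.  The image is the complement of
  the closed half-line through the pole.\<close>

definition hopf_embed :: "real \<Rightarrow> (real^3) \<times> real \<Rightarrow> (real^3) \<times> real" where
  "hopf_embed \<epsilon> y =
    (exp (snd y) *\<^sub>R (conf (fst y) *\<^sub>R fst y), exp (snd y) * (\<epsilon> * (1 - conf (fst y))))"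

definition hopf_embed_deriv ::
  "real \<Rightarrow> (real^3) \<times> real \<Rightarrow> (real^3) \<times> real \<Rightarrow> (real^3) \<times> real" where
  "hopf_embed_deriv \<epsilon> y U = exp (snd y) *\<^sub>R
    ((snd U * conf (fst y)) *\<^sub>R fst y + conf (fst y) *\<^sub>R fst U
        - ((conf (fst y))\<^sup>2 * (fst y \<bullet> fst U)) *\<^sub>R fst y,
     \<epsilon> * (snd U * (1 - conf (fst y)) + (conf (fst y))\<^sup>2 * (fst y \<bullet> fst U)))"

definition hopf_field_deriv :: "real \<Rightarrow> real^3 \<Rightarrow> real^3 \<Rightarrow> real^3" where
  "hopf_field_deriv \<epsilon> x u =
    cross3 e3 u + \<epsilon> *\<^sub>R ((e3 \<bullet> u) *\<^sub>R x + (e3 \<bullet> x) *\<^sub>R u - (x \<bullet> u) *\<^sub>R e3)"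

definition hopf_omega :: "real \<Rightarrow> (real^3) \<times> real \<Rightarrow> (real^3) \<times> real \<Rightarrow> (real^3) \<times> real \<Rightarrow> real" where
  "hopf_omega \<epsilon> y U V = hopf_h y (hopf_I \<epsilon> y U) V"

text \<open>The derivative in the direction \<open>u\<close> of \<open>\<eta>(w) = conf\<^sup>2 \<xi> \<bullet> w\<close>, the one-form dual to the
  Hopf field \<open>\<xi>\<close>.\<close>

definition eta_deriv :: "real \<Rightarrow> real^3 \<Rightarrow> real^3 \<Rightarrow> real^3 \<Rightarrow> real" where
  "eta_deriv \<epsilon> x u w = conf x ^ 2 * (hopf_field_deriv \<epsilon> x u \<bullet> w)
      - 2 * conf x ^ 3 * (x \<bullet> u) * (hopf_field \<epsilon> x \<bullet> w)"

text \<open>The derivative in the direction \<open>u\<close> of \<open>conf\<^sup>3 \<xi> \<bullet> w\<close>, where \<open>conf\<^sup>3\<close> is the density of the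
  round volume; its trace is that density times the divergence of the Hopf field on the
  sphere.\<close>

definition flux_deriv :: "real \<Rightarrow> real^3 \<Rightarrow> real^3 \<Rightarrow> real^3 \<Rightarrow> real" where
  "flux_deriv \<epsilon> x u w = conf x ^ 3 * (hopf_field_deriv \<epsilon> x u \<bullet> w)
      - 3 * conf x ^ 4 * (x \<bullet> u) * (hopf_field \<epsilon> x \<bullet> w)"

lemma conf_has_derivative: "(conf has_derivative (\<lambda>u. - ((conf x)\<^sup>2 * (x \<bullet> u)))) (at x)"
proof -
  have "((\<lambda>x::real^3. 2 / (1 + x \<bullet> x)) has_derivative
      (\<lambda>u. - (2 * (x \<bullet> u + u \<bullet> x)) / ((1 + x \<bullet> x) * (1 + x \<bullet> x)))) (at x)"
    using conf_denom[of x] by (auto intro!: derivative_eq_intros simp: divide_simps)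
  moreover have "- (2 * (x \<bullet> u + u \<bullet> x)) / ((1 + x \<bullet> x) * (1 + x \<bullet> x)) =
      - ((conf x)\<^sup>2 * (x \<bullet> u))" for u
    using conf_denom[of x]
    by (simp add: conf_def power2_eq_square inner_commute[of u x] divide_simps)
  ultimately show ?thesis by (simp add: conf_def[abs_def])
qed

lemma hopf_embed_has_derivative:
  "(hopf_embed \<epsilon> has_derivative hopf_embed_deriv \<epsilon> y) (at y)"
proof -
  have c: "((\<lambda>y::(real^3) \<times> real. conf (fst y)) has_derivative
      (\<lambda>U. - ((conf (fst y))\<^sup>2 * (fst y \<bullet> fst U)))) (at y)"
    using diff_chain_at[OF bounded_linear_imp_has_derivative[OF bounded_linear_fst]
        conf_has_derivative] by (simp add: o_def)
  have f: "((fst :: (real^3) \<times> real \<Rightarrow> _) has_derivative fst) (at y)"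
    and s: "((snd :: (real^3) \<times> real \<Rightarrow> _) has_derivative snd) (at y)"
    by (auto intro: bounded_linear_imp_has_derivative bounded_linear_fst bounded_linear_snd)
  have e: "((\<lambda>y::(real^3) \<times> real. exp (snd y)) has_derivative (\<lambda>U. snd U * exp (snd y))) (at y)"
    by (auto intro!: derivative_eq_intros s)
  have "((\<lambda>y. (exp (snd y) *\<^sub>R (conf (fst y) *\<^sub>R fst y),
      exp (snd y) * (\<epsilon> * (1 - conf (fst y))))) has_derivative hopf_embed_deriv \<epsilon> y) (at y)"
    by (rule has_derivative_eq_rhs[OF has_derivative_Pair[OF
        has_derivative_scaleR[OF e has_derivative_scaleR[OF c f]]
        has_derivative_mult[OF e has_derivative_mult_right[OF
            has_derivative_diff[OF has_derivative_const c]]]]])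
      (simp add: hopf_embed_deriv_def fun_eq_iff algebra_simps)
  then show ?thesis by (simp add: hopf_embed_def[abs_def])
qed

lemma linear_hopf_embed_deriv: "linear (hopf_embed_deriv \<epsilon> y)"
  by (rule has_derivative_linear[OF hopf_embed_has_derivative])

lemma hopf_field_nth:
  "hopf_field \<epsilon> x $ 1 = \<epsilon> * (x $ 3 * x $ 1) - x $ 2"
  "hopf_field \<epsilon> x $ 2 = \<epsilon> * (x $ 3 * x $ 2) + x $ 1"
  "hopf_field \<epsilon> x $ 3 = \<epsilon> * (x $ 3 * x $ 3 + 1 - (1 + x \<bullet> x) / 2)"
  by (simp_all add: hopf_field_def inner_vec_def sum_3 cross_components field_simps)

lemma hopf_field_inner: "x \<bullet> hopf_field \<epsilon> x = \<epsilon> * (e3 \<bullet> x) * ((1 + x \<bullet> x) / 2)"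
  by (simp add: hopf_field_def vec3_simps field_simps)

lemma hopf_h_pos: assumes "U \<noteq> 0" shows "hopf_h y U U > 0"
proof (cases "fst U = 0")
  case True
  then have "snd U \<noteq> 0" using assms by (simp add: prod_eq_iff)
  then show ?thesis using True by (simp add: hopf_h_def flip: power2_eq_square)
next
  case False
  then have "(conf (fst y))\<^sup>2 * (fst U \<bullet> fst U) > 0"
    using conf_pos[of "fst y"] by simp
  then show ?thesis by (simp add: hopf_h_def add_pos_nonneg)
qed

context
  fixes \<epsilon> :: real assumes eps: "\<epsilon> = 1 \<or> \<epsilon> = - 1"
begin

lemma hopf_field_norm: "hopf_field \<epsilon> x \<bullet> hopf_field \<epsilon> x = ((1 + x \<bullet> x) / 2)\<^sup>2"
  using eps by (auto simp: hopf_field_def vec3_simps power2_eq_square field_simps)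

lemma hopf_field_unit: "(conf x)\<^sup>2 * (hopf_field \<epsilon> x \<bullet> hopf_field \<epsilon> x) = 1"
  unfolding hopf_field_norm power_mult_distrib[symmetric] conf_mult by simp

text \<open>Inverse stereographic projection scales lengths by \<open>conf\<close>, and multiplication by
  \<open>e\<^sup>t\<close> scales the sphere and the radial direction alike.\<close>

lemma hopf_embed_conformal:
  "hopf_embed_deriv \<epsilon> y U \<bullet> hopf_embed_deriv \<epsilon> y V = (exp (snd y))\<^sup>2 * hopf_h y U V"
proof -
  obtain x t u a v b where [simp]: "y = (x, t)" "U = (u, a)" "V = (v, b)"
    by (cases y, cases U, cases V)
  define r where "r = conf x"
  \<comment> \<open>The relation \<open>r (1 + x \<bullet> x) = 2\<close>, multiplied by \<open>r\<close>.\<close>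
  have r: "r * r * (x \<bullet> x) = 2 * r - r * r"
    using arg_cong[OF conf_mult[of x], of "\<lambda>z. 2 * r * z"] by (simp add: r_def algebra_simps)
  have ee: "\<epsilon> * \<epsilon> = 1" using eps by auto
  have "((a * r) *\<^sub>R x + r *\<^sub>R u - (r\<^sup>2 * (x \<bullet> u)) *\<^sub>R x) \<bullet> ((b * r) *\<^sub>R x + r *\<^sub>R v - (r\<^sup>2 * (x \<bullet> v)) *\<^sub>R x)
      + (\<epsilon> * (a * (1 - r) + r\<^sup>2 * (x \<bullet> u))) * (\<epsilon> * (b * (1 - r) + r\<^sup>2 * (x \<bullet> v)))
      = (a - r * (x \<bullet> u)) * (b - r * (x \<bullet> v)) * (r * r * (x \<bullet> x))
        + r * r * ((a - r * (x \<bullet> u)) * (x \<bullet> v) + (b - r * (x \<bullet> v)) * (x \<bullet> u)) + r * r * (u \<bullet> v)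
      + (\<epsilon> * \<epsilon>) * ((a * (1 - r) + r\<^sup>2 * (x \<bullet> u)) * (b * (1 - r) + r\<^sup>2 * (x \<bullet> v)))"
    by (simp only: inner_add_left inner_add_right inner_diff_left inner_diff_right
        inner_scaleR_left inner_scaleR_right inner_commute[of u x]) algebra
  also have "\<dots> = r\<^sup>2 * (u \<bullet> v) + a * b"
    unfolding r ee by (simp add: algebra_simps power2_eq_square)
  finally have core: "((a * r) *\<^sub>R x + r *\<^sub>R u - (r\<^sup>2 * (x \<bullet> u)) *\<^sub>R x,
        \<epsilon> * (a * (1 - r) + r\<^sup>2 * (x \<bullet> u))) \<bullet>
      ((b * r) *\<^sub>R x + r *\<^sub>R v - (r\<^sup>2 * (x \<bullet> v)) *\<^sub>R x,
        \<epsilon> * (b * (1 - r) + r\<^sup>2 * (x \<bullet> v))) = hopf_h y U V"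
    by (simp only: inner_Pair inner_real_def hopf_h_def r_def fst_conv snd_conv
        \<open>y = (x, t)\<close> \<open>U = (u, a)\<close> \<open>V = (v, b)\<close>)
  have "hopf_embed_deriv \<epsilon> y U \<bullet> hopf_embed_deriv \<epsilon> y V = exp t * (exp t * hopf_h y U V)"
    unfolding core[symmetric] hopf_embed_deriv_def inner_scaleR_left inner_scaleR_right
    by (simp only: r_def fst_conv snd_conv \<open>y = (x, t)\<close> \<open>U = (u, a)\<close> \<open>V = (v, b)\<close>)
  then show ?thesis by (simp add: power2_eq_square)
qed

lemma hopf_embed_deriv_inj:
  assumes "hopf_embed_deriv \<epsilon> y U = hopf_embed_deriv \<epsilon> y V" shows "U = V"
proof (rule ccontr)
  assume "U \<noteq> V"
  then have "hopf_h y (U - V) (U - V) > 0" by (intro hopf_h_pos) simp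
  moreover have "hopf_embed_deriv \<epsilon> y (U - V) = 0"
    using assms by (simp add: linear_diff[OF linear_hopf_embed_deriv])
  then have "(exp (snd y))\<^sup>2 * hopf_h y (U - V) (U - V) = 0"
    using hopf_embed_conformal[of y "U - V" "U - V"] by simp
  ultimately show False by simp
qed

text \<open>The numerators of \<open>hopf_embed_holomorphic\<close> on vectors tangent to the sphere: polynomial
  identities modulo the relations \<open>\<epsilon>\<^sup>2 = 1\<close> and \<open>2 m = 1 + x \<bullet> x\<close>.\<close>

lemma hopf_field_rotation:
  fixes x u :: "real^3" defines "m \<equiv> (1 + x \<bullet> x) / 2"
  shows "- (hopf_field \<epsilon> x \<bullet> u) * x $ i + \<epsilon> * m * cross3 (hopf_field \<epsilon> x) u $ i
      - \<epsilon> * (x \<bullet> cross3 (hopf_field \<epsilon> x) u) * x $ i - m\<^sup>2 * cross3 e3 u $ i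
      + m * (x \<bullet> u) * cross3 e3 x $ i + \<epsilon> * m * (x \<bullet> u) * e3 $ i = 0" (is "?P i")
    and "- \<epsilon> * (m - 1) * (hopf_field \<epsilon> x \<bullet> u) + x \<bullet> cross3 (hopf_field \<epsilon> x) u
      - m\<^sup>2 * (e3 \<bullet> u) + m * (x \<bullet> u) * (e3 \<bullet> x) = 0" (is ?Q)
proof -
  have ee: "\<epsilon> * \<epsilon> = 1" using eps by auto
  note vec = inner_vec_def sum_3 cross_components inner_real_def e3_nth hopf_field_nth
  have m2: "2 * m = 1 + (x $ 1 * x $ 1 + x $ 2 * x $ 2 + x $ 3 * x $ 3)"
    by (simp add: m_def inner_vec_def sum_3)
  have "\<forall>i. ?P i"
    unfolding forall_3
    by (intro conjI; simp only: vec m_def[symmetric]; use m2 ee in algebra)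
  then show "?P i" ..
  show ?Q
    by (simp only: vec m_def[symmetric]; use m2 ee in algebra)
qed

text \<open>The differential being injective, this equation determines \<open>hopf_I\<close>.  Its part along the line
  says that the Hopf field is \<open>hopf_j\<close> of the position vector; its part along the sphere reduces to
  the preceding lemma through \<open>conf x * m = 1\<close>.\<close>

lemma hopf_embed_holomorphic:
  "hopf_embed_deriv \<epsilon> y (hopf_I \<epsilon> y U) = hopf_j (hopf_embed_deriv \<epsilon> y U)"
proof -
  obtain x t u a where yU: "y = (x, t)" "U = (u, a)" by (cases y, cases U)
  define r where "r = conf x"
  define m where "m = (1 + x \<bullet> x) / 2"
  define \<xi> where "\<xi> = hopf_field \<epsilon> x"
  have rm: "r * m = 1" unfolding r_def m_def by (rule conf_mult)
  have ee: "\<epsilon> * \<epsilon> = 1" using eps by auto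
  have x\<xi>: "x \<bullet> \<xi> = \<epsilon> * (e3 \<bullet> x) * m" unfolding \<xi>_def m_def by (rule hopf_field_inner)
  have \<xi>i: "\<xi> $ i = cross3 e3 x $ i + \<epsilon> * ((e3 \<bullet> x) * x $ i - (m - 1) * e3 $ i)" for i
    by (simp add: \<xi>_def hopf_field_def m_def field_simps)
  have v: "(- (r\<^sup>2 * (\<xi> \<bullet> u)) * r) * x $ i + r * (a * \<xi> $ i + \<epsilon> * r * cross3 \<xi> u $ i)
        - (r\<^sup>2 * (a * (x \<bullet> \<xi>) + \<epsilon> * r * (x \<bullet> cross3 \<xi> u))) * x $ i =
      a * r * cross3 e3 x $ i + r * cross3 e3 u $ i - r\<^sup>2 * (x \<bullet> u) * cross3 e3 x $ i
        - \<epsilon> * (a * (1 - r) + r\<^sup>2 * (x \<bullet> u)) * e3 $ i" for i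
  proof -
    note P = hopf_field_rotation(1)[of x u i, folded m_def \<xi>_def]
    have "r ^ 3 * (- (\<xi> \<bullet> u) * x $ i + \<epsilon> * m * cross3 \<xi> u $ i
        - \<epsilon> * (x \<bullet> cross3 \<xi> u) * x $ i - m\<^sup>2 * cross3 e3 u $ i
        + m * (x \<bullet> u) * cross3 e3 x $ i + \<epsilon> * m * (x \<bullet> u) * e3 $ i) = 0"
      unfolding P by simp
    then show ?thesis using rm x\<xi> \<xi>i[of i] by algebra
  qed
  have w: "\<epsilon> * (- (r\<^sup>2 * (\<xi> \<bullet> u)) * (1 - r) + r\<^sup>2 * (a * (x \<bullet> \<xi>) + \<epsilon> * r * (x \<bullet> cross3 \<xi> u))) =
      a * r * (e3 \<bullet> x) + r * (e3 \<bullet> u) - r\<^sup>2 * (x \<bullet> u) * (e3 \<bullet> x)"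
    using hopf_field_rotation(2)[of x u, folded m_def \<xi>_def] rm x\<xi> ee by algebra
  have "hopf_embed_deriv \<epsilon> (x, t) (hopf_I \<epsilon> (x, t) (u, a)) = exp t *\<^sub>R
      ((- (r\<^sup>2 * (\<xi> \<bullet> u)) * r) *\<^sub>R x + r *\<^sub>R (a *\<^sub>R \<xi> + (\<epsilon> * r) *\<^sub>R cross3 \<xi> u)
        - (r\<^sup>2 * (a * (x \<bullet> \<xi>) + \<epsilon> * r * (x \<bullet> cross3 \<xi> u))) *\<^sub>R x,
       \<epsilon> * (- (r\<^sup>2 * (\<xi> \<bullet> u)) * (1 - r) + r\<^sup>2 * (a * (x \<bullet> \<xi>) + \<epsilon> * r * (x \<bullet> cross3 \<xi> u))))"
    unfolding hopf_embed_deriv_def hopf_I_def fst_conv snd_conv r_def \<xi>_def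
    by (simp only: inner_add_right inner_scaleR_right)
  also have "\<dots> = exp t *\<^sub>R
      (cross3 e3 ((a * r) *\<^sub>R x + r *\<^sub>R u - (r\<^sup>2 * (x \<bullet> u)) *\<^sub>R x)
        - (\<epsilon> * (a * (1 - r) + r\<^sup>2 * (x \<bullet> u))) *\<^sub>R e3,
       e3 \<bullet> ((a * r) *\<^sub>R x + r *\<^sub>R u - (r\<^sup>2 * (x \<bullet> u)) *\<^sub>R x))"
    unfolding w
    by (intro arg_cong[where f = "\<lambda>z. exp t *\<^sub>R z"] prod_eqI)
      (simp_all only: fst_conv snd_conv inner_add_right inner_diff_right inner_scaleR_right
        cross_add_right cross_mult_right Cross3.right_diff_distrib vec_eq_iff
        vector_add_component vector_minus_component vector_scaleR_component v real_scaleR_def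
        simp_thms)
  also have "\<dots> = hopf_j (hopf_embed_deriv \<epsilon> (x, t) (u, a))"
    unfolding linear_scale[OF linear_hopf_j] hopf_embed_deriv_def fst_conv snd_conv r_def
    by (simp only: hopf_j_def fst_conv snd_conv)
  finally show ?thesis unfolding yU .
qed

lemma hopf_I_squared: "hopf_I \<epsilon> y (hopf_I \<epsilon> y U) = - U"
  by (rule hopf_embed_deriv_inj[of y])
    (simp add: hopf_embed_holomorphic hopf_j_squared linear_neg[OF linear_hopf_embed_deriv])

lemma hopf_I_isometry: "hopf_h y (hopf_I \<epsilon> y U) (hopf_I \<epsilon> y V) = hopf_h y U V"
  using hopf_embed_conformal[of y "hopf_I \<epsilon> y U" "hopf_I \<epsilon> y V"] hopf_embed_conformal[of y U V]
  by (simp add: hopf_embed_holomorphic hopf_j_isometry)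

end

subsection \<open>The torsion form\<close>

lemma hopf_field_has_derivative:
  "(hopf_field \<epsilon> has_derivative hopf_field_deriv \<epsilon> x) (at x)"
proof -
  note L = bounded_linear_imp_has_derivative[OF bounded_bilinear.bounded_linear_right]
  have "((\<lambda>x. cross3 e3 x + \<epsilon> *\<^sub>R ((e3 \<bullet> x) *\<^sub>R x - ((x \<bullet> x - 1) / 2) *\<^sub>R e3))
      has_derivative hopf_field_deriv \<epsilon> x) (at x)"
    by (rule has_derivative_eq_rhs, rule derivative_intros L[OF bounded_bilinear_cross3] | simp)+
      (auto simp: hopf_field_deriv_def fun_eq_iff algebra_simps inner_commute)
  then show ?thesis by (simp add: hopf_field_def[abs_def])
qed

lemma conf_power_field_has_derivative:
  "((\<lambda>x. conf x ^ k * (hopf_field \<epsilon> x \<bullet> w)) has_derivative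
    (\<lambda>u. conf x ^ k * (hopf_field_deriv \<epsilon> x u \<bullet> w)
      - of_nat k * conf x ^ (k + 1) * (x \<bullet> u) * (hopf_field \<epsilon> x \<bullet> w))) (at x)"
proof (rule has_derivative_eq_rhs)
  show "((\<lambda>x. conf x ^ k * (hopf_field \<epsilon> x \<bullet> w)) has_derivative
    (\<lambda>u. conf x ^ k * (hopf_field_deriv \<epsilon> x u \<bullet> w) +
      (of_nat k * - ((conf x)\<^sup>2 * (x \<bullet> u)) * conf x ^ (k - 1)) * (hopf_field \<epsilon> x \<bullet> w))) (at x)"
    by (intro has_derivative_mult has_derivative_power conf_has_derivative
        has_derivative_inner_left hopf_field_has_derivative)
  show "(\<lambda>u. conf x ^ k * (hopf_field_deriv \<epsilon> x u \<bullet> w) +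
      (of_nat k * - ((conf x)\<^sup>2 * (x \<bullet> u)) * conf x ^ (k - 1)) * (hopf_field \<epsilon> x \<bullet> w)) =
    (\<lambda>u. conf x ^ k * (hopf_field_deriv \<epsilon> x u \<bullet> w)
      - of_nat k * conf x ^ (k + 1) * (x \<bullet> u) * (hopf_field \<epsilon> x \<bullet> w))"
    by (cases k) (auto simp: fun_eq_iff power2_eq_square)
qed

text \<open>The form is \<open>dt \<and> \<eta> + \<epsilon> \<iota>\<^sub>\<xi> vol\<close>, with \<open>vol\<close> the round volume form.\<close>

lemma hopf_omega_eq: "hopf_omega \<epsilon> y U V =
  conf (fst y) ^ 2 * (hopf_field \<epsilon> (fst y) \<bullet> (snd U *\<^sub>R fst V - snd V *\<^sub>R fst U)) +
  \<epsilon> * (conf (fst y) ^ 3 * (hopf_field \<epsilon> (fst y) \<bullet> cross3 (fst U) (fst V)))"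
proof -
  have "cross3 \<xi> u \<bullet> v = \<xi> \<bullet> cross3 u v" for \<xi> u v :: "real^3"
    by (simp add: vec3_simps algebra_simps)
  then show ?thesis
    by (simp add: hopf_omega_def hopf_h_def hopf_I_def inner_add_left inner_diff_right
        power3_eq_cube power2_eq_square algebra_simps)
qed

lemma hopf_omega_has_derivative:
  "((\<lambda>y. hopf_omega \<epsilon> y V W) has_derivative
    (\<lambda>U. eta_deriv \<epsilon> (fst y) (fst U) (snd V *\<^sub>R fst W - snd W *\<^sub>R fst V) +
      \<epsilon> * flux_deriv \<epsilon> (fst y) (fst U) (cross3 (fst V) (fst W)))) (at y)"
proof -
  note f = bounded_linear_imp_has_derivative[OF bounded_linear_fst]
  have "((\<lambda>x. conf x ^ 2 * (hopf_field \<epsilon> x \<bullet> w)) has_derivative (\<lambda>u. eta_deriv \<epsilon> x u w)) (at x)"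
    and "((\<lambda>x. conf x ^ 3 * (hopf_field \<epsilon> x \<bullet> w)) has_derivative (\<lambda>u. flux_deriv \<epsilon> x u w)) (at x)"
    for x w
    using conf_power_field_has_derivative[of 2 \<epsilon> w x] conf_power_field_has_derivative[of 3 \<epsilon> w x]
    by (simp_all add: eta_deriv_def flux_deriv_def)
  then show ?thesis
    unfolding hopf_omega_eq
    by (intro has_derivative_add has_derivative_mult_right
        diff_chain_at[OF f, unfolded o_def])
qed

text \<open>The Hopf field is a Killing field of the sphere, hence free of divergence.\<close>

lemma flux_divergence_free:
  "flux_deriv \<epsilon> x u (cross3 v w) - flux_deriv \<epsilon> x v (cross3 u w) + flux_deriv \<epsilon> x w (cross3 u v) = 0"
proof -
  have tr: "hopf_field_deriv \<epsilon> x u \<bullet> cross3 v w - hopf_field_deriv \<epsilon> x v \<bullet> cross3 u w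
      + hopf_field_deriv \<epsilon> x w \<bullet> cross3 u v = 3 * \<epsilon> * (e3 \<bullet> x) * (u \<bullet> cross3 v w)"
    unfolding hopf_field_deriv_def by (simp add: vec3_simps) (simp add: algebra_simps)
  have "(x \<bullet> u) * (\<xi> \<bullet> cross3 v w) - (x \<bullet> v) * (\<xi> \<bullet> cross3 u w) + (x \<bullet> w) * (\<xi> \<bullet> cross3 u v) =
      (x \<bullet> \<xi>) * (u \<bullet> cross3 v w)" for \<xi>
    by (simp add: vec3_simps) (simp add: algebra_simps)
  from this[of "hopf_field \<epsilon> x", unfolded hopf_field_inner] tr conf_mult[of x]
  show ?thesis unfolding flux_deriv_def by algebra
qed

context
  fixes \<epsilon> :: real assumes eps: "\<epsilon> = 1 \<or> \<epsilon> = - 1"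
begin

text \<open>This is \<open>d\<eta> = 2 \<epsilon> \<iota>\<^sub>\<xi> vol\<close>, an identity of polynomials once
  \<open>conf\<^sup>2\<close> is written as \<open>conf\<^sup>3 m\<close> with \<open>m = 1 / conf x\<close>, and \<open>conf\<^sup>3\<close> is cancelled.\<close>

lemma eta_curl:
  "eta_deriv \<epsilon> x u v - eta_deriv \<epsilon> x v u = 2 * \<epsilon> * conf x ^ 3 * (hopf_field \<epsilon> x \<bullet> cross3 u v)"
proof -
  define m where "m = (1 + x \<bullet> x) / 2"
  have ee: "\<epsilon> * \<epsilon> = 1" using eps by auto
  note vec = inner_vec_def sum_3 cross_components inner_real_def e3_nth
  have m2: "2 * m = 1 + (x $ 1 * x $ 1 + x $ 2 * x $ 2 + x $ 3 * x $ 3)"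
    by (simp add: m_def inner_vec_def sum_3)
  have curl: "hopf_field_deriv \<epsilon> x u \<bullet> v - hopf_field_deriv \<epsilon> x v \<bullet> u =
      2 * (e3 \<bullet> cross3 u v) + 2 * \<epsilon> * ((e3 \<bullet> u) * (x \<bullet> v) - (x \<bullet> u) * (e3 \<bullet> v))"
    unfolding hopf_field_deriv_def by (simp add: vec3_simps) (simp add: algebra_simps)
  have "m * (hopf_field_deriv \<epsilon> x u \<bullet> v - hopf_field_deriv \<epsilon> x v \<bullet> u)
      - 2 * ((x \<bullet> u) * (hopf_field \<epsilon> x \<bullet> v) - (x \<bullet> v) * (hopf_field \<epsilon> x \<bullet> u)) =
      2 * \<epsilon> * (hopf_field \<epsilon> x \<bullet> cross3 u v)"
    unfolding curl by (simp only: vec hopf_field_nth m_def[symmetric]; use m2 ee in algebra)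
  with conf_mult[of x, folded m_def] show ?thesis unfolding eta_deriv_def by algebra
qed

text \<open>The divergence-free summand is closed, and \<open>d(dt \<and> \<eta>) = - dt \<and> d\<eta>\<close>.\<close>

lemma ext_deriv2_hopf_omega:
  "ext_deriv2 (hopf_omega \<epsilon>) y U V W = - 2 * \<epsilon> * conf (fst y) ^ 3 *
    (snd U * (hopf_field \<epsilon> (fst y) \<bullet> cross3 (fst V) (fst W))
     - snd V * (hopf_field \<epsilon> (fst y) \<bullet> cross3 (fst U) (fst W))
     + snd W * (hopf_field \<epsilon> (fst y) \<bullet> cross3 (fst U) (fst V)))"
proof -
  let ?x = "fst y" and ?u = "fst U" and ?v = "fst V" and ?w = "fst W"
  have lin: "eta_deriv \<epsilon> ?x p (a *\<^sub>R q - b *\<^sub>R s) = a * eta_deriv \<epsilon> ?x p q - b * eta_deriv \<epsilon> ?x p s" for p a q b s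
    by (simp add: eta_deriv_def inner_diff_right algebra_simps)
  have "ext_deriv2 (hopf_omega \<epsilon>) y U V W =
    - (snd U * (eta_deriv \<epsilon> ?x ?v ?w - eta_deriv \<epsilon> ?x ?w ?v)
       - snd V * (eta_deriv \<epsilon> ?x ?u ?w - eta_deriv \<epsilon> ?x ?w ?u)
       + snd W * (eta_deriv \<epsilon> ?x ?u ?v - eta_deriv \<epsilon> ?x ?v ?u))
    + \<epsilon> * (flux_deriv \<epsilon> ?x ?u (cross3 ?v ?w) - flux_deriv \<epsilon> ?x ?v (cross3 ?u ?w)
         + flux_deriv \<epsilon> ?x ?w (cross3 ?u ?v))"
    unfolding ext_deriv2_def frechet_derivative_at[OF hopf_omega_has_derivative, symmetric] lin
    by (simp add: algebra_simps)
  then show ?thesis unfolding eta_curl flux_divergence_free by (simp add: algebra_simps)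
qed

text \<open>Composition with \<open>I\<close> turns \<open>dt\<close> into \<open>- \<eta>\<close> and leaves \<open>d\<eta>\<close> unchanged, because \<open>I\<close> is a
  rotation of the planes orthogonal to the Hopf field; what results is
  \<open>\<eta> \<and> d\<eta> = 2 \<epsilon> vol\<close>.\<close>

lemma ext_deriv2_hopf_omega_I:
  "ext_deriv2 (hopf_omega \<epsilon>) y (hopf_I \<epsilon> y U) (hopf_I \<epsilon> y V) (hopf_I \<epsilon> y W) =
    2 * \<epsilon> * (conf (fst y) ^ 3 * (fst U \<bullet> cross3 (fst V) (fst W)))"
proof -
  let ?u = "fst U" and ?v = "fst V" and ?w = "fst W"
  define r where "r = conf (fst y)"
  define \<xi> where "\<xi> = hopf_field \<epsilon> (fst y)"
  have n: "r\<^sup>2 * (\<xi> \<bullet> \<xi>) = 1" unfolding r_def \<xi>_def by (rule hopf_field_unit[OF eps])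
  have ee: "\<epsilon> * \<epsilon> = 1" using eps by auto
  have C: "\<xi> \<bullet> cross3 (b *\<^sub>R \<xi> + s *\<^sub>R cross3 \<xi> v) (c *\<^sub>R \<xi> + s *\<^sub>R cross3 \<xi> w) =
      s * s * ((\<xi> \<bullet> \<xi>) * (\<xi> \<bullet> cross3 v w))" for b s v c w
    by (simp add: vec3_simps) (simp add: algebra_simps)
  have s: "(\<epsilon> * r) * (\<epsilon> * r) * ((\<xi> \<bullet> \<xi>) * z) = z" for z using n ee by algebra
  have G: "(\<xi> \<bullet> ?u) * (\<xi> \<bullet> cross3 ?v ?w) - (\<xi> \<bullet> ?v) * (\<xi> \<bullet> cross3 ?u ?w)
      + (\<xi> \<bullet> ?w) * (\<xi> \<bullet> cross3 ?u ?v) = (\<xi> \<bullet> \<xi>) * (?u \<bullet> cross3 ?v ?w)"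
    by (simp add: vec3_simps) (simp add: algebra_simps)
  show ?thesis
    unfolding ext_deriv2_hopf_omega hopf_I_def fst_conv snd_conv r_def[symmetric] \<xi>_def[symmetric] C s
    using G n by algebra
qed

end

text \<open>A three-form pulled back from a space of dimension three is closed: the alternating sum is the
  linear relation between four vectors of \<open>\<real>\<^sup>3\<close>, paired with \<open>x\<close>.\<close>

lemma conf_volume_closed:
  fixes y U V W Z :: "(real^3) \<times> real"
  shows "ext_deriv3 (\<lambda>y U V W. k * (conf (fst y) ^ 3 * (fst U \<bullet> cross3 (fst V) (fst W)))) y U V W Z = 0"
proof -
  note f = bounded_linear_imp_has_derivative[OF bounded_linear_fst[where 'a = "real^3" and 'b = real]]
  have "((\<lambda>x. conf x ^ 3) has_derivative (\<lambda>u. of_nat 3 * - ((conf x)\<^sup>2 * (x \<bullet> u)) * conf x ^ (3 - 1))) (at x)" for x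
    by (rule has_derivative_power[OF conf_has_derivative])
  from diff_chain_at[OF f this] have
    "((\<lambda>y::(real^3) \<times> real. conf (fst y) ^ 3) has_derivative
      (\<lambda>U. - 3 * conf (fst y) ^ 4 * (fst y \<bullet> fst U))) (at y)" for y
    by (simp add: o_def power_numeral_reduce algebra_simps)
  from has_derivative_mult_right[OF has_derivative_mult_left[OF this]]
  have D: "frechet_derivative (\<lambda>y::(real^3) \<times> real. k * (conf (fst y) ^ 3 * c)) (at y) =
      (\<lambda>U. k * (- 3 * conf (fst y) ^ 4 * (fst y \<bullet> fst U) * c))" for c
    by (intro frechet_derivative_at[symmetric])
  have H: "(x \<bullet> u) * (v \<bullet> cross3 w z) - (x \<bullet> v) * (u \<bullet> cross3 w z) + (x \<bullet> w) * (u \<bullet> cross3 v z)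
      - (x \<bullet> z) * (u \<bullet> cross3 v w) = 0" for x u v w z :: "real^3"
    by (simp add: vec3_simps) (simp add: algebra_simps)
  show ?thesis
    unfolding ext_deriv3_def D using H[of "fst y" "fst U" "fst V" "fst W" "fst Z"] by algebra
qed

subsection \<open>Smoothness of the Hopf tensors\<close>

lemmas smooth_on_cross3 [smooth_intros] = smooth_on_bounded_bilinear[OF bounded_bilinear_cross3]

lemma smooth_on_conf [smooth_intros]:
  assumes "open S" "smooth_on S f" shows "smooth_on S (\<lambda>y. conf (f y))"
  unfolding conf_def
  by (intro smooth_intros assms) (use conf_denom in \<open>metis less_irrefl\<close>)

lemma smooth_on_hopf_field [smooth_intros]:
  assumes "open S" "smooth_on S f" shows "smooth_on S (\<lambda>y. hopf_field \<epsilon> (f y))"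
  unfolding hopf_field_def using assms by (intro smooth_intros) auto

lemma smooth_on_hopf_I:
  assumes "open S" "smooth_on S f" shows "smooth_on S (\<lambda>y. hopf_I \<epsilon> (f y) U)"
  unfolding hopf_I_def using assms by (intro smooth_intros)

lemma smooth_on_hopf_h:
  assumes "open S" "smooth_on S f" shows "smooth_on S (\<lambda>y. hopf_h (f y) U V)"
  unfolding hopf_h_def using assms by (intro smooth_intros)

lemma smooth_on_hopf_embed:
  assumes "open S" "smooth_on S f" shows "smooth_on S (\<lambda>y. hopf_embed \<epsilon> (f y))"
  unfolding hopf_embed_def using assms by (intro smooth_intros)

section \<open>The three-sphere and its Hopf structure\<close>

text \<open>For \<open>\<epsilon> = 1\<close> and \<open>\<epsilon> = -1\<close> these are the two charts of \<open>sphere3\<close>.\<close>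

definition stereo :: "real \<Rightarrow> ((real^3) \<times> real, real^3) chart" where
  "stereo \<epsilon> = (sphere 0 1 - {(0, \<epsilon>)}, \<lambda>(y, s). y /\<^sub>R (1 - \<epsilon> * s))"

definition stereo_inv :: "real \<Rightarrow> real^3 \<Rightarrow> (real^3) \<times> real" where
  "stereo_inv \<epsilon> x = (conf x *\<^sub>R x, \<epsilon> * (1 - conf x))"

lemma hopf_embed_stereo_inv: "hopf_embed \<epsilon> (x, t) = exp t *\<^sub>R stereo_inv \<epsilon> x"
  by (simp add: hopf_embed_def stereo_inv_def)

lemma topo_sphere3 [simp]: "topo sphere3 = top_of_set (sphere 0 1)"
  by (simp add: sphere3_def)

lemma atlas_sphere3: "atlas sphere3 = {stereo 1, stereo (- 1)}"
  by (simp add: sphere3_def stereo_def)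

lemma conf_sphere: "(conf x)\<^sup>2 * (x \<bullet> x) = 1 - (1 - conf x)\<^sup>2"
  using conf_mult[of x] by algebra

lemma smooth_on_stereo_inv:
  assumes "open S" "smooth_on S f" shows "smooth_on S (\<lambda>y. stereo_inv \<epsilon> (f y))"
  unfolding stereo_inv_def using assms by (intro smooth_intros)

context
  fixes \<epsilon> :: real assumes eps: "\<epsilon> = 1 \<or> \<epsilon> = - 1"
begin

lemma stereo_inv_sphere: "stereo_inv \<epsilon> x \<in> sphere 0 1"
proof -
  have "stereo_inv \<epsilon> x \<bullet> stereo_inv \<epsilon> x = (conf x)\<^sup>2 * (x \<bullet> x) + (\<epsilon> * \<epsilon>) * (1 - conf x)\<^sup>2"
    by (simp add: stereo_inv_def power2_eq_square)
  also have "\<dots> = 1" unfolding conf_sphere using eps by auto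
  finally show ?thesis by (simp add: norm_eq_1)
qed

lemma stereo_pole:
  fixes z :: "(real^3) \<times> real"
  assumes "z \<in> sphere 0 1" "1 - \<epsilon> * snd z = 0" shows "z = (0, \<epsilon>)"
proof -
  have s: "snd z = \<epsilon>" using assms(2) eps by auto
  have "z \<bullet> z = 1" using assms(1) by (simp add: norm_eq_1)
  then have "fst z \<bullet> fst z + \<epsilon> * \<epsilon> = 1" by (cases z) (simp add: s[symmetric])
  then have "fst z = 0" using eps by auto
  then show ?thesis using s by (simp add: prod_eq_iff)
qed

lemma stereo_inv_in: "stereo_inv \<epsilon> x \<in> fst (stereo \<epsilon>)"
  using stereo_inv_sphere[of x] conf_pos[of x] eps by (auto simp: stereo_def stereo_inv_def)

lemma stereo_right_inverse: "snd (stereo \<epsilon>) (stereo_inv \<epsilon> x) = x"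
proof -
  have "1 - \<epsilon> * (\<epsilon> * (1 - conf x)) = conf x" using eps by auto
  then show ?thesis using conf_pos[of x] by (simp add: stereo_def stereo_inv_def)
qed

lemma stereo_left_inverse:
  assumes "z \<in> fst (stereo \<epsilon>)" shows "stereo_inv \<epsilon> (snd (stereo \<epsilon>) z) = z"
proof -
  obtain y s where z: "z = (y, s)" by (cases z)
  have ne: "1 - \<epsilon> * s \<noteq> 0" using assms stereo_pole[of z] by (auto simp: stereo_def z)
  have ee: "\<epsilon> * \<epsilon> = 1" using eps by auto
  have "z \<bullet> z = 1" using assms by (simp add: stereo_def norm_eq_1)
  then have yy: "y \<bullet> y = 1 - s * s" by (simp add: z)
  let ?x = "y /\<^sub>R (1 - \<epsilon> * s)"
  have "?x \<bullet> ?x = (1 - s * s) / ((1 - \<epsilon> * s) * (1 - \<epsilon> * s))"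
    by (simp add: yy inverse_eq_divide)
  then have "?x \<bullet> ?x * ((1 - \<epsilon> * s) * (1 - \<epsilon> * s)) = 1 - s * s" using ne by (simp only: times_divide_eq_left) simp
  then have "(1 + ?x \<bullet> ?x) * (1 - \<epsilon> * s) = 2" using ne ee by algebra
  then have c: "conf ?x = 1 - \<epsilon> * s"
    unfolding conf_def using ne by (metis eq_divide_imp mult_zero_left nonzero_mult_div_cancel_left zero_neq_numeral)
  have "conf ?x *\<^sub>R ?x = y" unfolding c using ne by simp
  moreover have "\<epsilon> * (1 - conf ?x) = s" unfolding c using ee by algebra
  moreover have "stereo_inv \<epsilon> (snd (stereo \<epsilon>) z) = (conf ?x *\<^sub>R ?x, \<epsilon> * (1 - conf ?x))"
    unfolding stereo_def stereo_inv_def z snd_conv prod.case ..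
  ultimately show ?thesis unfolding z by simp
qed

lemma stereo_image: "snd (stereo \<epsilon>) ` fst (stereo \<epsilon>) = UNIV"
  using stereo_inv_in stereo_right_inverse by (metis UNIV_eq_I image_eqI)

lemma stereo_inj: "inj_on (snd (stereo \<epsilon>)) (fst (stereo \<epsilon>))"
  by (rule inj_on_inverseI[where g = "stereo_inv \<epsilon>"]) (rule stereo_left_inverse)

lemma stereo_chart_inv: "chart_inv (stereo \<epsilon>) x = stereo_inv \<epsilon> x"
  using inv_into_f_f[OF stereo_inj stereo_inv_in] by (simp add: stereo_right_inverse)

lemma stereo_is_chart: "is_chart (top_of_set (sphere 0 1)) (stereo \<epsilon>)"
proof -
  have "is_chart (top_of_set (sphere 0 1)) (fst (stereo \<epsilon>), snd (stereo \<epsilon>))"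
  proof (rule is_chartI[OF _ stereo_inj])
    have "openin (top_of_set (sphere 0 1)) (sphere 0 1 \<inter> (- {(0, \<epsilon>)}))"
      by (rule openin_open_Int) (rule open_Compl[OF closed_singleton])
    then show o: "openin (top_of_set (sphere 0 1)) (fst (stereo \<epsilon>))"
      by (simp add: stereo_def Diff_eq)
    fix T :: "(real^3) set" assume T: "open T"
    have "continuous_on (fst (stereo \<epsilon>)) (\<lambda>z. fst z /\<^sub>R (1 - \<epsilon> * snd z))"
    proof (intro continuous_intros ballI)
      show "1 - \<epsilon> * snd z \<noteq> 0" if "z \<in> fst (stereo \<epsilon>)" for z
        using that stereo_pole[of z] by (auto simp: stereo_def)
    qed
    moreover have "snd (stereo \<epsilon>) = (\<lambda>z. fst z /\<^sub>R (1 - \<epsilon> * snd z))"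
      by (auto simp: stereo_def)
    ultimately have "openin (top_of_set (fst (stereo \<epsilon>))) (fst (stereo \<epsilon>) \<inter> snd (stereo \<epsilon>) -` T)"
      using continuous_openin_preimage_gen[OF _ T] by simp
    then have "openin (top_of_set (sphere 0 1)) (fst (stereo \<epsilon>) \<inter> snd (stereo \<epsilon>) -` T)"
      by (rule openin_trans[OF _ o])
    moreover have "{p \<in> fst (stereo \<epsilon>). snd (stereo \<epsilon>) p \<in> T} =
        fst (stereo \<epsilon>) \<inter> snd (stereo \<epsilon>) -` T" by blast
    ultimately show "openin (top_of_set (sphere 0 1)) {p \<in> fst (stereo \<epsilon>). snd (stereo \<epsilon>) p \<in> T}"
      by simp
  next
    fix V assume V: "openin (top_of_set (sphere 0 1)) V" "V \<subseteq> fst (stereo \<epsilon>)"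
    then obtain O' where O': "open O'" "V = sphere 0 1 \<inter> O'" by (meson openin_open)
    have "snd (stereo \<epsilon>) ` V = stereo_inv \<epsilon> -` O'"
    proof (intro set_eqI iffI)
      fix x assume "x \<in> snd (stereo \<epsilon>) ` V"
      then obtain p where p: "p \<in> V" "x = snd (stereo \<epsilon>) p" by blast
      then have "stereo_inv \<epsilon> x = p" using V(2) stereo_left_inverse by blast
      then show "x \<in> stereo_inv \<epsilon> -` O'" using p(1) O'(2) by simp
    next
      fix x assume "x \<in> stereo_inv \<epsilon> -` O'"
      then have "stereo_inv \<epsilon> x \<in> V" using O'(2) stereo_inv_sphere by simp
      then show "x \<in> snd (stereo \<epsilon>) ` V"
        by (intro image_eqI[of _ _ "stereo_inv \<epsilon> x"]) (simp_all add: stereo_right_inverse)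
    qed
    moreover have "continuous_on UNIV (stereo_inv \<epsilon>)"
      by (rule smooth_on_imp_continuous_on) (rule smooth_on_stereo_inv[OF open_UNIV smooth_on_id])
    ultimately show "open (snd (stereo \<epsilon>) ` V)"
      using O'(1) open_vimage by fastforce
  qed
  then show ?thesis by simp
qed

end

context
  fixes \<epsilon> \<delta> :: real assumes eps: "\<epsilon> = 1 \<or> \<epsilon> = - 1" and del: "\<delta> = 1 \<or> \<delta> = - 1"
begin

lemma stereo_transition_dom: "x \<in> local_dom id (stereo \<epsilon>) (stereo \<delta>) \<longleftrightarrow> stereo_inv \<epsilon> x \<in> fst (stereo \<delta>)"
  by (simp add: mem_local_dom_iff[OF stereo_is_chart[OF eps]] stereo_image[OF eps]
      stereo_chart_inv[OF eps])

lemma stereo_transition: "local_rep id (stereo \<epsilon>) (stereo \<delta>) x = snd (stereo \<delta>) (stereo_inv \<epsilon> x)"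
  by (simp add: local_rep_apply stereo_chart_inv[OF eps])

lemma open_stereo_transition_dom: "open (local_dom id (stereo \<epsilon>) (stereo \<delta>))"
  by (rule open_local_dom[OF stereo_is_chart[OF eps] stereo_is_chart[OF del] continuous_map_id])

lemma stereo_transition_smooth:
  "smooth_rep id (stereo \<epsilon>) (stereo \<delta>)"
proof -
  let ?S = "local_dom id (stereo \<epsilon>) (stereo \<delta>)"
  have ne: "1 - \<delta> * (\<epsilon> * (1 - conf x)) \<noteq> 0" if "x \<in> ?S" for x
  proof
    assume "1 - \<delta> * (\<epsilon> * (1 - conf x)) = 0"
    then have "stereo_inv \<epsilon> x = (0, \<delta>)"
      by (intro stereo_pole[OF del stereo_inv_sphere[OF eps]]) (simp add: stereo_inv_def)
    then show False using that stereo_transition_dom by (simp add: stereo_def)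
  qed
  have "smooth_on ?S (\<lambda>x. inverse (1 - \<delta> * (\<epsilon> * (1 - conf x))) *\<^sub>R (conf x *\<^sub>R x))"
    by (intro smooth_intros open_stereo_transition_dom ne)
  moreover have "local_rep id (stereo \<epsilon>) (stereo \<delta>) =
      (\<lambda>x. inverse (1 - \<delta> * (\<epsilon> * (1 - conf x))) *\<^sub>R (conf x *\<^sub>R x))"
    by (rule ext, unfold stereo_transition) (simp add: stereo_def stereo_inv_def)
  ultimately show ?thesis by simp
qed

text \<open>Both stereographic charts, extended by the radial coordinate, are inverse to embeddings onto
  subsets of the same punctured \<open>\<real>\<^sup>4\<close>, so the transition map intertwines the
  differentials of these embeddings and with them everything pulled back along them.\<close>

lemma hopf_embed_transition:
  assumes x: "x \<in> local_dom id (stereo \<epsilon>) (stereo \<delta>)"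
  shows "hopf_embed_deriv \<delta> (local_rep id (stereo \<epsilon>) (stereo \<delta>) x, t)
      (local_deriv id (stereo \<epsilon>) (stereo \<delta>) x u, a) =
    hopf_embed_deriv \<epsilon> (x, t) (u, a)"
proof -
  let ?\<beta> = "local_rep id (stereo \<epsilon>) (stereo \<delta>)"
  let ?S = "local_dom id (stereo \<epsilon>) (stereo \<delta>) \<times> (UNIV :: real set)"
  have f: "(fst has_derivative fst) (at (x, t))" and s: "(snd has_derivative snd) (at (x, t))"
    by (auto intro: bounded_linear_imp_has_derivative bounded_linear_fst bounded_linear_snd)
  have "(?\<beta> has_derivative frechet_derivative ?\<beta> (at x)) (at (fst (x, t)))"
    using smooth_on_has_derivative[OF stereo_transition_smooth x] by simp
  from has_derivative_Pair[OF diff_chain_at[OF f this] s]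
  have "((\<lambda>y. (?\<beta> (fst y), snd y)) has_derivative
      (\<lambda>U. (frechet_derivative ?\<beta> (at x) (fst U), snd U))) (at (x, t))" by (simp add: o_def)
  from diff_chain_at[OF this hopf_embed_has_derivative]
  have 1: "((\<lambda>y. hopf_embed \<delta> (?\<beta> (fst y), snd y)) has_derivative
      (\<lambda>U. hopf_embed_deriv \<delta> (?\<beta> x, t) (frechet_derivative ?\<beta> (at x) (fst U), snd U))) (at (x, t))"
    by (simp add: o_def)
  have eq: "hopf_embed \<epsilon> y = hopf_embed \<delta> (?\<beta> (fst y), snd y)" if "y \<in> ?S" for y
  proof -
    have "stereo_inv \<delta> (?\<beta> (fst y)) = stereo_inv \<epsilon> (fst y)"
      unfolding stereo_transition by (rule stereo_left_inverse[OF del])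
        (use that in \<open>auto simp: stereo_transition_dom\<close>)
    then show ?thesis using hopf_embed_stereo_inv by (metis prod.collapse)
  qed
  have "(hopf_embed \<epsilon> has_derivative
      (\<lambda>U. hopf_embed_deriv \<delta> (?\<beta> x, t) (frechet_derivative ?\<beta> (at x) (fst U), snd U))) (at (x, t))"
    by (rule has_derivative_transform_within_open[OF 1, of ?S])
      (use x eq open_stereo_transition_dom in \<open>auto intro: open_Times\<close>)
  from fun_cong[OF has_derivative_unique[OF this hopf_embed_has_derivative], of "(u, a)"]
  show ?thesis by simp
qed

lemma hopf_transition:
  assumes x: "x \<in> local_dom id (stereo \<epsilon>) (stereo \<delta>)"
  defines "D \<equiv> local_deriv id (stereo \<epsilon>) (stereo \<delta>) x"
  shows "hopf_I \<delta> (local_rep id (stereo \<epsilon>) (stereo \<delta>) x, t') (D (fst U), snd U) =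
      (D (fst (hopf_I \<epsilon> (x, t) U)), snd (hopf_I \<epsilon> (x, t) U))"
    and "hopf_h (local_rep id (stereo \<epsilon>) (stereo \<delta>) x, t') (D (fst U), snd U) (D (fst V), snd V) =
      hopf_h (x, t) U V"
proof -
  let ?b = "local_rep id (stereo \<epsilon>) (stereo \<delta>) x"
  have tr: "hopf_embed_deriv \<delta> (?b, t) (D (fst W), snd W) = hopf_embed_deriv \<epsilon> (x, t) W" for W
    unfolding D_def using hopf_embed_transition[OF x, of t "fst W" "snd W"] by simp
  have "hopf_I \<delta> (?b, t) (D (fst U), snd U) =
      (D (fst (hopf_I \<epsilon> (x, t) U)), snd (hopf_I \<epsilon> (x, t) U))"
    by (rule hopf_embed_deriv_inj[OF del, of "(?b, t)"])
      (simp only: hopf_embed_holomorphic[OF eps] hopf_embed_holomorphic[OF del] tr)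
  then show "hopf_I \<delta> (?b, t') (D (fst U), snd U) =
      (D (fst (hopf_I \<epsilon> (x, t) U)), snd (hopf_I \<epsilon> (x, t) U))" by (simp add: hopf_I_def)
  have "(exp t)\<^sup>2 * hopf_h (?b, t) (D (fst U), snd U) (D (fst V), snd V) = (exp t)\<^sup>2 * hopf_h (x, t) U V"
    using hopf_embed_conformal[OF del, of "(?b, t)" "(D (fst U), snd U)" "(D (fst V), snd V)"]
      hopf_embed_conformal[OF eps, of "(x, t)" U V] by (simp add: tr)
  then show "hopf_h (?b, t') (D (fst U), snd U) (D (fst V), snd V) = hopf_h (x, t) U V"
    by (simp add: hopf_h_def)
qed

end

theorem smooth_manifold_sphere3: "smooth_manifold 3 sphere3"
  unfolding smooth_manifold_iff_onb
proof (intro conjI ballI)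
  show "\<exists>B :: (real^3) set. onb B \<and> card B = 3"
    by (intro exI[of _ Basis] conjI onb_Basis) simp
  show "Hausdorff_space (topo sphere3)" by (simp add: Hausdorff_space_subtopology)
  show "second_countable (topo sphere3)"
    by (simp add: second_countable_subtopology second_countable_euclidean)
  show "is_chart (topo sphere3) c" if "c \<in> atlas sphere3" for c
    using that stereo_is_chart by (auto simp: atlas_sphere3)
  show "(\<Union>c\<in>atlas sphere3. fst c) = topspace (topo sphere3)"
    by (auto simp: atlas_sphere3 stereo_def)
  show "smoothly_compatible c d" if "c \<in> atlas sphere3" "d \<in> atlas sphere3" for c d
    using that stereo_transition_smooth by (auto simp: atlas_sphere3 smoothly_compatible_def)
qed

text \<open>Polar coordinates identify \<open>S\<^sup>3 \<times> \<real>\<close> with the punctured \<open>\<real>\<^sup>4\<close>.\<close>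

definition polar :: "(((real^3) \<times> real) \<times> real, (real^3) \<times> real) chart" where
  "polar = (sphere 0 1 \<times> UNIV, \<lambda>(z, t). exp t *\<^sub>R z)"

lemma polar_is_chart: "is_chart (prod_topology (top_of_set (sphere 0 1)) euclidean) polar"
proof -
  let ?S = "sphere 0 1 \<times> UNIV :: (((real^3) \<times> real) \<times> real) set"
  let ?f = "\<lambda>(z, t). exp t *\<^sub>R z :: (real^3) \<times> real"
  let ?g = "\<lambda>w. (w /\<^sub>R norm w, ln (norm w)) :: ((real^3) \<times> real) \<times> real"
  have top: "prod_topology (top_of_set (sphere 0 1)) euclidean = top_of_set ?S"
    using prod_topology_subtopology(1)[of euclidean "sphere 0 1" euclidean]
    by (simp add: euclidean_product_topology)
  have gf: "?g (?f p) = p" if "p \<in> ?S" for p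
  proof -
    obtain z t where p: "p = (z, t)" by (cases p)
    have "norm z = 1" using that by (simp add: p)
    then have "norm (exp t *\<^sub>R z) = exp t" unfolding norm_scaleR by simp
    then show ?thesis unfolding p prod.case by simp
  qed
  have fg: "?f (?g w) = w" "?g w \<in> ?S" if "w \<noteq> 0" for w using that by auto
  show ?thesis unfolding polar_def top
  proof (rule is_chartI)
    show "openin (top_of_set ?S) ?S" by simp
    show "inj_on ?f ?S" by (rule inj_on_inverseI[where g = ?g]) (rule gf)
    fix T :: "((real^3) \<times> real) set" assume T: "open T"
    have "continuous_on ?S ?f" unfolding case_prod_unfold by (intro continuous_intros)
    from continuous_openin_preimage_gen[OF this T]
    have "openin (top_of_set ?S) (?S \<inter> ?f -` T)" .
    moreover have "{p \<in> ?S. ?f p \<in> T} = ?S \<inter> ?f -` T" by blast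
    ultimately show "openin (top_of_set ?S) {p \<in> ?S. ?f p \<in> T}" by simp
  next
    fix V assume V: "openin (top_of_set ?S) V" "V \<subseteq> ?S"
    then obtain O' where O': "open O'" "V = ?S \<inter> O'" by (meson openin_open)
    have "?f ` V = (- {0}) \<inter> ?g -` O'"
    proof (intro set_eqI iffI)
      fix w assume "w \<in> ?f ` V"
      then obtain p where p: "p \<in> V" "w = ?f p" by blast
      then have "?g w = p" "p \<in> ?S" using gf V(2) by blast+
      moreover have "w \<noteq> 0"
      proof -
        obtain z t where zt: "p = (z, t)" by (cases p)
        then have "z \<noteq> 0" using \<open>p \<in> ?S\<close> by auto
        then show ?thesis unfolding p(2) zt prod.case scaleR_eq_0_iff by simp
      qed
      ultimately show "w \<in> (- {0}) \<inter> ?g -` O'" using p(1) O'(2) by simp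
    next
      fix w assume w: "w \<in> (- {0}) \<inter> ?g -` O'"
      then have "?g w \<in> V" using fg(2) O'(2) by blast
      then show "w \<in> ?f ` V" using fg(1)[of w] w by (intro image_eqI[of _ _ "?g w"]) auto
    qed
    moreover have "open ((- {0}) \<inter> ?g -` O')"
      by (rule continuous_open_preimage) (auto intro!: continuous_intros O'(1))
    ultimately show "open (?f ` V)" by simp
  qed
qed

text \<open>Serves to rearrange the components of a product, with \<open>A\<close> on points and \<open>L\<close> on
  coordinates.\<close>

lemma is_chart_transfer:
  fixes L :: "'e::real_inner \<Rightarrow> 'f::real_inner" and M :: "'f \<Rightarrow> 'e"
  assumes c: "is_chart X c" and A: "continuous_map Y X A" and B: "continuous_map X Y B"
    and BA: "\<And>p. p \<in> topspace Y \<Longrightarrow> B (A p) = p" and AB: "\<And>p. p \<in> topspace X \<Longrightarrow> A (B p) = p"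
    and L: "continuous_on UNIV L" and M: "continuous_on UNIV M"
    and inv_right: "\<And>x. L (M x) = x" and inv_left: "\<And>x. M (L x) = x"
  shows "is_chart Y ({p \<in> topspace Y. A p \<in> fst c}, \<lambda>p. L (snd c (A p)))"
proof (rule is_chartI)
  show "openin Y {p \<in> topspace Y. A p \<in> fst c}"
    by (rule openin_continuous_map_preimage[OF A is_chart_openin[OF c]])
  show "inj_on (\<lambda>p. L (snd c (A p))) {p \<in> topspace Y. A p \<in> fst c}"
  proof (rule inj_on_inverseI)
    show "B (chart_inv c (M (L (snd c (A p))))) = p" if "p \<in> {p \<in> topspace Y. A p \<in> fst c}" for p
      using that by (simp add: inv_left chart_inv_chart[OF c] BA)
  qed
next
  fix T :: "'f set" assume "open T"
  then have "openin X {p \<in> fst c. snd c p \<in> L -` T}"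
    using open_vimage[OF _ L] is_chart_openin_preimage[OF c] by blast
  from openin_continuous_map_preimage[OF A this]
  show "openin Y {p \<in> {p \<in> topspace Y. A p \<in> fst c}. L (snd c (A p)) \<in> T}" by simp
next
  fix V assume V: "openin Y V" "V \<subseteq> {p \<in> topspace Y. A p \<in> fst c}"
  have im: "A ` V = {p \<in> topspace X. B p \<in> V}"
  proof (intro set_eqI iffI)
    fix p assume "p \<in> A ` V"
    then obtain v where v: "v \<in> V" "p = A v" by blast
    then have "v \<in> topspace Y" using V(2) by blast
    then show "p \<in> {p \<in> topspace X. B p \<in> V}"
      using v BA A by (auto simp: continuous_map_def)
  next
    fix p assume "p \<in> {p \<in> topspace X. B p \<in> V}"
    then show "p \<in> A ` V" using AB by (metis (mono_tags, lifting) image_eqI mem_Collect_eq)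
  qed
  have "openin X (A ` V)" unfolding im by (rule openin_continuous_map_preimage[OF B V(1)])
  then have "open (snd c ` A ` V)" by (rule is_chart_open_image[OF c]) (use V(2) in blast)
  then have "open (M -` (snd c ` A ` V))" by (rule open_vimage[OF _ M])
  moreover have "(\<lambda>p. L (snd c (A p))) ` V = M -` (snd c ` A ` V)"
  proof (intro set_eqI iffI)
    fix x assume "x \<in> M -` (snd c ` A ` V)"
    then obtain v where "v \<in> V" "M x = snd c (A v)" by auto
    then have "x = L (snd c (A v))" using inv_right by metis
    then show "x \<in> (\<lambda>p. L (snd c (A p))) ` V" using \<open>v \<in> V\<close> by blast
  qed (auto simp: inv_left)
  ultimately show "open ((\<lambda>p. L (snd c (A p))) ` V)" by simp
qed

section \<open>The product with \<open>S\<^sup>3 \<times> \<real>\<close>\<close>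

text \<open>The covering space is associated as \<open>(K \<times> S\<^sup>3) \<times> \<real>\<close>, whereas the complex
  structure is a product along \<open>K \<times> (S\<^sup>3 \<times> \<real>)\<close>.  The following maps pass between the
  two associations, for points as well as for coordinates and tangent vectors.\<close>

definition base_part :: "('u \<times> 'v) \<times> 'w \<Rightarrow> 'u" where "base_part z = fst (fst z)"
definition hopf_part :: "('u \<times> 'v) \<times> 'w \<Rightarrow> 'v \<times> 'w" where "hopf_part z = (snd (fst z), snd z)"
definition glue :: "'u \<Rightarrow> 'v \<times> 'w \<Rightarrow> ('u \<times> 'v) \<times> 'w" where "glue k y = ((k, fst y), snd y)"

lemma glue_simps [simp]:
  "base_part (glue k y) = k" "hopf_part (glue k y) = y" "glue (base_part z) (hopf_part z) = z"
  by (simp_all add: base_part_def hopf_part_def glue_def)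

lemma bounded_linear_base_part:
  "bounded_linear (base_part :: ('u::real_normed_vector \<times> 'v::real_normed_vector) \<times> 'w::real_normed_vector \<Rightarrow> 'u)"
  unfolding base_part_def
  by (rule bounded_linear_compose[OF bounded_linear_fst bounded_linear_fst])

lemma bounded_linear_hopf_part:
  "bounded_linear (hopf_part ::
    ('u::real_normed_vector \<times> 'v::real_normed_vector) \<times> 'w::real_normed_vector \<Rightarrow> 'v \<times> 'w)"
  unfolding hopf_part_def
  by (intro bounded_linear_Pair bounded_linear_snd bounded_linear_compose[OF bounded_linear_snd bounded_linear_fst])

lemma glue_add: "glue (k + k') (y + y') = glue k y + glue k' y'"
  and glue_scaleR: "glue (r *\<^sub>R k) (r *\<^sub>R y) = r *\<^sub>R glue k y"
  and glue_minus: "glue (- k) (- y) = - glue k y"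
  by (simp_all add: glue_def)

lemma base_part_linear: "base_part (u + v) = base_part u + base_part v" "base_part (r *\<^sub>R u) = r *\<^sub>R base_part u"
  and hopf_part_linear: "hopf_part (u + v) = hopf_part u + hopf_part v"
    "hopf_part (r *\<^sub>R u) = r *\<^sub>R hopf_part u"
  by (simp_all add: base_part_def hopf_part_def)

lemma smooth_on_glue [smooth_intros]:
  "open S \<Longrightarrow> smooth_on S f \<Longrightarrow> smooth_on S g \<Longrightarrow> smooth_on S (\<lambda>x. glue (f x) (g x))"
  unfolding glue_def by (intro smooth_intros)

lemma glue_has_derivative:
  assumes "(f has_derivative f') (at (base_part z))" "(g has_derivative g') (at (hopf_part z))"
  shows "((\<lambda>z. glue (f (base_part z)) (g (hopf_part z))) has_derivative
    (\<lambda>U. glue (f' (base_part U)) (g' (hopf_part U)))) (at z)"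
proof -
  note f = diff_chain_at[OF bounded_linear_imp_has_derivative[OF bounded_linear_base_part] assms(1), unfolded o_def]
  note g = diff_chain_at[OF bounded_linear_imp_has_derivative[OF bounded_linear_hopf_part] assms(2), unfolded o_def]
  show ?thesis
    unfolding glue_def
    by (intro has_derivative_Pair f bounded_linear.has_derivative[OF bounded_linear_fst g]
        bounded_linear.has_derivative[OF bounded_linear_snd g])
qed

abbreviation cover :: "('a, 'e::real_inner) manifold \<Rightarrow>
    (('a \<times> (real^3) \<times> real) \<times> real, ('e \<times> (real^3)) \<times> real) manifold" where
  "cover K \<equiv> prod_manifold (prod_manifold K sphere3) line_manifold"

definition cover_chart :: "('a, 'e::real_inner) chart \<Rightarrow> real \<Rightarrow>
    (('a \<times> (real^3) \<times> real) \<times> real, ('e \<times> (real^3)) \<times> real) chart" where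
  "cover_chart c \<epsilon> = prod_chart (prod_chart c (stereo \<epsilon>)) (UNIV, id)"

lemma atlas_cover: "atlas (cover K) =
    {cover_chart c \<epsilon> | c \<epsilon>. c \<in> atlas K \<and> (\<epsilon> = 1 \<or> \<epsilon> = - 1)}"
  unfolding atlas_prod_manifold atlas_sphere3 atlas_line cover_chart_def by blast

definition cover_map :: "('a \<Rightarrow> 'a) \<Rightarrow> real \<Rightarrow> ('a \<times> 'b) \<times> real \<Rightarrow> ('a \<times> 'b) \<times> real" where
  "cover_map \<phi> a = map_prod (map_prod \<phi> id) (\<lambda>t. t + a)"

lemma cover_map_id: "cover_map id 0 = id"
  by (simp add: cover_map_def map_prod_id id_def[symmetric] fun_eq_iff)

lemma fst_cover_chart: "p \<in> fst (cover_chart c \<epsilon>) \<longleftrightarrow>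
    base_part p \<in> fst c \<and> fst (hopf_part p) \<in> fst (stereo \<epsilon>)"
  by (cases p) (auto simp: cover_chart_def base_part_def hopf_part_def)

lemma snd_cover_chart: "snd (cover_chart c \<epsilon>) p =
    glue (snd c (base_part p)) (snd (stereo \<epsilon>) (fst (hopf_part p)), snd (hopf_part p))"
  by (cases p) (auto simp: cover_chart_def base_part_def hopf_part_def glue_def)

lemma cover_map_dom: "z \<in> local_dom (cover_map \<phi> a) (cover_chart c \<epsilon>) (cover_chart c' \<delta>) \<longleftrightarrow>
    base_part z \<in> local_dom \<phi> c c' \<and> fst (hopf_part z) \<in> local_dom id (stereo \<epsilon>) (stereo \<delta>)"
  unfolding cover_map_def cover_chart_def
    local_dom_prod line_rep
  by (auto simp: base_part_def hopf_part_def mem_Times_iff)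

context
  fixes X :: "'a topology" and c :: "('a, 'e::real_inner) chart" and \<epsilon> :: real
  assumes c: "is_chart X c" and eps: "\<epsilon> = 1 \<or> \<epsilon> = - 1"
begin

lemma cover_chart_is_chart:
  "is_chart (prod_topology (prod_topology X (top_of_set (sphere 0 1))) euclidean) (cover_chart c \<epsilon>)"
  unfolding cover_chart_def
  by (intro prod_is_chart c stereo_is_chart eps UNIV_id_is_chart)

lemma cover_chart_image:
  "snd (cover_chart c \<epsilon>) ` fst (cover_chart c \<epsilon>) = {z. base_part z \<in> snd c ` fst c}"
proof -
  have "snd (cover_chart c \<epsilon>) ` fst (cover_chart c \<epsilon>) = (snd c ` fst c \<times> UNIV) \<times> UNIV"
    by (simp add: cover_chart_def map_prod_surj_on[OF map_prod_surj_on[OF refl stereo_image[OF eps]]])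
  also have "\<dots> = {z. base_part z \<in> snd c ` fst c}" by (auto simp: base_part_def)
  finally show ?thesis .
qed

lemma cover_chart_inv:
  assumes "base_part z \<in> snd c ` fst c"
  shows "chart_inv (cover_chart c \<epsilon>) z =
    glue (chart_inv c (base_part z)) (stereo_inv \<epsilon> (fst (hopf_part z)), snd (hopf_part z))"
proof -
  let ?p = "glue (chart_inv c (base_part z)) (stereo_inv \<epsilon> (fst (hopf_part z)), snd (hopf_part z))"
  have "?p \<in> fst (cover_chart c \<epsilon>)"
    unfolding fst_cover_chart using assms stereo_inv_in[OF eps] by (simp add: inv_into_into)
  moreover have "snd (cover_chart c \<epsilon>) ?p = z"
    unfolding snd_cover_chart
    by (simp add: stereo_right_inverse[OF eps] f_inv_into_f[OF assms])
  ultimately show ?thesis using chart_inv_chart[OF cover_chart_is_chart] by metis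
qed

end

context
  fixes X :: "'a topology" and c c' :: "('a, 'e::real_inner) chart" and \<epsilon> \<delta> :: real
    and \<phi> :: "'a \<Rightarrow> 'a"
  assumes c: "is_chart X c" and c': "is_chart X c'"
    and eps: "\<epsilon> = 1 \<or> \<epsilon> = - 1" and del: "\<delta> = 1 \<or> \<delta> = - 1"
    and phi: "continuous_map X X \<phi>" and s: "smooth_rep \<phi> c c'"
begin

lemma cover_map_rep:
  assumes z: "base_part z \<in> local_dom \<phi> c c'" "fst (hopf_part z) \<in> local_dom id (stereo \<epsilon>) (stereo \<delta>)"
  shows "local_rep (cover_map \<phi> a) (cover_chart c \<epsilon>) (cover_chart c' \<delta>) z =
      glue (local_rep \<phi> c c' (base_part z))
        (local_rep id (stereo \<epsilon>) (stereo \<delta>) (fst (hopf_part z)), snd (hopf_part z) + a)" (is ?rep)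
    and "local_deriv (cover_map \<phi> a) (cover_chart c \<epsilon>) (cover_chart c' \<delta>) z U =
      glue (local_deriv \<phi> c c' (base_part z) (base_part U))
        (local_deriv id (stereo \<epsilon>) (stereo \<delta>) (fst (hopf_part z))
            (fst (hopf_part U)), snd (hopf_part U))" (is ?deriv)
proof -
  note cs = stereo_is_chart[OF eps] and ds = stereo_is_chart[OF del]
  have z1: "fst z \<in> local_dom \<phi> c c' \<times> local_dom id (stereo \<epsilon>) (stereo \<delta>)"
    using z by (cases z) (auto simp: base_part_def hopf_part_def)
  then have z2: "z \<in> local_dom (map_prod \<phi> id) (prod_chart c (stereo \<epsilon>)) (prod_chart c' (stereo \<delta>))
      \<times> local_dom (\<lambda>t. t + a) (UNIV, id) (UNIV, id)"
    unfolding local_dom_prod line_rep by (cases z) auto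
  show ?rep
    unfolding cover_map_def cover_chart_def
      local_rep_prod[OF prod_is_chart[OF c cs] UNIV_id_is_chart z2]
      local_rep_prod[OF c cs z1] line_rep
    by (simp add: glue_def base_part_def hopf_part_def)
  have st: "smooth_on UNIV (\<lambda>t::real. t + a)" by (intro smooth_intros open_UNIV)
  have ct: "continuous_map euclidean euclidean (\<lambda>t::real. t + a)"
    using smooth_on_imp_continuous_on[OF st] by simp
  have "((\<lambda>t::real. t + a) has_derivative (\<lambda>v. v)) (at (snd z))"
    by (auto intro!: derivative_eq_intros)
  then have dt: "frechet_derivative (\<lambda>t::real. t + a) (at (snd z)) = (\<lambda>v. v)"
    by (rule frechet_derivative_at[symmetric])
  have "local_deriv (map_prod (map_prod \<phi> id) (\<lambda>t. t + a)) (prod_chart (prod_chart c (stereo \<epsilon>)) (UNIV, id)) (prod_chart (prod_chart c' (stereo \<delta>)) (UNIV, id)) z U =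
    (local_deriv (map_prod \<phi> id) (prod_chart c (stereo \<epsilon>)) (prod_chart c' (stereo \<delta>)) (fst z) (fst U),
     local_deriv (\<lambda>t. t + a) (UNIV, id) (UNIV, id) (snd z) (snd U))"
    by (rule local_rep_prod_derivative[OF prod_is_chart[OF c cs] UNIV_id_is_chart
          prod_is_chart[OF c' ds] UNIV_id_is_chart
          continuous_map_map_prod[OF phi continuous_map_id] ct
          local_rep_prod_smooth[OF c cs c' ds phi continuous_map_id s
            stereo_transition_smooth[OF eps del]] _ z2]) (simp add: line_rep st)
  also have "\<dots> = ((local_deriv \<phi> c c' (base_part z) (base_part U),
      local_deriv id (stereo \<epsilon>) (stereo \<delta>) (fst (hopf_part z))
            (fst (hopf_part U))), snd U)"
    unfolding local_rep_prod_derivative[OF c cs c' ds phi continuous_map_id s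
        stereo_transition_smooth[OF eps del] z1] line_rep dt
    by (simp add: base_part_def hopf_part_def)
  finally show ?deriv
    unfolding cover_map_def cover_chart_def by (simp add: glue_def hopf_part_def)
qed

end

definition skt_I :: "('a, 'e::real_inner) endo_field \<Rightarrow> ('a, 'e) chart \<Rightarrow> real \<Rightarrow>
    ('e \<times> (real^3)) \<times> real \<Rightarrow> ('e \<times> (real^3)) \<times> real \<Rightarrow> ('e \<times> (real^3)) \<times> real" where
  "skt_I J c \<epsilon> z U = glue (J c (base_part z) (base_part U)) (hopf_I \<epsilon> (hopf_part z) (hopf_part U))"

definition skt_h :: "('a, 'e::real_inner) form2 \<Rightarrow> ('a, 'e) chart \<Rightarrow>
    ('e \<times> (real^3)) \<times> real \<Rightarrow> ('e \<times> (real^3)) \<times> real \<Rightarrow> ('e \<times> (real^3)) \<times> real \<Rightarrow> real" where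
  "skt_h g c z U V = g c (base_part z) (base_part U) (base_part V) +
    hopf_h (hopf_part z) (hopf_part U) (hopf_part V)"

text \<open>Tensor fields are indexed by charts, so the factors of a product chart are recovered by choice;
  any factors serve, as the tensor fields agree on overlaps.\<close>

definition chart_factors :: "('a, 'e::real_inner) manifold \<Rightarrow>
    (('a \<times> (real^3) \<times> real) \<times> real, ('e \<times> (real^3)) \<times> real) chart \<Rightarrow> ('a, 'e) chart \<times> real" where
  "chart_factors K C =
    (SOME f. fst f \<in> atlas K \<and> (snd f = 1 \<or> snd f = - 1) \<and> C = cover_chart (fst f) (snd f))"

definition cover_I :: "('a, 'e::real_inner) manifold \<Rightarrow> ('a, 'e) endo_field \<Rightarrow>
    (('a \<times> (real^3) \<times> real) \<times> real, ('e \<times> (real^3)) \<times> real) endo_field" where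
  "cover_I K J C = skt_I J (fst (chart_factors K C)) (snd (chart_factors K C))"

definition cover_h :: "('a, 'e::real_inner) manifold \<Rightarrow> ('a, 'e) form2 \<Rightarrow>
    (('a \<times> (real^3) \<times> real) \<times> real, ('e \<times> (real^3)) \<times> real) form2" where
  "cover_h K g C = skt_h g (fst (chart_factors K C))"

lemma cover_factors:
  assumes "C \<in> atlas (cover K)"
  obtains c \<epsilon> where "c \<in> atlas K" "\<epsilon> = 1 \<or> \<epsilon> = - 1" "C = cover_chart c \<epsilon>"
    "cover_I K J C = skt_I J c \<epsilon>" "cover_h K g C = skt_h g c"
proof -
  obtain c0 \<epsilon>0 where "c0 \<in> atlas K" "\<epsilon>0 = 1 \<or> \<epsilon>0 = - 1" "C = cover_chart c0 \<epsilon>0"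
    using assms unfolding atlas_cover by blast
  then have "\<exists>f. fst f \<in> atlas K \<and> (snd f = 1 \<or> snd f = - 1) \<and> C = cover_chart (fst f) (snd f)"
    by (intro exI[of _ "(c0, \<epsilon>0)"]) simp
  from someI_ex[OF this, folded chart_factors_def] show ?thesis
    by (intro that[of "fst (chart_factors K C)" "snd (chart_factors K C)"])
      (simp_all add: cover_I_def cover_h_def)
qed

lemma linear_hopf_I: "linear (hopf_I \<epsilon> y)"
  by (rule linearI) (simp_all add: hopf_I_def cross_add_right cross_mult_right inner_add_right algebra_simps)

lemma bilinear_hopf_h: "bilinear (hopf_h y)"
  unfolding bilinear_def hopf_h_def
  by (auto intro!: linearI simp: inner_add_left inner_add_right algebra_simps)

lemma hopf_h_commute: "hopf_h y U V = hopf_h y V U"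
  by (simp add: hopf_h_def inner_commute mult.commute)

lemma hopf_h_nonneg: "hopf_h y U U \<ge> 0"
  by (simp add: hopf_h_def)

text \<open>The Hopf structure does not depend on the coordinate of the line, so translations of the line
  preserve it.\<close>

lemma cover_map_hermitian:
  assumes K: "smooth_manifold n K" and \<phi>: "hermitian_map K J g \<phi>"
  shows "hermitian_map (cover K) (cover_I K J) (cover_h K g) (cover_map \<phi> a)"
proof -
  have sm: "smooth_map K K \<phi>" using \<phi> by (simp add: hermitian_map_def)
  then have cphi: "continuous_map (topo K) (topo K) \<phi>" by (simp add: smooth_map_def)
  have KS: "smooth_manifold (n + 3) (prod_manifold K sphere3)"
    by (rule smooth_manifold_prod[OF K smooth_manifold_sphere3])
  have "smooth_map (cover K) (cover K) (cover_map \<phi> a)"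
    unfolding cover_map_def
    by (intro smooth_map_prod[OF KS KS smooth_manifold_line smooth_manifold_line]
        smooth_map_prod[OF K K smooth_manifold_sphere3 smooth_manifold_sphere3] sm
        smooth_map_id[OF smooth_manifold_sphere3] smooth_map_translation)
  moreover have "local_deriv (cover_map \<phi> a) C C' z (cover_I K J C z U) =
      cover_I K J C' (local_rep (cover_map \<phi> a) C C' z)
        (local_deriv (cover_map \<phi> a) C C' z U) \<and>
      cover_h K g C' (local_rep (cover_map \<phi> a) C C' z)
        (local_deriv (cover_map \<phi> a) C C' z U)
        (local_deriv (cover_map \<phi> a) C C' z V) = cover_h K g C z U V"
    if C: "C \<in> atlas (cover K)" and C': "C' \<in> atlas (cover K)"
      and z: "z \<in> local_dom (cover_map \<phi> a) C C'" for C C' z U V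
  proof -
    obtain c \<epsilon> where c: "c \<in> atlas K" "\<epsilon> = 1 \<or> \<epsilon> = - 1" and Ceq: "C = cover_chart c \<epsilon>"
      "cover_I K J C = skt_I J c \<epsilon>" "cover_h K g C = skt_h g c"
      using cover_factors[OF C] .
    obtain c' \<delta> where c': "c' \<in> atlas K" "\<delta> = 1 \<or> \<delta> = - 1" and Ceq': "C' = cover_chart c' \<delta>"
      "cover_I K J C' = skt_I J c' \<delta>" "cover_h K g C' = skt_h g c'"
      using cover_factors[OF C'] .
    note cc = manifold_chart[OF K c(1)] and cc' = manifold_chart[OF K c'(1)]
    have z': "base_part z \<in> local_dom \<phi> c c'"
      "fst (hopf_part z) \<in> local_dom id (stereo \<epsilon>) (stereo \<delta>)"
      using z unfolding Ceq(1) Ceq'(1) cover_map_dom by simp_all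
    have s: "smooth_rep \<phi> c c'"
      using sm c(1) c'(1) by (simp add: smooth_map_def)
    note rep = cover_map_rep[OF cc cc' c(2) c'(2) cphi s z', folded Ceq(1) Ceq'(1)]
    note H1 = hopf_transition(1)[OF c(2) c'(2) z'(2), of "snd (hopf_part z) + a" "hopf_part U"
        "snd (hopf_part z)", unfolded prod.collapse]
    note H2 = hopf_transition(2)[OF c(2) c'(2) z'(2), of "snd (hopf_part z) + a" "hopf_part U"
        "hopf_part V" "snd (hopf_part z)", unfolded prod.collapse]
    show ?thesis
      unfolding Ceq(2,3) Ceq'(2,3) rep skt_I_def skt_h_def glue_simps
        H1 H2 hermitian_mapD[OF \<phi> c(1) c'(1) z'(1)]
      by simp
  qed
  ultimately show ?thesis
    unfolding hermitian_map_def preserves_endo_def preserves_bilinear_def by blast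
qed

subsection \<open>Integrability\<close>

text \<open>Holomorphic coordinates on \<open>K\<close> together with polar coordinates on the other factors; here the
  complex structure has constant coefficients.\<close>

definition hol_chart :: "('a, 'e::real_inner) chart \<Rightarrow>
    (('a \<times> (real^3) \<times> real) \<times> real, ('e \<times> (real^3)) \<times> real) chart" where
  "hol_chart d = ({p. base_part p \<in> fst d \<and> hopf_part p \<in> fst polar},
     \<lambda>p. glue (snd d (base_part p)) (snd polar (hopf_part p)))"

lemma hol_chart_is_chart:
  assumes d: "is_chart X d"
  shows "is_chart (prod_topology (prod_topology X (top_of_set (sphere 0 1))) euclidean) (hol_chart d)"
proof -
  let ?Y = "prod_topology (prod_topology X (top_of_set (sphere 0 1 :: ((real^3) \<times> real) set))) (euclidean :: real topology)"
  let ?X = "prod_topology X (prod_topology (top_of_set (sphere 0 1 :: ((real^3) \<times> real) set)) (euclidean :: real topology))"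
  let ?A = "\<lambda>p. (base_part p, hopf_part p)" and ?B = "\<lambda>q. glue (fst q) (snd q)"
  have f: "continuous_map ?Y (prod_topology X (top_of_set (sphere 0 1))) fst"
    and s: "continuous_map ?Y euclidean snd"
    and f': "continuous_map ?X X fst"
    and s': "continuous_map ?X (prod_topology (top_of_set (sphere 0 1)) euclidean) snd"
    by (rule continuous_map_fst continuous_map_snd)+
  have A: "continuous_map ?Y ?X ?A"
    unfolding base_part_def hopf_part_def
    by (intro continuous_map_pairedI s
        continuous_map_compose[OF f continuous_map_fst, unfolded o_def]
        continuous_map_compose[OF f continuous_map_snd, unfolded o_def])
  have B: "continuous_map ?X ?Y ?B"
    unfolding glue_def
    by (intro continuous_map_pairedI f'
        continuous_map_compose[OF s' continuous_map_fst, unfolded o_def]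
        continuous_map_compose[OF s' continuous_map_snd, unfolded o_def])
  have L: "continuous_on UNIV (\<lambda>q::'b \<times> (real^3) \<times> real. glue (fst q) (snd q))"
    unfolding glue_def by (intro continuous_intros)
  have M: "continuous_on UNIV (\<lambda>p::('b \<times> (real^3)) \<times> real. (base_part p, hopf_part p))"
    unfolding base_part_def hopf_part_def by (intro continuous_intros)
  have "is_chart ?Y ({p \<in> topspace ?Y. ?A p \<in> fst (prod_chart d polar)},
      \<lambda>p. (\<lambda>q. glue (fst q) (snd q)) (snd (prod_chart d polar) (?A p)))"
    by (rule is_chart_transfer[OF prod_is_chart[OF d polar_is_chart] A B _ _ L M]) simp_all
  moreover have "{p \<in> topspace ?Y. ?A p \<in> fst (prod_chart d polar)} = fst (hol_chart d)"
    using is_chart_subset[OF d]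
    by (auto simp: hol_chart_def base_part_def hopf_part_def polar_def)
  moreover have "(\<lambda>p. (\<lambda>q. glue (fst q) (snd q)) (snd (prod_chart d polar) (?A p))) = snd (hol_chart d)"
    by (simp add: hol_chart_def fun_eq_iff)
  ultimately show ?thesis by simp
qed

lemma polar_apply: "snd polar (z, t) = exp t *\<^sub>R z"
  by (simp add: polar_def)

lemma polar_mem: "(z, t) \<in> fst polar \<longleftrightarrow> z \<in> sphere 0 1"
  by (simp add: polar_def)

text \<open>Writing the norm with \<open>ln\<close> and \<open>exp\<close> makes its smoothness off the origin a matter of
  composition.\<close>

definition radius :: "(real^3) \<times> real \<Rightarrow> real" where
  "radius y = exp (ln (y \<bullet> y) / 2)"

context
  fixes X :: "'a topology" and c d :: "('a, 'e::real_inner) chart" and \<epsilon> :: real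
  assumes c: "is_chart X c" and d: "is_chart X d" and eps: "\<epsilon> = 1 \<or> \<epsilon> = - 1"
    and cd: "smoothly_compatible c d"
begin

lemma compatible_smooth:
  "smooth_rep id c d" "smooth_rep id d c"
  using cd by (simp_all add: smoothly_compatible_def)

lemma hol_transition_dom:
  "z \<in> local_dom id (cover_chart c \<epsilon>) (hol_chart d) \<longleftrightarrow> base_part z \<in> local_dom id c d"
proof (cases "base_part z \<in> snd c ` fst c")
  case True
  then show ?thesis
    using stereo_inv_sphere[OF eps]
    unfolding mem_local_dom_iff[OF cover_chart_is_chart[OF c eps]] mem_local_dom_iff[OF c]
      cover_chart_image[OF c eps]
    by (simp add: cover_chart_inv[OF c eps True] hol_chart_def polar_mem)
next
  case False
  then show ?thesis
    unfolding mem_local_dom_iff[OF cover_chart_is_chart[OF c eps]] mem_local_dom_iff[OF c]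
      cover_chart_image[OF c eps] by simp
qed

lemma hol_transition:
  assumes "base_part z \<in> local_dom id c d"
  shows "local_rep id (cover_chart c \<epsilon>) (hol_chart d) z =
    glue (local_rep id c d (base_part z)) (hopf_embed \<epsilon> (hopf_part z))"
proof -
  have z: "base_part z \<in> snd c ` fst c" using assms by (simp add: mem_local_dom_iff[OF c])
  have "hopf_embed \<epsilon> (hopf_part z) =
      exp (snd (hopf_part z)) *\<^sub>R stereo_inv \<epsilon> (fst (hopf_part z))"
    using hopf_embed_stereo_inv[of \<epsilon> "fst (hopf_part z)" "snd (hopf_part z)"] by simp
  then show ?thesis
    unfolding local_rep_apply cover_chart_inv[OF c eps z]
    by (simp add: hol_chart_def polar_apply)
qed

lemma open_hol_transition_dom: "open {z :: ('e \<times> (real^3)) \<times> real. base_part z \<in> local_dom id c d}"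
proof -
  have "continuous_on UNIV (base_part :: ('e \<times> (real^3)) \<times> real \<Rightarrow> 'e)"
    by (rule bounded_linear.continuous_on[OF bounded_linear_base_part continuous_on_id])
  from open_vimage[OF open_local_dom[OF c d continuous_map_id] this] show ?thesis
    by (simp add: vimage_def)
qed

lemma hol_transition_smooth:
  "smooth_rep id (cover_chart c \<epsilon>) (hol_chart d)"
proof -
  let ?S = "{z :: ('e \<times> (real^3)) \<times> real. base_part z \<in> local_dom id c d}"
  note o = open_hol_transition_dom
  have "smooth_on ?S (\<lambda>z. hopf_part z :: (real^3) \<times> real)"
    by (rule smooth_on_bounded_linear[OF bounded_linear_hopf_part o smooth_on_id])
  then have "smooth_on ?S (\<lambda>z. glue (local_rep id c d (base_part z)) (hopf_embed \<epsilon> (hopf_part z)))"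
    by (intro smooth_on_glue o smooth_on_hopf_embed
        smooth_on_compose_linear[OF bounded_linear_base_part o _ compatible_smooth(1)]) auto
  moreover have "local_dom id (cover_chart c \<epsilon>) (hol_chart d) = ?S"
    using hol_transition_dom by blast
  ultimately show ?thesis
    using smooth_on_cong[OF o, of "\<lambda>z. glue (local_rep id c d (base_part z)) (hopf_embed \<epsilon> (hopf_part z))"
        "local_rep id (cover_chart c \<epsilon>) (hol_chart d)"] hol_transition by simp
qed

lemma hol_transition_derivative:
  assumes z: "base_part z \<in> local_dom id c d"
  shows "local_deriv id (cover_chart c \<epsilon>) (hol_chart d) z U =
    glue (local_deriv id c d (base_part z) (base_part U))
      (hopf_embed_deriv \<epsilon> (hopf_part z) (hopf_part U))"
proof -
  have "local_deriv id (cover_chart c \<epsilon>) (hol_chart d) z =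
      frechet_derivative (\<lambda>z. glue (local_rep id c d (base_part z)) (hopf_embed \<epsilon> (hopf_part z))) (at z)"
    by (rule frechet_derivative_cong_open[OF open_hol_transition_dom])
      (use z hol_transition in auto)
  also have "\<dots> = (\<lambda>U. glue (local_deriv id c d (base_part z) (base_part U))
      (hopf_embed_deriv \<epsilon> (hopf_part z) (hopf_part U)))"
    by (rule frechet_derivative_at[symmetric, OF glue_has_derivative[OF
            smooth_on_has_derivative[OF compatible_smooth(1) z] hopf_embed_has_derivative]])
  finally show ?thesis by simp
qed

text \<open>In polar coordinates \<open>y = e\<^sup>t z\<close> the time is \<open>ln (y \<bullet> y) / 2\<close>, and the stereographic coordinate
  of \<open>z = y / radius y\<close> is the imaginary part of \<open>y\<close> divided by \<open>radius y - \<epsilon> * snd y\<close>.\<close>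

lemma hol_transition_inverse:
  assumes w: "w \<in> local_dom id (hol_chart d) (cover_chart c \<epsilon>)"
  shows "base_part w \<in> local_dom id d c" "hopf_part w \<bullet> hopf_part w > 0"
    "radius (hopf_part w) - \<epsilon> * snd (hopf_part w) \<noteq> 0"
    "local_rep id (hol_chart d) (cover_chart c \<epsilon>) w = glue (local_rep id d c (base_part w))
      (inverse (radius (hopf_part w) - \<epsilon> * snd (hopf_part w)) *\<^sub>R fst (hopf_part w),
       ln (hopf_part w \<bullet> hopf_part w) / 2)" (is ?rep)
proof -
  obtain p where p: "p \<in> fst (hol_chart d)" "p \<in> fst (cover_chart c \<epsilon>)" "w = snd (hol_chart d) p"
    using w unfolding local_dom_def by auto
  define z t where "z = fst (hopf_part p)" and "t = snd (hopf_part p)"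
  have zt: "hopf_part p = (z, t)" by (simp add: z_def t_def)
  have k: "base_part p \<in> fst d" "base_part p \<in> fst c" and z: "z \<in> sphere 0 1" "z \<in> fst (stereo \<epsilon>)"
    using p(1,2) by (simp_all add: hol_chart_def fst_cover_chart zt polar_mem)
  have w1: "base_part w = snd d (base_part p)" and w2: "hopf_part w = exp t *\<^sub>R z"
    by (simp_all add: p(3) hol_chart_def zt polar_apply)
  have "z \<bullet> z = 1" using z(1) by (simp add: norm_eq_1)
  then have ww: "hopf_part w \<bullet> hopf_part w = exp (2 * t)"
    unfolding w2 by (simp add: exp_double power2_eq_square)
  then show "hopf_part w \<bullet> hopf_part w > 0" by simp
  have lnw: "ln (hopf_part w \<bullet> hopf_part w) / 2 = t" unfolding ww by simp
  have "radius (hopf_part w) = exp t" unfolding radius_def lnw ..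
  then have rw: "radius (hopf_part w) - \<epsilon> * snd (hopf_part w) = exp t * (1 - \<epsilon> * snd z)"
    unfolding w2 by (simp add: algebra_simps)
  have ne: "1 - \<epsilon> * snd z \<noteq> 0"
    using stereo_pole[OF eps z(1)] z(2) by (auto simp: stereo_def)
  then show "radius (hopf_part w) - \<epsilon> * snd (hopf_part w) \<noteq> 0" unfolding rw by simp
  show "base_part w \<in> local_dom id d c" using k w1 by (auto simp: local_dom_def)
  have "local_rep id (hol_chart d) (cover_chart c \<epsilon>) w = snd (cover_chart c \<epsilon>) p"
    unfolding local_rep_apply p(3)
    by (simp add: chart_inv_chart[OF hol_chart_is_chart[OF d] p(1)])
  also have "\<dots> = glue (snd c (base_part p)) (snd (stereo \<epsilon>) z, t)"
    by (simp add: snd_cover_chart zt)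
  also have "snd c (base_part p) = local_rep id d c (base_part w)"
    unfolding w1 local_rep_apply by (simp add: chart_inv_chart[OF d k(1)])
  also have "snd (stereo \<epsilon>) z =
      inverse (radius (hopf_part w) - \<epsilon> * snd (hopf_part w)) *\<^sub>R fst (hopf_part w)"
    unfolding rw unfolding w2 using ne by (cases z) (simp add: stereo_def)
  finally show ?rep unfolding lnw .
qed

lemma hol_transition_inverse_smooth:
  "smooth_rep id (hol_chart d) (cover_chart c \<epsilon>)"
proof -
  let ?S = "local_dom id (hol_chart d) (cover_chart c \<epsilon>)"
  note inv = hol_transition_inverse
  have o: "open ?S"
    by (rule open_local_dom[OF hol_chart_is_chart[OF d] cover_chart_is_chart[OF c eps]
          continuous_map_id])
  have i: "smooth_on ?S (\<lambda>w. hopf_part w :: (real^3) \<times> real)"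
    by (rule smooth_on_bounded_linear[OF bounded_linear_hopf_part o smooth_on_id])
  have r: "smooth_on ?S (\<lambda>w. radius (hopf_part w))"
    unfolding radius_def by (intro smooth_intros o i inv(2)) auto
  have s: "smooth_on ?S (\<lambda>w. glue (local_rep id d c (base_part w))
      (inverse (radius (hopf_part w) - \<epsilon> * snd (hopf_part w)) *\<^sub>R fst (hopf_part w),
       ln (hopf_part w \<bullet> hopf_part w) / 2))"
    by (intro smooth_on_glue smooth_on_Pair smooth_on_scaleR smooth_on_inverse smooth_on_diff
        smooth_on_mult smooth_on_const smooth_on_fst smooth_on_snd smooth_on_divide smooth_on_ln
        smooth_on_inner o i r inv(2,3)
        smooth_on_compose_linear[OF bounded_linear_base_part o _ compatible_smooth(2)])
      (use inv(1) in auto)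
  show ?thesis by (rule smooth_on_cong[OF o _ s]) (rule inv(4)[symmetric])
qed

end

lemma cover_complex_structure:
  assumes K: "smooth_manifold n K" and J: "complex_structure K J"
    and id: "hermitian_map (cover K) (cover_I K J) (cover_h K g) id"
  shows "complex_structure (cover K) (cover_I K J)"
  unfolding complex_structure_def smooth_endo_field_def
proof (intro conjI ballI allI)
  fix C assume C: "C \<in> atlas (cover K)"
  obtain c \<epsilon> where c: "c \<in> atlas K" "\<epsilon> = 1 \<or> \<epsilon> = - 1" and Ceq: "C = cover_chart c \<epsilon>"
    "cover_I K J C = skt_I J c \<epsilon>" by (rule cover_factors[OF C])
  note cc = manifold_chart[OF K c(1)]
  have im: "snd C ` fst C = {z. base_part z \<in> snd c ` fst c}"
    unfolding Ceq(1) by (rule cover_chart_image[OF cc c(2)])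
  note JD = complex_structureD[OF J c(1)]
  show "linear (cover_I K J C z)" if "z \<in> snd C ` fst C" for z
  proof -
    have "linear (J c (base_part z))" by (rule JD(1)) (use that in \<open>simp add: im\<close>)
    then show ?thesis
      unfolding Ceq(2)
      by (intro linearI)
        (simp_all add: skt_I_def base_part_linear hopf_part_linear linear_add linear_scale
          linear_hopf_I glue_add glue_scaleR)
  qed
  show "smooth_on (snd C ` fst C) (\<lambda>z. cover_I K J C z U)" for U
  proof -
    have o: "open (snd C ` fst C)"
      using manifold_chart[OF smooth_manifold_prod[OF smooth_manifold_prod[OF K
              smooth_manifold_sphere3] smooth_manifold_line] C] by (simp add: is_chart_def)
    have "base_part ` (snd C ` fst C) \<subseteq> snd c ` fst c" unfolding im by auto
    then show ?thesis
      unfolding Ceq(2) skt_I_def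
      by (intro smooth_on_glue o smooth_on_hopf_I
          smooth_on_compose_linear[OF bounded_linear_base_part o _ JD(3)]
          smooth_on_bounded_linear[OF bounded_linear_hopf_part o smooth_on_id])
  qed
  show "cover_I K J C z (cover_I K J C z U) = - U" if "z \<in> snd C ` fst C" for z U
  proof -
    have "J c (base_part z) (J c (base_part z) (base_part U)) = - base_part U"
      by (rule JD(2)) (use that in \<open>simp add: im\<close>)
    then show ?thesis
      unfolding Ceq(2) by (simp add: skt_I_def hopf_I_squared[OF c(2)] glue_minus)
  qed
next
  show "preserves_endo (cover K) id (cover_I K J)" using id by (simp add: hermitian_map_def)
next
  fix p assume "p \<in> topspace (topo (cover K))"
  then have p: "base_part p \<in> topspace (topo K)" "hopf_part p \<in> fst polar"
    by (auto simp: base_part_def hopf_part_def polar_def)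
  obtain d J0 where d: "is_chart (topo K) d" "base_part p \<in> fst d"
    and comp: "\<And>c. c \<in> atlas K \<Longrightarrow> smoothly_compatible c d"
    and J0: "linear J0" "\<And>v. J0 (J0 v) = - v"
    and hol: "\<And>c x v. c \<in> atlas K \<Longrightarrow> x \<in> local_dom id c d \<Longrightarrow>
        local_deriv id c d x (J c x v) =
        J0 (local_deriv id c d x v)"
    using J p(1) unfolding complex_structure_def by meson
  define J1 where "J1 U = glue (J0 (base_part U)) (hopf_j (hopf_part U))"
    for U :: "('b \<times> (real^3)) \<times> real"
  show "\<exists>D J1. is_chart (topo (cover K)) D \<and> p \<in> fst D \<and>
      (\<forall>C\<in>atlas (cover K). smoothly_compatible C D) \<and>
      linear J1 \<and> (\<forall>v. J1 (J1 v) = - v) \<and>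
      (\<forall>C\<in>atlas (cover K). \<forall>x\<in>local_dom id C D. \<forall>v.
        local_deriv id C D x (cover_I K J C x v) =
        J1 (local_deriv id C D x v))"
  proof (intro exI[of _ "hol_chart d"] exI[of _ J1] conjI ballI allI)
    show "is_chart (topo (cover K)) (hol_chart d)"
      using hol_chart_is_chart[OF d(1)] by simp
    show "p \<in> fst (hol_chart d)" using p(2) d(2) by (simp add: hol_chart_def)
    show "linear J1"
      by (rule linearI) (simp_all add: J1_def base_part_linear hopf_part_linear linear_add linear_scale
          linear_hopf_j J0(1) glue_add glue_scaleR)
    show "J1 (J1 v) = - v" for v
      by (simp add: J1_def J0(2) hopf_j_squared glue_minus)
    fix C assume C: "C \<in> atlas (cover K)"
    obtain c \<epsilon> where c: "c \<in> atlas K" "\<epsilon> = 1 \<or> \<epsilon> = - 1" and Ceq: "C = cover_chart c \<epsilon>"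
      "cover_I K J C = skt_I J c \<epsilon>" by (rule cover_factors[OF C])
    note h = manifold_chart[OF K c(1)] d(1) c(2) comp[OF c(1)]
    show "smoothly_compatible C (hol_chart d)"
      unfolding smoothly_compatible_def Ceq(1)
      by (intro conjI hol_transition_smooth[OF h] hol_transition_inverse_smooth[OF h])
    fix z U assume "z \<in> local_dom id C (hol_chart d)"
    then have z: "base_part z \<in> local_dom id c d"
      unfolding Ceq(1) hol_transition_dom[OF h] .
    show "local_deriv id C (hol_chart d) z (cover_I K J C z U) =
        J1 (local_deriv id C (hol_chart d) z U)"
      unfolding Ceq(2) unfolding Ceq(1) hol_transition_derivative[OF h z]
      by (simp add: skt_I_def J1_def hol[OF c(1) z] hopf_embed_holomorphic[OF c(2)])
  qed
qed

subsection \<open>The metric and its torsion\<close>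

lemma cover_hermitian_metric:
  assumes K: "smooth_manifold n K" and g: "hermitian_metric K J g"
    and id: "hermitian_map (cover K) (cover_I K J) (cover_h K g) id"
  shows "hermitian_metric (cover K) (cover_I K J) (cover_h K g)"
  unfolding hermitian_metric_def riemannian_metric_def
proof (intro conjI ballI allI impI)
  fix C assume C: "C \<in> atlas (cover K)"
  obtain c \<epsilon> where c: "c \<in> atlas K" "\<epsilon> = 1 \<or> \<epsilon> = - 1" and Ceq: "C = cover_chart c \<epsilon>"
    "cover_I K J C = skt_I J c \<epsilon>" "cover_h K g C = skt_h g c" by (rule cover_factors[OF C])
  note cc = manifold_chart[OF K c(1)]
  have im: "snd C ` fst C = {z. base_part z \<in> snd c ` fst c}"
    unfolding Ceq(1) by (rule cover_chart_image[OF cc c(2)])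
  show "smooth_on (snd C ` fst C) (\<lambda>z. cover_h K g C z U V)" for U V
  proof -
    have o: "open (snd C ` fst C)"
      using manifold_chart[OF smooth_manifold_prod[OF smooth_manifold_prod[OF K
              smooth_manifold_sphere3] smooth_manifold_line] C] by (simp add: is_chart_def)
    have "base_part ` (snd C ` fst C) \<subseteq> snd c ` fst c" unfolding im by auto
    then show ?thesis
      unfolding Ceq(3) skt_h_def
      by (intro smooth_on_add o smooth_on_hopf_h
          smooth_on_compose_linear[OF bounded_linear_base_part o _ hermitian_metric_smooth[OF g c(1)]]
          smooth_on_bounded_linear[OF bounded_linear_hopf_part o smooth_on_id])
  qed
  fix z assume "z \<in> snd C ` fst C"
  then have z: "base_part z \<in> snd c ` fst c" unfolding im by simp
  note G = hermitian_metricD[OF g c(1) z]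
  show "bilinear (cover_h K g C z)"
    unfolding Ceq(3) bilinear_def skt_h_def
    by (intro conjI allI linearI; simp only: base_part_linear hopf_part_linear
        bilinear_ladd[OF G(1)] bilinear_radd[OF G(1)] bilinear_lmul[OF G(1)] bilinear_rmul[OF G(1)]
        bilinear_ladd[OF bilinear_hopf_h] bilinear_radd[OF bilinear_hopf_h]
        bilinear_lmul[OF bilinear_hopf_h] bilinear_rmul[OF bilinear_hopf_h];
        simp add: algebra_simps)
  show "cover_h K g C z U V = cover_h K g C z V U" for U V
    unfolding Ceq(3) skt_h_def by (simp only: G(2)[of "base_part U" "base_part V"] hopf_h_commute[of _ "hopf_part U"])
  show "0 < cover_h K g C z U U" if "U \<noteq> 0" for U
  proof (cases "base_part U = 0")
    case True
    have "hopf_part U \<noteq> 0" using that True by (auto simp: base_part_def hopf_part_def prod_eq_iff)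
    then have "hopf_h (hopf_part z) (hopf_part U) (hopf_part U) > 0" by (rule hopf_h_pos)
    moreover have "g c (base_part z) (base_part U) (base_part U) = 0"
      using True G(1) bilinear_lzero by metis
    ultimately show ?thesis unfolding Ceq(3) skt_h_def by simp
  next
    case False
    then show ?thesis
      unfolding Ceq(3) skt_h_def using G(3) hopf_h_nonneg by (simp add: add_pos_nonneg)
  qed
  show "cover_h K g C z (cover_I K J C z U) (cover_I K J C z V) = cover_h K g C z U V" for U V
    unfolding Ceq(2,3) by (simp add: skt_h_def skt_I_def G(4) hopf_I_isometry[OF c(2)])
next
  show "preserves_bilinear (cover K) id (cover_h K g)" using id by (simp add: hermitian_map_def)
qed

text \<open>The first argument of \<open>g\<close> varies with the point; expanding it in an orthonormal basis leaves
  coefficients of \<open>g\<close> at constant vectors, whose smoothness is known.\<close>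

lemma fundamental_form_smooth:
  assumes K: "smooth_manifold n K" and J: "complex_structure K J"
    and g: "hermitian_metric K J g" and c: "c \<in> atlas K"
  shows "smooth_on (snd c ` fst c) (\<lambda>x. fundamental_form J g c x u v)"
proof -
  obtain B where B: "onb (B :: 'b set)" using manifold_onb[OF K] by blast
  have o: "open (snd c ` fst c)" using manifold_chart[OF K c] by (simp add: is_chart_def)
  have "smooth_on (snd c ` fst c) (\<lambda>x. \<Sum>b\<in>B. (J c x u \<bullet> b) *\<^sub>R g c x b v)"
    by (intro smooth_on_sum smooth_on_scaleR smooth_on_inner smooth_on_const o
        complex_structureD(3)[OF J c] hermitian_metric_smooth[OF g c])
  moreover have "(\<Sum>b\<in>B. (J c x u \<bullet> b) *\<^sub>R g c x b v) = fundamental_form J g c x u v"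
    if "x \<in> snd c ` fst c" for x
  proof -
    have "linear (\<lambda>w. g c x w v)"
      using hermitian_metricD(1)[OF g c that] by (simp add: bilinear_def)
    from onb_linear_expansion[OF B this, of "J c x u"] show ?thesis
      unfolding fundamental_form_def by (rule sym)
  qed
  ultimately show ?thesis by (rule smooth_on_cong[OF o, rotated])
qed

lemma frechet_derivative_base_hopf_sum:
  fixes z U :: "('e::real_normed_vector \<times> 'f::real_normed_vector) \<times> 'g::real_normed_vector"
    and f :: "'e \<Rightarrow> real" and h :: "'f \<times> 'g \<Rightarrow> real"
  assumes "f differentiable at (base_part z)" "h differentiable at (hopf_part z)"
  shows "frechet_derivative (\<lambda>z. f (base_part z) + h (hopf_part z)) (at z) U =
    frechet_derivative f (at (base_part z)) (base_part U) +
    frechet_derivative h (at (hopf_part z)) (hopf_part U)"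
proof -
  have f: "(f has_derivative frechet_derivative f (at (base_part z))) (at (base_part z))"
    and h: "(h has_derivative frechet_derivative h (at (hopf_part z))) (at (hopf_part z))"
    using assms by (simp_all add: frechet_derivative_works)
  have "((\<lambda>z. f (base_part z) + h (hopf_part z)) has_derivative
      (\<lambda>U. frechet_derivative f (at (base_part z)) (base_part U) +
        frechet_derivative h (at (hopf_part z)) (hopf_part U))) (at z)"
    by (intro has_derivative_add
        diff_chain_at[OF bounded_linear_imp_has_derivative[OF bounded_linear_base_part] f, unfolded o_def]
        diff_chain_at[OF bounded_linear_imp_has_derivative[OF bounded_linear_hopf_part] h, unfolded o_def])
  then show ?thesis by (simp add: frechet_derivative_at[symmetric])
qed

text \<open>The Kaehler form is closed, so the differential of the fundamental form comes from the Hopf form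
  alone, and \<open>d\<^sup>c\<close> of it is a constant multiple of the volume form of \<open>S\<^sup>3\<close>.\<close>

lemma cover_torsion_closed:
  assumes K: "smooth_manifold n K" and J: "complex_structure K J" and g: "hermitian_metric K J g"
    and closed: "\<And>c x u v w. c \<in> atlas K \<Longrightarrow> x \<in> snd c ` fst c \<Longrightarrow>
      ext_deriv2 (fundamental_form J g c) x u v w = 0"
    and C: "C \<in> atlas (cover K)" and z: "z \<in> snd C ` fst C"
  shows "ext_deriv3 (dc_form (cover_I K J) (fundamental_form (cover_I K J) (cover_h K g)) C) z
    U V W Z = 0"
proof -
  obtain c \<epsilon> where c: "c \<in> atlas K" "\<epsilon> = 1 \<or> \<epsilon> = - 1" and Ceq: "C = cover_chart c \<epsilon>"
    "cover_I K J C = skt_I J c \<epsilon>" "cover_h K g C = skt_h g c" by (rule cover_factors[OF C])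
  note cc = manifold_chart[OF K c(1)]
  let ?S = "snd C ` fst C" and ?dc = "dc_form (cover_I K J) (fundamental_form (cover_I K J) (cover_h K g)) C"
  have im: "?S = {z. base_part z \<in> snd c ` fst c}"
    unfolding Ceq(1) by (rule cover_chart_image[OF cc c(2)])
  have o: "open ?S"
    using manifold_chart[OF smooth_manifold_prod[OF smooth_manifold_prod[OF K
            smooth_manifold_sphere3] smooth_manifold_line] C] by (simp add: is_chart_def)
  let ?\<omega> = "fundamental_form (cover_I K J) (cover_h K g) C"
  let ?\<beta> = "\<lambda>y U V W. (- (2 * \<epsilon>)) * (conf (fst y) ^ 3 * (fst U \<bullet> cross3 (fst V) (fst W)))
    :: real"
  have \<omega>: "?\<omega> = (\<lambda>y U V. fundamental_form J g c (base_part y) (base_part U) (base_part V) +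
      hopf_omega \<epsilon> (hopf_part y) (hopf_part U) (hopf_part V))"
    by (simp add: fundamental_form_def Ceq(2,3) skt_I_def skt_h_def hopf_omega_def fun_eq_iff)
  have d\<omega>: "ext_deriv2 ?\<omega> y A B D = ext_deriv2 (hopf_omega \<epsilon>) (hopf_part y)
      (hopf_part A) (hopf_part B) (hopf_part D)" if "y \<in> ?S" for y A B D
  proof -
    have y: "base_part y \<in> snd c ` fst c" using that unfolding im by simp
    have d1: "(\<lambda>x. fundamental_form J g c x u v) differentiable at (base_part y)" for u v
      using smooth_on_has_derivative[OF fundamental_form_smooth[OF K J g c(1)] y]
      by (auto simp: differentiable_def)
    have d2: "(\<lambda>x. hopf_omega \<epsilon> x u v) differentiable at (hopf_part y)" for u v
      unfolding differentiable_def by (rule exI, rule hopf_omega_has_derivative)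
    have "ext_deriv2 ?\<omega> y A B D =
        ext_deriv2 (fundamental_form J g c) (base_part y) (base_part A) (base_part B) (base_part D) +
        ext_deriv2 (hopf_omega \<epsilon>) (hopf_part y) (hopf_part A) (hopf_part B) (hopf_part D)"
      unfolding \<omega> ext_deriv2_def frechet_derivative_base_hopf_sum[OF d1 d2] by simp
    then show ?thesis using closed[OF c(1) y] by simp
  qed
  have dc: "?dc y A B D =
      0 + ?\<beta> (hopf_part y) (hopf_part A) (hopf_part B) (hopf_part D)" if "y \<in> ?S" for y A B D
    unfolding dc_form_def d\<omega>[OF that] Ceq(2)
    by (simp add: skt_I_def ext_deriv2_hopf_omega_I[OF c(2)])
  have D: "frechet_derivative
        (\<lambda>y. ?dc y A B D) (at z) E =
      frechet_derivative (\<lambda>x. ?\<beta> x (hopf_part A) (hopf_part B) (hopf_part D))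
        (at (hopf_part z)) (hopf_part E)" for A B D E
  proof -
    have "smooth_on UNIV (\<lambda>x::(real^3) \<times> real. ?\<beta> x (hopf_part A) (hopf_part B) (hopf_part D))"
      by (intro smooth_intros open_UNIV)
    from smooth_on_has_derivative[OF this UNIV_I] have d: "(\<lambda>x. ?\<beta> x (hopf_part A) (hopf_part B) (hopf_part D)) differentiable at (hopf_part z)"
      by (rule differentiableI)
    have "frechet_derivative
        (\<lambda>y. ?dc y A B D) (at z) =
      frechet_derivative
        (\<lambda>y. 0 + ?\<beta> (hopf_part y) (hopf_part A) (hopf_part B) (hopf_part D)) (at z)"
      by (rule frechet_derivative_cong_open[OF o z]) (rule dc)
    then show ?thesis
      using frechet_derivative_base_hopf_sum[OF differentiable_const d, of 0 E] by simp
  qed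
  have "ext_deriv3 (?dc) z
      U V W Z = ext_deriv3 ?\<beta> (hopf_part z) (hopf_part U) (hopf_part V) (hopf_part W) (hopf_part Z)"
    unfolding ext_deriv3_def D ..
  then show ?thesis unfolding conf_volume_closed .
qed

theorem cover_skt_structure:
  assumes "kaehler_manifold k K J g"
  shows "skt_structure (cover K) (cover_I K J) (cover_h K g)"
proof -
  have K: "smooth_manifold (2 * k) K" and J: "complex_structure K J" and g: "hermitian_metric K J g"
    and closed: "\<And>c x u v w. c \<in> atlas K \<Longrightarrow> x \<in> snd c ` fst c \<Longrightarrow>
      ext_deriv2 (fundamental_form J g c) x u v w = 0"
    using assms unfolding kaehler_manifold_def by blast+
  have "hermitian_map K J g id"
    using J g smooth_map_id[OF K]
    unfolding hermitian_map_def complex_structure_def smooth_endo_field_def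
      hermitian_metric_def riemannian_metric_def by blast
  from cover_map_hermitian[OF K this, of 0]
  have id: "hermitian_map (cover K) (cover_I K J) (cover_h K g) id" by (simp only: cover_map_id)
  show ?thesis
    unfolding skt_structure_def
    using cover_complex_structure[OF K J id] cover_hermitian_metric[OF K g id]
      cover_torsion_closed[OF K J g closed] by blast
qed

section \<open>The mapping torus\<close>

lemma diffeomorphism_times_id:
  fixes K :: "('a, 'e::real_inner) manifold" and N :: "('b, 'f::real_inner) manifold"
  assumes K: "smooth_manifold m K" and N: "smooth_manifold n N" and \<psi>: "diffeomorphism_of K \<psi>"
  shows "diffeomorphism_of (prod_manifold K N) (map_prod \<psi> id)"
    and "p \<in> topspace (topo K) \<Longrightarrow> q \<in> topspace (topo N) \<Longrightarrow>
      inv_into (topspace (topo (prod_manifold K N))) (map_prod \<psi> id) (p, q) =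
      (inv_into (topspace (topo K)) \<psi> p, q)"
proof -
  let ?S = "topspace (topo K)" and ?T = "topspace (topo N)"
  have b: "bij_betw \<psi> ?S ?S" and s: "smooth_map K K \<psi>" and i: "smooth_map K K (inv_into ?S \<psi>)"
    using \<psi> by (auto simp: diffeomorphism_of_def)
  have b': "bij_betw (map_prod \<psi> id) (?S \<times> ?T) (?S \<times> ?T)"
    using b by (intro bij_betw_map_prod) simp_all
  have inv: "inv_into (?S \<times> ?T) (map_prod \<psi> id) (p, q) = (inv_into ?S \<psi> p, q)"
    if "p \<in> ?S" "q \<in> ?T" for p q
  proof (rule inv_into_f_eq)
    show "inj_on (map_prod \<psi> id) (?S \<times> ?T)" using b' by (simp add: bij_betw_def)
    show "(inv_into ?S \<psi> p, q) \<in> ?S \<times> ?T"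
      using that b bij_betwE[OF bij_betw_inv_into[OF b]] by blast
    show "map_prod \<psi> id (inv_into ?S \<psi> p, q) = (p, q)"
      using that b by (simp add: bij_betw_inv_into_right)
  qed
  then show "p \<in> ?S \<Longrightarrow> q \<in> ?T \<Longrightarrow>
      inv_into (topspace (topo (prod_manifold K N))) (map_prod \<psi> id) (p, q) = (inv_into ?S \<psi> p, q)"
    by simp
  note KN = smooth_manifold_prod[OF K N]
  have "smooth_map (prod_manifold K N) (prod_manifold K N) (inv_into (?S \<times> ?T) (map_prod \<psi> id))"
    by (rule smooth_map_cong[OF KN smooth_map_prod[OF K K N N i smooth_map_id[OF N]] KN])
      (auto simp: inv)
  then show "diffeomorphism_of (prod_manifold K N) (map_prod \<psi> id)"
    using b' smooth_map_prod[OF K K N N s smooth_map_id[OF N]]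
    by (simp add: diffeomorphism_of_def)
qed

lemma int_funpow_times_id:
  assumes K: "smooth_manifold m K" and N: "smooth_manifold n N" and \<psi>: "diffeomorphism_of K \<psi>"
    and p: "p \<in> topspace (topo K)" and q: "q \<in> topspace (topo N)"
  shows "int_funpow (topspace (topo (prod_manifold K N))) (map_prod \<psi> id) j (p, q) =
    (int_funpow (topspace (topo K)) \<psi> j p, q)"
proof -
  let ?S = "topspace (topo K)"
  have "(map_prod \<psi> id ^^ i) (p, q) = ((\<psi> ^^ i) p, q)" for i
    by (induction i) simp_all
  moreover have "(inv_into (topspace (topo (prod_manifold K N))) (map_prod \<psi> id) ^^ i) (p, q) =
      ((inv_into ?S \<psi> ^^ i) p, q)" for i
  proof -
    define F G where "F = inv_into (topspace (topo (prod_manifold K N))) (map_prod \<psi> id)"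
      and "G = inv_into ?S \<psi>"
    have F: "F (x, q) = (G x, q)" if "x \<in> ?S" for x
      unfolding F_def G_def by (rule diffeomorphism_times_id(2)[OF K N \<psi> that q])
    have "bij_betw \<psi> ?S ?S" using \<psi> by (simp add: diffeomorphism_of_def)
    then have G: "G x \<in> ?S" if "x \<in> ?S" for x
      unfolding G_def using that bij_betwE[OF bij_betw_inv_into] by blast
    have "(F ^^ i) (p, q) = ((G ^^ i) p, q) \<and> (G ^^ i) p \<in> ?S"
      by (induction i) (simp_all add: F G p)
    then show ?thesis unfolding F_def G_def by (rule conjunct1)
  qed
  ultimately show ?thesis by (simp add: int_funpow_def)
qed

lemma hermitian_map_int_funpow:
  assumes K: "smooth_manifold n K" and \<psi>: "diffeomorphism_of K \<psi>"
    and id: "hermitian_map K J g id" and h: "hermitian_map K J g \<psi>"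
  shows "hermitian_map K J g (int_funpow (topspace (topo K)) \<psi> j)"
proof (rule int_funpow_induct[where Q = "hermitian_map K J g"])
  have i: "hermitian_map K J g (inv_into (topspace (topo K)) \<psi>)"
    by (rule hermitian_map_inverse[OF K h])
      (use \<psi> diffeomorphism_inverse[OF K \<psi>] in \<open>auto simp: diffeomorphism_of_def\<close>)
  show "hermitian_map K J g (\<psi> \<circ> f)" "hermitian_map K J g (inv_into (topspace (topo K)) \<psi> \<circ> f)"
    if "hermitian_map K J g f" for f
    by (rule hermitian_map_compose[OF K that h] hermitian_map_compose[OF K that i])+
qed (rule id)

theorem lemma3p1:
  fixes K :: "('a, 'e::real_inner) manifold"
    and J :: "('a, 'e) endo_field" and g :: "('a, 'e) form2"
    and \<psi> :: "'a \<Rightarrow> 'a" and k :: nat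
  assumes "kaehler_manifold k K J g"
    and "compact_space (topo K)"
    and "kaehler_isometry K J g \<psi>"
  defines "M \<equiv> mapping_torus (prod_manifold K sphere3) (\<lambda>(p, q). (\<psi> p, q))"
  shows "smooth_manifold (2 * k + 4) M \<and> (\<exists>I h. skt_structure M I h)"
proof -
  have K: "smooth_manifold (2 * k) K" and J: "complex_structure K J" and g: "hermitian_metric K J g"
    using assms(1) unfolding kaehler_manifold_def by blast+
  have \<psi>: "diffeomorphism_of K \<psi>" using assms(3) by (simp add: kaehler_isometry_def)
  have h\<psi>: "hermitian_map K J g \<psi>"
    using assms(3) by (simp add: kaehler_isometry_def hermitian_map_def diffeomorphism_of_def)
  have hid: "hermitian_map K J g id"
    using J g smooth_map_id[OF K]
    unfolding hermitian_map_def complex_structure_def smooth_endo_field_def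
      hermitian_metric_def riemannian_metric_def by blast
  let ?N = "prod_manifold K sphere3" and ?f = "map_prod \<psi> id :: 'a \<times> (real^3) \<times> real \<Rightarrow> _"
  let ?S = "topspace (topo ?N)"
  have N: "smooth_manifold (2 * k + 3) ?N"
    by (rule smooth_manifold_prod[OF K smooth_manifold_sphere3])
  have f: "diffeomorphism_of ?N ?f"
    by (rule diffeomorphism_times_id(1)[OF K smooth_manifold_sphere3 \<psi>])
  have "(\<lambda>(p, q). (\<psi> p, q)) = ?f" by auto
  then have M: "M = quotient_manifold (cover K) (mapping_torus_orbit ?S ?f)"
    unfolding M_def mapping_torus_def by simp
  interpret deck_quotient "cover K" "2 * k + 3 + 1" "mapping_torus_orbit ?S ?f"
    "range (torus_deck ?S ?f)"
    by (rule mapping_torus_is_deck_quotient[OF N f])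
  have "hermitian_map (cover K) (cover_I K J) (cover_h K g) F"
    if F: "F \<in> range (torus_deck ?S ?f)" for F
  proof -
    obtain j where j: "F = torus_deck ?S ?f j" using F by blast
    show ?thesis
    proof (rule hermitian_map_cong[OF manifold])
      show "hermitian_map (cover K) (cover_I K J) (cover_h K g)
          (cover_map (int_funpow (topspace (topo K)) \<psi> j) (of_int j))"
        by (rule cover_map_hermitian[OF K hermitian_map_int_funpow[OF K \<psi> hid h\<psi>]])
      fix p assume p: "p \<in> topspace (topo (cover K))"
      obtain a q t where a: "p = ((a, q), t)" by (metis prod.collapse)
      then have "a \<in> topspace (topo K)" "q \<in> topspace (topo sphere3)" using p by auto
      from int_funpow_times_id[OF K smooth_manifold_sphere3 \<psi> this]
      show "cover_map (int_funpow (topspace (topo K)) \<psi> j) (of_int j) p = F p"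
        by (simp add: a j cover_map_def torus_deck_def)
    qed
  qed
  from descend_skt_structure[OF this cover_skt_structure[OF assms(1)]]
  have "skt_structure M (descend (cover_I K J)) (descend (cover_h K g))"
    unfolding M .
  moreover have "2 * k + 3 + 1 = 2 * k + (4::nat)" by simp
  then have "smooth_manifold (2 * k + 4) M"
    using quotient_smooth_manifold unfolding M by (simp only:)
  ultimately show ?thesis by blast
qed

end
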